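(* Let $\mathbb{F}_q$ have characteristic $p>2$, let $d<q$, $s\ge1$, $\boldsymbol{a}\in\mathbb{F}_q^s$, and $m,n$ integers with $1\le m,n\le d$ and $d-s+1\le m+n\le 2d$. If either $d-s\ge4$ and $p>3$, or $d-s\ge6$ and $p=3$, then the singular locus of $\Gamma^*_{m,n}$ has codimension at least $2$ in $\Gamma^*_{m,n}$.
   Context: Let $\boldsymbol{a}=(a_{d-1},\dots,a_{d-s})$, $\boldsymbol{B}=(B_{d-s-1},\dots,B_1)$, $F:=T^d+\sum_{i=d-s}^{d-1}a_iT^i+\sum_{i=1}^{d-s-1}B_iT^i+B\in\mathbb{F}_q[\boldsymbol{B},B,T]$. Divided differences of a univariate $g$: $\Delta^0g:=g(X_1)$, $\Delta^ig(X_1,\dots,X_{i+1}):=\big(\Delta^{i-1}g(X_1,\dots,X_i)-\Delta^{i-1}g(X_1,\dots,X_{i-1},X_{i+1})\big)/(X_i-X_{i+1})$; $\Delta^{i-1}F(\boldsymbol{b},c,X_1,\dots,X_i)$ denotes that of $F(\boldsymbol{b},c,T)$. $\Gamma^*_{m,n}\subset\mathbb{A}^{d-s+1+m+n}=\overline{\mathbb{F}}_q^{\,d-s+1+m+n}$ is the set of $(\boldsymbol{b},b_{0,1},b_{0,2},\boldsymbol{\alpha},\boldsymbol{\beta})$, $\boldsymbol{\alpha}\in\mathbb{A}^m$, $\boldsymbol{\beta}\in\mathbb{A}^n$, with $\Delta^{i-1}F(\boldsymbol{b},b_{0,1},\alpha_1,\dots,\alpha_i)=0$ for $1\le i\le m$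 and $\Delta^{j-1}F(\boldsymbol{b},b_{0,2},\beta_1,\dots,\beta_j)=0$ for $1\le j\le n$. *)

theory Defs
  imports
    "HOL-Library.Poly_Mapping"
    "HOL-Library.Extended_Nat"
    "HOL-Library.Function_Algebras"
    "HOL-Computational_Algebra.Polynomial"
    "HOL-Algebra.Algebraic_Closure_Type"
begin

section \<open>Multivariate polynomials\<close>

text \<open>
  A polynomial over \<open>'a\<close> in variables indexed by \<open>'v\<close> is a finitely supported function on
  monomials; a monomial is the finitely supported function of its exponents. The ring operations
  are those of \<^theory>\<open>HOL-Library.Poly_Mapping\<close>.
\<close>

type_synonym ('v, 'a) mpoly = "('v \<Rightarrow>\<^sub>0 nat) \<Rightarrow>\<^sub>0 'a"

definition mp_const :: "'a \<Rightarrow> ('v, 'a::zero) mpoly" where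
  "mp_const c = Poly_Mapping.single 0 c"

definition mp_var :: "'v \<Rightarrow> ('v, 'a::zero_neq_one) mpoly" where
  "mp_var i = Poly_Mapping.single (Poly_Mapping.single i 1) 1"

text \<open>
  Image of \<open>f\<close> under the map sending the variable \<open>i\<close> to \<open>x i\<close> and acting on coefficients by \<open>h\<close>:
  evaluation at a point for \<open>h = id\<close>, substitution of polynomials for \<open>h = mp_const\<close>.
\<close>

definition mp_eval :: "('a::zero \<Rightarrow> 'b) \<Rightarrow> ('v \<Rightarrow> 'b) \<Rightarrow> ('v, 'a) mpoly \<Rightarrow> 'b::comm_semiring_1" where
  "mp_eval h x f = (\<Sum>m\<in>Poly_Mapping.keys f.
     h (Poly_Mapping.lookup f m) * (\<Prod>i\<in>Poly_Mapping.keys m. x i ^ Poly_Mapping.lookup m i))"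

text \<open>
  The formal partial derivative. Subtraction of exponents is truncated, which is harmless since
  the coefficient is zero if the variable \<open>i\<close> does not occur in the monomial.
\<close>

definition mp_deriv :: "'v \<Rightarrow> ('v, 'a::comm_semiring_1) mpoly \<Rightarrow> ('v, 'a) mpoly" where
  "mp_deriv i f = (\<Sum>m\<in>Poly_Mapping.keys f.
     Poly_Mapping.single (m - Poly_Mapping.single i 1)
       (of_nat (Poly_Mapping.lookup m i) * Poly_Mapping.lookup f m))"

definition mp_vars_in :: "'v set \<Rightarrow> ('v, 'a::zero) mpoly set" where
  "mp_vars_in I = {f. \<forall>m\<in>Poly_Mapping.keys f. Poly_Mapping.keys m \<subseteq> I}"


section \<open>Affine algebraic geometry\<close>

text \<open>
  The affine space whose coordinates are indexed by the finite set \<open>I\<close>. The values outside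
  \<open>I\<close> are fixed to zero, so that points correspond bijectively to families indexed by \<open>I\<close>.
\<close>

definition affine_space :: "'v set \<Rightarrow> ('v \<Rightarrow> 'a::zero) set" where
  "affine_space I = {x. \<forall>i. i \<notin> I \<longrightarrow> x i = 0}"

definition zariski_closed :: "'v set \<Rightarrow> ('v \<Rightarrow> 'a::comm_semiring_1) set \<Rightarrow> bool" where
  "zariski_closed I V \<longleftrightarrow>
     (\<exists>S\<subseteq>mp_vars_in I. V = {x\<in>affine_space I. \<forall>f\<in>S. mp_eval id x f = 0})"

definition vanishing_ideal :: "'v set \<Rightarrow> ('v \<Rightarrow> 'a::comm_semiring_1) set \<Rightarrow> ('v, 'a) mpoly set" where
  "vanishing_ideal I V = {f\<in>mp_vars_in I. \<forall>x\<in>V. mp_eval id x f = 0}"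

definition irreducible_closed :: "'v set \<Rightarrow> ('v \<Rightarrow> 'a::comm_semiring_1) set \<Rightarrow> bool" where
  "irreducible_closed I V \<longleftrightarrow> zariski_closed I V \<and> V \<noteq> {} \<and>
     (\<forall>A B. zariski_closed I A \<longrightarrow> zariski_closed I B \<longrightarrow> V = A \<union> B \<longrightarrow> V = A \<or> V = B)"

definition irreducible_component ::
    "'v set \<Rightarrow> ('v \<Rightarrow> 'a::comm_semiring_1) set \<Rightarrow> ('v \<Rightarrow> 'a) set \<Rightarrow> bool" where
  "irreducible_component I V C \<longleftrightarrow> irreducible_closed I C \<and> C \<subseteq> V \<and>
     (\<forall>D. irreducible_closed I D \<longrightarrow> D \<subseteq> V \<longrightarrow> C \<subseteq> D \<longrightarrow> D = C)"

definition irreducible_chain ::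
    "'v set \<Rightarrow> ('v \<Rightarrow> 'a::comm_semiring_1) set \<Rightarrow> nat \<Rightarrow> (nat \<Rightarrow> ('v \<Rightarrow> 'a) set) \<Rightarrow> bool" where
  "irreducible_chain I V k Z \<longleftrightarrow>
     (\<forall>i\<le>k. irreducible_closed I (Z i) \<and> Z i \<subseteq> V) \<and> (\<forall>i<k. Z i \<subset> Z (Suc i))"

text \<open>Only used for nonempty \<open>V\<close>, so that no convention for the empty set is needed.\<close>

definition variety_dim :: "'v set \<Rightarrow> ('v \<Rightarrow> 'a::comm_semiring_1) set \<Rightarrow> enat" where
  "variety_dim I V = Sup {enat k | k Z. irreducible_chain I V k Z}"

definition local_dim :: "'v set \<Rightarrow> ('v \<Rightarrow> 'a::comm_semiring_1) set \<Rightarrow> ('v \<Rightarrow> 'a) \<Rightarrow> enat" where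
  "local_dim I V x = Sup (variety_dim I ` {C. irreducible_component I V C \<and> x \<in> C})"

text \<open>
  The codimension of a closed subset \<open>W\<close> of a variety \<open>V\<close>: for irreducible \<open>W\<close> the supremum of the
  lengths of chains of irreducible closed subsets of \<open>V\<close> starting at \<open>W\<close>, in general the infimum
  over the irreducible closed subsets of \<open>W\<close>. It is infinite for empty \<open>W\<close>, and agrees with the
  difference of the dimensions if \<open>V\<close> is equidimensional and \<open>W\<close> is nonempty.
\<close>

definition codim :: "'v set \<Rightarrow> ('v \<Rightarrow> 'a::comm_semiring_1) set \<Rightarrow> ('v \<Rightarrow> 'a) set \<Rightarrow> enat" where
  "codim I V W = Inf {Sup {enat k | k Z. irreducible_chain I V k Z \<and> Z 0 = Y} | Y.
     irreducible_closed I Y \<and> Y \<subseteq> W}"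

definition tangent_space ::
    "'v set \<Rightarrow> ('v \<Rightarrow> 'a::comm_semiring_1) set \<Rightarrow> ('v \<Rightarrow> 'a) \<Rightarrow> ('v \<Rightarrow> 'a) set" where
  "tangent_space I V x =
     {v\<in>affine_space I. \<forall>f\<in>vanishing_ideal I V. (\<Sum>i\<in>I. mp_eval id x (mp_deriv i f) * v i) = 0}"

lemma vector_space_pointwise:
  "vector_space (\<lambda>c (v :: 'v \<Rightarrow> 'a::field) i. c * v i)"
  by unfold_locales (auto simp: algebra_simps)

definition singular_locus :: "'v set \<Rightarrow> ('v \<Rightarrow> 'a::field) set \<Rightarrow> ('v \<Rightarrow> 'a) set" where
  "singular_locus I V = {x\<in>V.
     enat (vector_space.dim (\<lambda>c v i. c * v i) (tangent_space I V x)) \<noteq> local_dim I V x}"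


section \<open>Divided differences\<close>

text \<open>
  \<open>divdiff g i\<close> is the \<open>i\<close>-th divided difference of \<open>g\<close>, a polynomial in the variables
  \<open>1, \<dots>, i + 1\<close>. The quotient is taken in the polynomial ring; it exists and is unique by
  \<open>divdiff_Suc\<close> and \<open>divdiff_unique\<close> below.
\<close>

primrec divdiff :: "'a::field poly \<Rightarrow> nat \<Rightarrow> (nat, 'a) mpoly" where
  "divdiff g 0 = (\<Sum>k\<le>Polynomial.degree g. mp_const (poly.coeff g k) * mp_var 1 ^ k)"
| "divdiff g (Suc i) = (THE h. h * (mp_var (i + 1) - mp_var (i + 2)) =
     divdiff g i - mp_eval mp_const (mp_var(i + 1 := mp_var (i + 2))) (divdiff g i))"

lemma mp_var_power: "mp_var i ^ k = Poly_Mapping.single (Poly_Mapping.single i k) (1::'a::comm_semiring_1)"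
  by (induction k) (simp_all add: mp_var_def mult_single single_add[symmetric])

lemma prod_mp_var:
  assumes "finite A"
  shows "(\<Prod>i\<in>A. mp_var i ^ e i) =
    Poly_Mapping.single (\<Sum>i\<in>A. Poly_Mapping.single i (e i)) (1::'a::comm_semiring_1)"
  using assms by (induction A rule: finite_induct) (simp_all add: mp_var_power mult_single)

lemma sum_single_keys:
  "(\<Sum>i\<in>Poly_Mapping.keys f. Poly_Mapping.single i (Poly_Mapping.lookup f i)) = f"
  by (rule poly_mapping_eqI)
     (auto simp: lookup_sum lookup_single when_def in_keys_iff)

lemma mp_eval_var: "mp_eval mp_const mp_var f = (f :: ('v, 'a::comm_semiring_1) mpoly)"
proof -
  have "mp_eval mp_const mp_var f =
      (\<Sum>m\<in>Poly_Mapping.keys f. Poly_Mapping.single m (Poly_Mapping.lookup f m))"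
    unfolding mp_eval_def
    by (intro sum.cong refl) (simp add: prod_mp_var sum_single_keys mp_const_def mult_single)
  then show ?thesis
    by (simp add: sum_single_keys)
qed

lemma dvd_prod_diff:
  fixes f g :: "'b \<Rightarrow> 'a::comm_ring_1"
  assumes "finite A" "\<And>i. i \<in> A \<Longrightarrow> r dvd f i - g i"
  shows "r dvd prod f A - prod g A"
  using assms
proof (induction A rule: finite_induct)
  case (insert a A)
  have "prod f (insert a A) - prod g (insert a A) =
      (f a - g a) * prod f A + g a * (prod f A - prod g A)"
    using insert by (simp add: algebra_simps)
  then show ?case
    using insert by (metis dvd_add dvd_mult dvd_mult2 insertCI)
qed simp

lemma dvd_diff_subst:
  fixes f :: "('v, 'a::comm_ring_1) mpoly"
  shows "mp_var i - mp_var j dvd f - mp_eval mp_const (mp_var(i := mp_var j)) f"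
proof -
  let ?y = "mp_var(i := mp_var j) :: 'v \<Rightarrow> ('v, 'a) mpoly"
  have "mp_var i - mp_var j dvd mp_var k ^ e - ?y k ^ e" for k e
  proof -
    have "mp_var k - ?y k dvd mp_var k ^ e - ?y k ^ e"
      by (metis dvd_triv_left power_diff_sumr2)
    moreover have "mp_var i - mp_var j dvd mp_var k - ?y k"
      by simp
    ultimately show ?thesis
      by (rule dvd_trans[rotated])
  qed
  then have "mp_var i - mp_var j dvd mp_eval mp_const mp_var f - mp_eval mp_const ?y f"
    unfolding mp_eval_def sum_subtractf[symmetric] right_diff_distrib[symmetric]
    by (intro dvd_sum dvd_mult dvd_prod_diff) auto
  then show ?thesis
    by (simp add: mp_eval_var)
qed

lemma mp_var_inject: "mp_var i = (mp_var j :: ('v, 'a::zero_neq_one) mpoly) \<longleftrightarrow> i = j"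
  by (metis (no_types) keys_single mp_var_def one_neq_zero singleton_inject)

lemma divdiff_unique:
  fixes h h' :: "(nat, 'a::field) mpoly"
  assumes "h * (mp_var (i + 1) - mp_var (i + 2)) = h' * (mp_var (i + 1) - mp_var (i + 2))"
  shows "h = h'"
proof -
  have "mp_var (i + 1) - mp_var (i + 2) \<noteq> (0 :: (nat, 'a) mpoly)"
    by (simp add: mp_var_inject)
  with assms show ?thesis
    by simp
qed

lemma divdiff_Suc:
  "divdiff g (Suc i) * (mp_var (i + 1) - mp_var (i + 2)) =
     divdiff g i - mp_eval mp_const (mp_var(i + 1 := mp_var (i + 2))) (divdiff g i)"
proof -
  obtain h where h: "h * (mp_var (i + 1) - mp_var (i + 2)) =
      divdiff g i - mp_eval mp_const (mp_var(i + 1 := mp_var (i + 2))) (divdiff g i)"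
    using dvd_diff_subst[of "i + 1" "i + 2" "divdiff g i"] by (metis dvdE mult.commute)
  then show ?thesis
    unfolding divdiff.simps by (rule theI) (rule divdiff_unique[where i = i], simp only: h)
qed


section \<open>The variety\<close>

text \<open>
  The polynomial \<open>F(b, c, T)\<close> in \<open>T\<close>, where \<open>a\<close> is used at the indices \<open>d - s, \<dots>, d - 1\<close> and
  \<open>b\<close> at the indices \<open>1, \<dots>, d - s - 1\<close>.
\<close>

definition F_poly ::
    "nat \<Rightarrow> nat \<Rightarrow> (nat \<Rightarrow> 'k::field) \<Rightarrow> (nat \<Rightarrow> 'k alg_closure) \<Rightarrow> 'k alg_closure \<Rightarrow> 'k alg_closure poly" where
  "F_poly d s a b c = Polynomial.monom 1 d
     + (\<Sum>i=d-s..d-1. Polynomial.monom (to_ac (a i)) i)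
     + (\<Sum>i=1..d-s-1. Polynomial.monom (b i) i) + [:c:]"

text \<open>The names of the coordinates \<open>b\<^sub>i\<close>, \<open>b\<^sub>0\<^sub>,\<^sub>1\<close>, \<open>b\<^sub>0\<^sub>,\<^sub>2\<close>, \<open>\<alpha>\<^sub>i\<close> and \<open>\<beta>\<^sub>j\<close>.\<close>

datatype coord = B nat | B01 | B02 | Alpha nat | Beta nat

definition coords :: "nat \<Rightarrow> nat \<Rightarrow> nat \<Rightarrow> nat \<Rightarrow> coord set" where
  "coords d s m n = B ` {1..d-s-1} \<union> {B01, B02} \<union> Alpha ` {1..m} \<union> Beta ` {1..n}"

definition Gamma_star ::
    "nat \<Rightarrow> nat \<Rightarrow> (nat \<Rightarrow> 'k::field) \<Rightarrow> nat \<Rightarrow> nat \<Rightarrow> (coord \<Rightarrow> 'k alg_closure) set" where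
  "Gamma_star d s a m n = {x\<in>affine_space (coords d s m n).
     (\<forall>i\<in>{1..m}. mp_eval id (\<lambda>k. x (Alpha k))
        (divdiff (F_poly d s a (\<lambda>k. x (B k)) (x B01)) (i - 1)) = 0) \<and>
     (\<forall>j\<in>{1..n}. mp_eval id (\<lambda>k. x (Beta k))
        (divdiff (F_poly d s a (\<lambda>k. x (B k)) (x B02)) (j - 1)) = 0)}"

end

theory Submission
  imports Defs
begin

text \<open>
  Divided differences are Newton coefficients, so \<open>\<Gamma>*\<close> consists of the points for which
  \<open>\<Prod>(T - \<alpha>\<^sub>i)\<close> divides \<open>F(b, b\<^sub>0\<^sub>,\<^sub>1, T)\<close> and \<open>\<Prod>(T - \<beta>\<^sub>j)\<close> divides \<open>F(b, b\<^sub>0\<^sub>,\<^sub>2, T)\<close>. One root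
  \<open>\<alpha>\<^sub>i\<close> determines \<open>b\<^sub>0\<^sub>,\<^sub>1\<close>, and the remaining coordinates are roots of monic polynomials. Thus \<open>\<Gamma>*\<close> is
  a tower of monic extensions of the affine space with coordinates \<open>(b, b\<^sub>0\<^sub>,\<^sub>2, \<alpha>\<^sub>i)\<close>, and the
  projection to this space is open with finite fibres. Irreducible sets in \<open>\<Gamma>*\<close> can therefore be
  enlarged over any irreducible set containing their projection, which gives local dimension
  \<open>d - s + 1\<close> everywhere. Since the extensions are generically separable, the equations of
  the tower generate the vanishing ideal, and every tangent space has dimension at least
  \<open>d - s + 1\<close>.

  At a singular point some \<open>\<alpha>\<^sub>i\<close> or \<open>\<beta>\<^sub>j\<close>, say \<open>\<alpha>\<^sub>i\<close>, is a multiple root, i.e. \<open>F'(b, \<alpha>\<^sub>i) = 0\<close>, which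
  is a hypersurface in the base. Over a generic point of it \<open>\<alpha>\<^sub>i\<close> is a double root and
  all other roots of both polynomials are simple; there the tangent space still injects into
  that of the base, so the point is nonsingular. Enlarging an irreducible subset of the singular
  locus first over the hypersurface and then over the whole base is a chain of length two.
\<close>

text \<open>One root coordinate belongs to the base so that multiplicity of this root becomes an
  equation in base coordinates; the free coefficient of T enters it linearly with factor 1.
  Genericity comes from perturbing by powers of T - x. If F = (T - x)^e H, adding s(T - x)^(e+1) and
  t(T - x)^e replaces H by H + s(T - x) + t and keeps the factor (T - x)^e. The linear term prevents
  H' from vanishing identically, which can happen in characteristic p; the constant then makes the
  roots of H simple. For e = 2 a cubic is added, whence \<open>3 \<le> N\<close>, that is, at least
  three free nonconstant coefficients. Where two coordinates share a double root x, the equation F =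
  0 at the second one has no differential in that coordinate. The injectivity of the tangent space
  rests there on another function vanishing on the variety: F divided by T minus the first root,
  evaluated at the second, whose derivative is H(x), a nonzero number. The upper bound for
  dimensions is a count: a chain of length k gives t^k independent functions of degree linear in t,
  while a tower over r coordinates has room for a constant times t^r.\<close>

lemma infinite_UNIV_alg_closed: "infinite (UNIV :: 'a::alg_closed_field set)"
proof
  assume fin: "finite (UNIV :: 'a set)"
  let ?P = "\<Prod>a\<in>(UNIV :: 'a set). [:-a, 1:]"
  have "degree ?P = card (UNIV :: 'a set)"
    by (subst degree_prod_eq_sum_degree) auto
  moreover have "card (UNIV :: 'a set) > 0"
    using fin by (simp add: card_gt_0_iff)
  ultimately have "degree (?P + 1) > 0"
    by (subst degree_add_eq_left) auto
  then obtain x where "poly (?P + 1) x = 0"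
    using alg_closed_imp_poly_has_root by blast
  moreover have "poly ?P x = 0"
    using fin by (auto simp: poly_prod)
  ultimately show False
    by simp
qed

lemma poly_eqI_finite:
  fixes P Q :: "'a::alg_closed_field poly"
  assumes "finite S" "\<And>s. s \<notin> S \<Longrightarrow> poly P s = poly Q s"
  shows "P = Q"
proof (rule ccontr)
  assume "P \<noteq> Q"
  then have "finite ({x. poly (P - Q) x = 0} \<union> S)"
    using assms(1) poly_roots_finite[of "P - Q"] by simp
  moreover have "{x. poly (P - Q) x = 0} \<union> S = UNIV"
    using assms(2) by auto
  ultimately show False
    using infinite_UNIV_alg_closed by metis
qed

section \<open>Regular functions\<close>

text \<open>Polynomial functions instead of formal polynomials: over an infinite field nothing is
  lost, and closure properties become introduction rules. The functions are defined on all families,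
  but by \<open>reg_cong\<close> only the coordinates in \<open>I\<close> count.\<close>

inductive_set reg :: "'v set \<Rightarrow> (('v \<Rightarrow> 'a::comm_ring_1) \<Rightarrow> 'a) set" for I where
  const: "(\<lambda>x. c) \<in> reg I"
| coord: "i \<in> I \<Longrightarrow> (\<lambda>x. x i) \<in> reg I"
| add: "f \<in> reg I \<Longrightarrow> g \<in> reg I \<Longrightarrow> (\<lambda>x. f x + g x) \<in> reg I"
| mult: "f \<in> reg I \<Longrightarrow> g \<in> reg I \<Longrightarrow> (\<lambda>x. f x * g x) \<in> reg I"

lemma reg_uminus: "f \<in> reg I \<Longrightarrow> (\<lambda>x. - f x) \<in> reg I"
  using reg.mult[OF reg.const[of "-1"]] by fastforce

lemma reg_diff: "f \<in> reg I \<Longrightarrow> g \<in> reg I \<Longrightarrow> (\<lambda>x. f x - g x) \<in> reg I"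
  using reg.add[OF _ reg_uminus] by fastforce

lemma reg_power: "f \<in> reg I \<Longrightarrow> (\<lambda>x. f x ^ k) \<in> reg I"
  by (induction k) (auto intro: reg.intros)

lemma reg_sum: "(\<And>i. i \<in> S \<Longrightarrow> f i \<in> reg I) \<Longrightarrow> (\<lambda>x. \<Sum>i\<in>S. f i x) \<in> reg I"
  by (induction S rule: infinite_finite_induct) (auto intro: reg.intros)

lemma reg_prod: "(\<And>i. i \<in> S \<Longrightarrow> f i \<in> reg I) \<Longrightarrow> (\<lambda>x. \<Prod>i\<in>S. f i x) \<in> reg I"
  by (induction S rule: infinite_finite_induct) (auto intro: reg.intros)

lemmas reg_intros = reg.intros reg_uminus reg_diff reg_power reg_sum reg_prod

lemma reg_mono: "f \<in> reg I \<Longrightarrow> I \<subseteq> J \<Longrightarrow> f \<in> reg J"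
  by (induction rule: reg.induct) (auto intro: reg.intros)

lemma reg_cong: "f \<in> reg I \<Longrightarrow> (\<And>i. i \<in> I \<Longrightarrow> x i = y i) \<Longrightarrow> f x = f y"
  by (induction rule: reg.induct) auto

text \<open>Restriction to a polynomial curve reduces questions in many variables to univariate
  polynomials; irreducibility proofs and generic choices both rely on it.\<close>

lemma reg_path: "f \<in> reg I \<Longrightarrow> \<exists>P. \<forall>s. f (\<lambda>i. poly (\<gamma> i) s) = poly P s"
proof (induction rule: reg.induct)
  case (const c)
  show ?case
    by (rule exI[of _ "[:c:]"]) simp
next
  case (add f g)
  then show ?case
    by (metis poly_add)
next
  case (mult f g)
  then show ?case
    by (metis poly_mult)
qed auto

lemma reg_line: "f \<in> reg I \<Longrightarrow> \<exists>P. \<forall>s. poly P s = f (\<lambda>i. x i + s * w i)"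
  using reg_path[of f I "\<lambda>i. [:x i, w i:]"] by auto

text \<open>The coefficient of \<open>s\<close> in \<open>f (x + s w)\<close>, a derivative that
  sees only the values of \<open>f\<close> on a line. Over an algebraically closed field
  \<open>P\<close> is unique because the field is infinite.\<close>

definition dir_deriv :: "(('v \<Rightarrow> 'a::comm_ring_1) \<Rightarrow> 'a) \<Rightarrow> ('v \<Rightarrow> 'a) \<Rightarrow> ('v \<Rightarrow> 'a) \<Rightarrow> 'a" where
  "dir_deriv f x w = coeff (THE P. \<forall>s. poly P s = f (\<lambda>i. x i + s * w i)) 1"

lemma dir_deriv_eqI:
  fixes P :: "'a::alg_closed_field poly"
  assumes "\<And>s. f (\<lambda>i. x i + s * w i) = poly P s"
  shows "dir_deriv f x w = coeff P 1"
proof -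
  have "(THE P. \<forall>s. poly P s = f (\<lambda>i. x i + s * w i)) = P"
    using assms by (intro the_equality) (auto intro!: poly_eqI_finite[of "{}"])
  then show ?thesis
    by (simp add: dir_deriv_def)
qed

lemma dir_deriv_const: "dir_deriv (\<lambda>x. c) x w = (0::'a::alg_closed_field)"
  by (subst dir_deriv_eqI[where P = "[:c:]"]) auto

lemma dir_deriv_coord: "dir_deriv (\<lambda>x. x i) x w = (w i::'a::alg_closed_field)"
  by (subst dir_deriv_eqI[where P = "[:x i, w i:]"]) auto

lemma dir_deriv_add:
  fixes f :: "('v \<Rightarrow> 'a::alg_closed_field) \<Rightarrow> 'a"
  assumes "f \<in> reg I" "g \<in> reg I"
  shows "dir_deriv (\<lambda>x. f x + g x) x w = dir_deriv f x w + dir_deriv g x w"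
proof -
  obtain P where P: "\<And>s. poly P s = f (\<lambda>i. x i + s * w i)"
    using reg_line[OF assms(1)] by blast
  obtain Q where Q: "\<And>s. poly Q s = g (\<lambda>i. x i + s * w i)"
    using reg_line[OF assms(2)] by blast
  show ?thesis
    using dir_deriv_eqI[of f x w P] dir_deriv_eqI[of g x w Q] dir_deriv_eqI[of "\<lambda>x. f x + g x" x w "P + Q"]
    by (simp add: P Q)
qed

lemma dir_deriv_mult:
  fixes f :: "('v \<Rightarrow> 'a::alg_closed_field) \<Rightarrow> 'a"
  assumes "f \<in> reg I" "g \<in> reg I"
  shows "dir_deriv (\<lambda>x. f x * g x) x w = f x * dir_deriv g x w + dir_deriv f x w * g x"
proof -
  obtain P where P: "\<And>s. poly P s = f (\<lambda>i. x i + s * w i)"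
    using reg_line[OF assms(1)] by blast
  obtain Q where Q: "\<And>s. poly Q s = g (\<lambda>i. x i + s * w i)"
    using reg_line[OF assms(2)] by blast
  have "coeff P 0 = f x" "coeff Q 0 = g x"
    using P[of 0] Q[of 0] by (auto simp: poly_0_coeff_0)
  then show ?thesis
    using dir_deriv_eqI[of f x w P] dir_deriv_eqI[of g x w Q] dir_deriv_eqI[of "\<lambda>x. f x * g x" x w "P * Q"]
    by (simp add: P Q coeff_mult)
qed

lemma dir_deriv_sum:
  fixes f :: "'i \<Rightarrow> ('v \<Rightarrow> 'a::alg_closed_field) \<Rightarrow> 'a"
  assumes "\<And>i. i \<in> S \<Longrightarrow> f i \<in> reg I"
  shows "dir_deriv (\<lambda>x. \<Sum>i\<in>S. f i x) x w = (\<Sum>i\<in>S. dir_deriv (f i) x w)"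
  using assms
  by (induction S rule: infinite_finite_induct) (simp_all add: dir_deriv_const dir_deriv_add[where I = I] reg_sum)

lemma dir_deriv_linear:
  fixes f :: "('v \<Rightarrow> 'a::alg_closed_field) \<Rightarrow> 'a"
  assumes "f \<in> reg I"
  shows "dir_deriv f x (\<lambda>i. a * v i + b * w i) = a * dir_deriv f x v + b * dir_deriv f x w"
  using assms
  by (induction rule: reg.induct)
    (simp_all add: dir_deriv_const dir_deriv_coord dir_deriv_add[where I = I] dir_deriv_mult[where I = I] algebra_simps)

lemma dir_deriv_power:
  fixes w :: "'v \<Rightarrow> 'a::alg_closed_field"
  shows "dir_deriv (\<lambda>x. x i ^ k) x w = of_nat k * x i ^ (k - 1) * w i"
proof (induction k)
  case (Suc k)
  have "dir_deriv (\<lambda>x. x i * x i ^ k) x w = x i * dir_deriv (\<lambda>x. x i ^ k) x w + dir_deriv (\<lambda>x. x i) x w * x i ^ k"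
    by (rule dir_deriv_mult[where I = UNIV]) (auto intro!: reg_intros)
  also have "\<dots> = of_nat (Suc k) * x i ^ (Suc k - 1) * w i"
    unfolding Suc dir_deriv_coord by (cases k) (auto simp: algebra_simps)
  finally show ?case
    by simp
qed (simp add: dir_deriv_const)

lemma dir_deriv_prod_power:
  fixes w :: "'v \<Rightarrow> 'a::alg_closed_field"
  assumes "finite S"
  shows "dir_deriv (\<lambda>x. \<Prod>i\<in>S. x i ^ e i) x w =
    (\<Sum>i\<in>S. of_nat (e i) * (\<Prod>j\<in>S. x j ^ (if j = i then e j - 1 else e j)) * w i)"
  using assms
proof (induction S rule: finite_induct)
  case (insert a S)
  have "dir_deriv (\<lambda>x. \<Prod>i\<in>insert a S. x i ^ e i) x w = dir_deriv (\<lambda>x. x a ^ e a * (\<Prod>i\<in>S. x i ^ e i)) x w"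
    using insert by simp
  also have "\<dots> = x a ^ e a * dir_deriv (\<lambda>x. \<Prod>i\<in>S. x i ^ e i) x w
      + dir_deriv (\<lambda>x. x a ^ e a) x w * (\<Prod>i\<in>S. x i ^ e i)"
    by (rule dir_deriv_mult[where I = UNIV]) (auto intro!: reg_intros)
  also have "(\<Prod>i\<in>S. x i ^ e i) = (\<Prod>j\<in>S. x j ^ (if j = a then e j - 1 else e j))"
    using insert by (intro prod.cong) auto
  also have "x a ^ e a * dir_deriv (\<lambda>x. \<Prod>i\<in>S. x i ^ e i) x w = (\<Sum>i\<in>S. of_nat (e i) *
      (\<Prod>j\<in>insert a S. x j ^ (if j = i then e j - 1 else e j)) * w i)"
    unfolding insert sum_distrib_left using insert by (intro sum.cong) (auto simp: algebra_simps)
  also have "\<dots> + dir_deriv (\<lambda>x. x a ^ e a) x w * (\<Prod>j\<in>S. x j ^ (if j = a then e j - 1 else e j)) =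
      (\<Sum>i\<in>insert a S. of_nat (e i) *
      (\<Prod>j\<in>insert a S. x j ^ (if j = i then e j - 1 else e j)) * w i)"
    using insert by (simp add: dir_deriv_power algebra_simps)
  finally show ?case .
qed (simp add: dir_deriv_const)

subsection \<open>Comparison with polynomials\<close>

lemma mp_eval_id_superset:
  fixes f :: "('v, 'a::comm_semiring_1) mpoly"
  assumes "finite S" "Poly_Mapping.keys f \<subseteq> S"
    and "\<And>m. m \<in> S \<Longrightarrow> Poly_Mapping.keys m \<subseteq> J m" "\<And>m. m \<in> S \<Longrightarrow> finite (J m)"
  shows "mp_eval id x f =
    (\<Sum>m\<in>S. Poly_Mapping.lookup f m * (\<Prod>i\<in>J m. x i ^ Poly_Mapping.lookup m i))"
proof -
  have *: "(\<Prod>i\<in>Poly_Mapping.keys m. x i ^ Poly_Mapping.lookup m i)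
      = (\<Prod>i\<in>J m. x i ^ Poly_Mapping.lookup m i)" if "m \<in> S" for m
    using assms(3,4)[OF that] by (intro prod.mono_neutral_left) (auto simp: in_keys_iff)
  show ?thesis
    unfolding mp_eval_def using assms(1,2) *
    by (intro sum.mono_neutral_cong_left) (auto simp: in_keys_iff)
qed

lemma mp_eval_id_add:
  fixes f :: "('v, 'a::comm_semiring_1) mpoly"
  shows "mp_eval id x (f + g) = mp_eval id x f + mp_eval id x g"
proof -
  let ?S = "Poly_Mapping.keys f \<union> Poly_Mapping.keys g"
  have *: "mp_eval id x h =
      (\<Sum>m\<in>?S. Poly_Mapping.lookup h m * (\<Prod>i\<in>Poly_Mapping.keys m. x i ^ Poly_Mapping.lookup m i))"
    if "Poly_Mapping.keys h \<subseteq> ?S" for h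
    using that by (intro mp_eval_id_superset) auto
  show ?thesis
    using Poly_Mapping.keys_add[of f g]
    by (subst (1 2 3) *) (auto simp: lookup_add algebra_simps sum.distrib)
qed

lemma mp_eval_id_sum:
  fixes f :: "'i \<Rightarrow> ('v, 'a::comm_semiring_1) mpoly"
  shows "mp_eval id x (\<Sum>i\<in>S. f i) = (\<Sum>i\<in>S. mp_eval id x (f i))"
proof -
  have "mp_eval id x (0 :: ('v, 'a) mpoly) = 0"
    by (simp add: mp_eval_def)
  then show ?thesis
    by (induction S rule: infinite_finite_induct) (auto simp: mp_eval_id_add)
qed

lemma mp_eval_id_single:
  fixes c :: "'a::comm_semiring_1"
  assumes "finite J" "Poly_Mapping.keys m \<subseteq> J"
  shows "mp_eval id x (Poly_Mapping.single m c) = c * (\<Prod>i\<in>J. x i ^ Poly_Mapping.lookup m i)"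
  using assms by (subst mp_eval_id_superset[where S = "{m}" and J = "\<lambda>_. J"]) auto

lemma mp_eval_id_mult:
  fixes f :: "('v, 'a::comm_semiring_1) mpoly"
  shows "mp_eval id x (f * g) = mp_eval id x f * mp_eval id x g"
proof -
  let ?s = "\<lambda>f m. Poly_Mapping.single m (Poly_Mapping.lookup f m)"
  have "f * g = (\<Sum>m\<in>Poly_Mapping.keys f. ?s f m) * (\<Sum>n\<in>Poly_Mapping.keys g. ?s g n)"
    by (simp add: sum_single_keys)
  also have "\<dots> = (\<Sum>m\<in>Poly_Mapping.keys f. \<Sum>n\<in>Poly_Mapping.keys g. ?s f m * ?s g n)"
    by (rule sum_product)
  finally have "mp_eval id x (f * g) =
      (\<Sum>m\<in>Poly_Mapping.keys f. \<Sum>n\<in>Poly_Mapping.keys g. mp_eval id x (?s f m * ?s g n))"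
    by (simp add: mp_eval_id_sum)
  also have "\<dots> = (\<Sum>m\<in>Poly_Mapping.keys f. \<Sum>n\<in>Poly_Mapping.keys g.
      mp_eval id x (?s f m) * mp_eval id x (?s g n))"
  proof (intro sum.cong refl)
    fix m n :: "'v \<Rightarrow>\<^sub>0 nat"
    let ?J = "Poly_Mapping.keys m \<union> Poly_Mapping.keys n"
    have "Poly_Mapping.keys (m + n) \<subseteq> ?J"
      by (rule Poly_Mapping.keys_add)
    then show "mp_eval id x (?s f m * ?s g n) = mp_eval id x (?s f m) * mp_eval id x (?s g n)"
      by (simp add: mult_single mp_eval_id_single[where J = ?J] lookup_add power_add prod.distrib
          algebra_simps)
  qed
  also have "\<dots> = mp_eval id x (\<Sum>m\<in>Poly_Mapping.keys f. ?s f m)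
      * mp_eval id x (\<Sum>n\<in>Poly_Mapping.keys g. ?s g n)"
    by (simp add: mp_eval_id_sum sum_product)
  finally show ?thesis
    by (simp add: sum_single_keys)
qed

lemma mp_vars_in_add: "f \<in> mp_vars_in I \<Longrightarrow> g \<in> mp_vars_in I \<Longrightarrow> f + g \<in> mp_vars_in I"
  using Poly_Mapping.keys_add[of f g] by (auto simp: mp_vars_in_def)

lemma mp_vars_in_mult: "f \<in> mp_vars_in I \<Longrightarrow> g \<in> mp_vars_in I \<Longrightarrow> f * g \<in> mp_vars_in I"
proof -
  assume *: "f \<in> mp_vars_in I" "g \<in> mp_vars_in I"
  show ?thesis
    unfolding mp_vars_in_def
  proof safe
    fix m i assume "m \<in> Poly_Mapping.keys (f * g)" "i \<in> Poly_Mapping.keys m"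
    then obtain a b where "m = a + b" "a \<in> Poly_Mapping.keys f" "b \<in> Poly_Mapping.keys g"
      using keys_mult[of f g] by blast
    with * \<open>i \<in> _\<close> show "i \<in> I"
      using Poly_Mapping.keys_add[of a b] by (auto simp: mp_vars_in_def) blast
  qed
qed

lemma mp_eval_in_reg: "f \<in> mp_vars_in I \<Longrightarrow> (\<lambda>x. mp_eval id x f) \<in> reg I"
  unfolding mp_eval_def mp_vars_in_def by (auto intro!: reg_intros)

lemma reg_imp_mp_eval: "f \<in> reg I \<Longrightarrow> \<exists>F\<in>mp_vars_in I. \<forall>x. f x = mp_eval id x F"
proof (induction rule: reg.induct)
  case (const c)
  show ?case
    by (rule bexI[of _ "mp_const c"])
      (auto simp: mp_const_def mp_vars_in_def mp_eval_def)
next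
  case (coord i)
  then show ?case
    by (intro bexI[of _ "mp_var i"]) (auto simp: mp_var_def mp_vars_in_def mp_eval_def)
next
  case (add f g)
  then show ?case
    by (metis mp_eval_id_add mp_vars_in_add)
next
  case (mult f g)
  then show ?case
    by (metis mp_eval_id_mult mp_vars_in_mult)
qed

lemma reg_eq_mp_eval: "reg I = (\<lambda>F x. mp_eval id x F) ` mp_vars_in I"
proof safe
  fix f :: "('a \<Rightarrow> 'b) \<Rightarrow> 'b" assume "f \<in> reg I"
  then obtain F where "F \<in> mp_vars_in I" "\<forall>x. f x = mp_eval id x F"
    using reg_imp_mp_eval by blast
  then show "f \<in> (\<lambda>F x. mp_eval id x F) ` mp_vars_in I"
    by (intro image_eqI[of _ _ F]) auto
qed (rule mp_eval_in_reg)

lemma sum_mp_deriv: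
  fixes f :: "('v, 'a::alg_closed_field) mpoly"
  assumes "finite I" "f \<in> mp_vars_in I"
  shows "(\<Sum>i\<in>I. mp_eval id x (mp_deriv i f) * w i) = dir_deriv (\<lambda>x. mp_eval id x f) x w"
proof -
  let ?L = Poly_Mapping.lookup
  let ?K = "Poly_Mapping.keys f"
  have K: "Poly_Mapping.keys m \<subseteq> I" if "m \<in> ?K" for m
    using assms(2) that by (auto simp: mp_vars_in_def)
  have "(\<lambda>x. mp_eval id x f) = (\<lambda>x. \<Sum>m\<in>?K. ?L f m * (\<Prod>i\<in>I. x i ^ ?L m i))"
    using assms(1) K by (intro ext mp_eval_id_superset) auto
  then have "dir_deriv (\<lambda>x. mp_eval id x f) x w =
      (\<Sum>m\<in>?K. dir_deriv (\<lambda>x. ?L f m * (\<Prod>i\<in>I. x i ^ ?L m i)) x w)"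
    by (simp only:) (intro dir_deriv_sum[where I = I] reg_intros)
  also have "\<dots> = (\<Sum>m\<in>?K. ?L f m * dir_deriv (\<lambda>x. \<Prod>i\<in>I. x i ^ ?L m i) x w)"
    by (subst dir_deriv_mult[where I = I]) (auto intro!: reg_intros simp: dir_deriv_const)
  also have "\<dots> = (\<Sum>m\<in>?K. \<Sum>i\<in>I. ?L f m * (of_nat (?L m i) *
      (\<Prod>j\<in>I. x j ^ (if j = i then ?L m j - 1 else ?L m j)) * w i))"
    using assms(1) by (simp add: dir_deriv_prod_power sum_distrib_left)
  also have "\<dots> = (\<Sum>i\<in>I. \<Sum>m\<in>?K. ?L f m * (of_nat (?L m i) *
      (\<Prod>j\<in>I. x j ^ (if j = i then ?L m j - 1 else ?L m j)) * w i))"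
    by (rule sum.swap)
  also have "\<dots> = (\<Sum>i\<in>I. mp_eval id x (mp_deriv i f) * w i)"
    unfolding mp_deriv_def mp_eval_id_sum sum_distrib_right
  proof (intro sum.cong refl)
    fix i m assume "i \<in> I" "m \<in> ?K"
    have *: "Poly_Mapping.keys (m - Poly_Mapping.single i 1) \<subseteq> I"
      using K[OF \<open>m \<in> ?K\<close>] by (auto simp: in_keys_iff lookup_minus)
    have "(\<Prod>j\<in>I. x j ^ (if j = i then ?L m j - 1 else ?L m j))
        = (\<Prod>j\<in>I. x j ^ ?L (m - Poly_Mapping.single i 1) j)"
      by (intro prod.cong) (auto simp: lookup_minus lookup_single when_def)
    then show "?L f m * (of_nat (?L m i) *
        (\<Prod>j\<in>I. x j ^ (if j = i then ?L m j - 1 else ?L m j)) * w i) =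
        mp_eval id x (Poly_Mapping.single (m - Poly_Mapping.single i 1)
          (of_nat (?L m i) * ?L f m)) * w i"
      by (subst mp_eval_id_single[OF assms(1) *]) (simp add: algebra_simps)
  qed
  finally show ?thesis ..
qed

section \<open>Families of univariate polynomials\<close>

text \<open>The uniform degree bound lets an evaluation be one finite sum of regular functions, and
  makes division with remainder end after the same number of steps at all points.\<close>

definition regpoly :: "'v set \<Rightarrow> (('v \<Rightarrow> 'a::comm_ring_1) \<Rightarrow> 'a poly) set" where
  "regpoly I = {p. (\<forall>n. (\<lambda>x. coeff (p x) n) \<in> reg I) \<and> (\<exists>N. \<forall>x. degree (p x) \<le> N)}"

lemma regpI: "(\<And>n. (\<lambda>x. coeff (p x) n) \<in> reg I) \<Longrightarrow> (\<And>x. degree (p x) \<le> N) \<Longrightarrow> p \<in> regpoly I"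
  by (auto simp: regpoly_def)

lemma regp_coeff: "p \<in> regpoly I \<Longrightarrow> (\<lambda>x. coeff (p x) n) \<in> reg I"
  by (simp add: regpoly_def)

lemma regp_degree: "p \<in> regpoly I \<Longrightarrow> \<exists>N. \<forall>x. degree (p x) \<le> N"
  by (simp add: regpoly_def)

lemma regp_monom: "c \<in> reg I \<Longrightarrow> (\<lambda>x. monom (c x) n) \<in> regpoly I"
proof (rule regpI[where N = n])
  fix k assume "c \<in> reg I"
  then show "(\<lambda>x. coeff (monom (c x) n) k) \<in> reg I"
    by (cases "n = k") (auto intro: reg.const)
qed (simp add: degree_monom_le)

lemma regp_const: "(\<lambda>x. c) \<in> regpoly I"
  by (rule regpI[where N = "degree c"]) (auto intro!: reg_intros)

lemma regp_pCons: "c \<in> reg I \<Longrightarrow> p \<in> regpoly I \<Longrightarrow> (\<lambda>x. pCons (c x) (p x)) \<in> regpoly I"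
proof -
  assume c: "c \<in> reg I" and p: "p \<in> regpoly I"
  obtain N where "\<And>x. degree (p x) \<le> N"
    using regp_degree[OF p] by blast
  then have *: "degree (pCons (c x) (p x)) \<le> Suc N" for x
    using degree_pCons_le[of "c x" "p x"] by (meson Suc_le_mono order_trans)
  show ?thesis
  proof (rule regpI[OF _ *])
    fix n show "(\<lambda>x. coeff (pCons (c x) (p x)) n) \<in> reg I"
      by (cases n) (use c p in \<open>auto intro: regp_coeff\<close>)
  qed
qed

lemma regp_add: "p \<in> regpoly I \<Longrightarrow> q \<in> regpoly I \<Longrightarrow> (\<lambda>x. p x + q x) \<in> regpoly I"
proof -
  assume p: "p \<in> regpoly I" and q: "q \<in> regpoly I"
  obtain N M where "\<And>x. degree (p x) \<le> N" "\<And>x. degree (q x) \<le> M"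
    using regp_degree[OF p] regp_degree[OF q] by blast
  then have *: "degree (p x + q x) \<le> max N M" for x
    by (meson degree_add_le max.coboundedI1 max.coboundedI2)
  show ?thesis
    by (rule regpI[OF _ *]) (use p q in \<open>auto intro!: reg.add regp_coeff\<close>)
qed

lemma regp_mult: "p \<in> regpoly I \<Longrightarrow> q \<in> regpoly I \<Longrightarrow> (\<lambda>x. p x * q x) \<in> regpoly I"
proof -
  assume p: "p \<in> regpoly I" and q: "q \<in> regpoly I"
  obtain N M where "\<And>x. degree (p x) \<le> N" "\<And>x. degree (q x) \<le> M"
    using regp_degree[OF p] regp_degree[OF q] by blast
  then have *: "degree (p x * q x) \<le> N + M" for x
    by (meson add_mono degree_mult_le order_trans)
  show ?thesis
    unfolding regpoly_def
    using * p q by (auto intro!: reg_intros regp_coeff simp: coeff_mult)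
qed

lemma regp_uminus: "p \<in> regpoly I \<Longrightarrow> (\<lambda>x. - p x) \<in> regpoly I"
  using regp_mult[OF regp_const[of "-1"]] by fastforce

lemma regp_diff: "p \<in> regpoly I \<Longrightarrow> q \<in> regpoly I \<Longrightarrow> (\<lambda>x. p x - q x) \<in> regpoly I"
  using regp_add[OF _ regp_uminus] by fastforce

lemma regp_sum: "(\<And>i. i \<in> S \<Longrightarrow> p i \<in> regpoly I) \<Longrightarrow> (\<lambda>x. \<Sum>i\<in>S. p i x) \<in> regpoly I"
  by (induction S rule: infinite_finite_induct) (auto intro: regp_const regp_add)

lemma regp_prod: "(\<And>i. i \<in> S \<Longrightarrow> p i \<in> regpoly I) \<Longrightarrow> (\<lambda>x. \<Prod>i\<in>S. p i x) \<in> regpoly I"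
  by (induction S rule: infinite_finite_induct) (auto intro: regp_const regp_mult)

lemma regp_power: "p \<in> regpoly I \<Longrightarrow> (\<lambda>x. p x ^ k) \<in> regpoly I"
  by (induction k) (auto intro: regp_const regp_mult)

lemma regp_mono: "p \<in> regpoly I \<Longrightarrow> I \<subseteq> J \<Longrightarrow> p \<in> regpoly J"
  by (auto simp: regpoly_def intro: reg_mono)

lemma regp_cong: "p \<in> regpoly I \<Longrightarrow> (\<And>i. i \<in> I \<Longrightarrow> x i = y i) \<Longrightarrow> p x = p y"
  by (rule poly_eqI) (metis regp_coeff reg_cong[where f = "\<lambda>x. coeff (p x) _"])

lemma poly_eq_sum_coeff:
  fixes p :: "'a::comm_semiring_1 poly"
  assumes "degree p \<le> N"
  shows "poly p t = (\<Sum>i\<le>N. coeff p i * t ^ i)"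
  unfolding poly_altdef using assms by (intro sum.mono_neutral_left) (auto simp: coeff_eq_0)

lemma regp_poly: "p \<in> regpoly I \<Longrightarrow> t \<in> reg I \<Longrightarrow> (\<lambda>x. poly (p x) (t x)) \<in> reg I"
proof -
  assume p: "p \<in> regpoly I" and t: "t \<in> reg I"
  obtain N where "\<And>x. degree (p x) \<le> N"
    using regp_degree[OF p] by blast
  then have *: "(\<lambda>x. poly (p x) (t x)) = (\<lambda>x. \<Sum>i\<le>N. coeff (p x) i * t x ^ i)"
    by (auto simp: poly_eq_sum_coeff)
  show ?thesis
    unfolding * using p t by (auto intro!: reg_sum reg.mult reg_power regp_coeff)
qed

lemma regp_pderiv:
  fixes p :: "('v \<Rightarrow> 'a::idom) \<Rightarrow> 'a poly"
  assumes "p \<in> regpoly I"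
  shows "(\<lambda>x. pderiv (p x)) \<in> regpoly I"
proof -
  obtain N where N: "\<And>x. degree (p x) \<le> N"
    using regp_degree[OF assms] by blast
  have "degree (pderiv (p x)) \<le> N" for x
    using N[of x] by (intro degree_le) (auto simp: coeff_pderiv intro: coeff_eq_0)
  then show ?thesis
    by (intro regpI) (use assms in \<open>auto intro!: reg.mult reg.const regp_coeff simp: coeff_pderiv simp del: of_nat_Suc\<close>)
qed

lemma div_mod_monic_step:
  fixes g p q :: "'a::field poly"
  assumes "g \<noteq> 0"
  shows "(p - q * g) div g = p div g - q" "(p - q * g) mod g = p mod g"
  using assms by (simp_all add: poly_div_diff_left poly_mod_diff_left)

text \<open>A monic divisor of constant degree never forces a division by a coefficient, so quotient
  and remainder stay regular. The induction lowers a uniform strict degree bound by cancelling the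
  top coefficient.\<close>

lemma regp_div_mod:
  fixes p :: "('v \<Rightarrow> 'a::field) \<Rightarrow> 'a poly"
  assumes "p \<in> regpoly I" "G \<in> regpoly I" "\<And>x. lead_coeff (G x) = 1" "\<And>x. degree (G x) = e"
  shows "(\<lambda>x. p x div G x) \<in> regpoly I" "(\<lambda>x. p x mod G x) \<in> regpoly I"
proof -
  have "(\<lambda>x. p x div G x) \<in> regpoly I \<and> (\<lambda>x. p x mod G x) \<in> regpoly I"
    if "p \<in> regpoly I" "\<And>x. degree (p x) < N" for N and p :: "('v \<Rightarrow> 'a) \<Rightarrow> 'a poly"
    using that
  proof (induction N arbitrary: p)
    case (Suc N)
    show ?case
    proof (cases "N < e")
      case True
      have "degree (p x) < degree (G x)" for x
        using Suc.prems(2)[of x] assms(4)[of x] True by simp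
      then show ?thesis
        using Suc.prems(1) by (simp add: div_poly_less mod_poly_less regp_const)
    next
      case False
      let ?q = "\<lambda>x. monom (coeff (p x) N) (N - e)"
      have q: "?q \<in> regpoly I"
        by (intro regp_monom regp_coeff Suc.prems)
      have nz: "G x \<noteq> 0" for x
        using assms(3)[of x] by auto
      have c0: "coeff (p x - ?q x * G x) k = 0" if k: "k \<ge> N" for k x
      proof -
        consider "k = N" | "k > N"
          using k by linarith
        then show ?thesis
        proof cases
          case 1
          then show ?thesis
            using False assms(3)[of x] assms(4)[of x] by (simp add: coeff_monom_mult)
        next
          case 2
          moreover have "coeff (p x) k = 0"
            using Suc.prems(2)[of x] 2 by (intro coeff_eq_0) simp
          moreover have "coeff (G x) (k - (N - e)) = 0"
            using 2 False assms(4)[of x] by (intro coeff_eq_0) simp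
          ultimately show ?thesis
            by (simp add: coeff_monom_mult)
        qed
      qed
      have *: "(\<lambda>x. (p x - ?q x * G x) div G x) \<in> regpoly I \<and> (\<lambda>x. (p x - ?q x * G x) mod G x) \<in> regpoly I"
      \<comment> \<open>The induction hypothesis wants degrees strictly below \<open>N\<close>,
        which even the zero polynomial fails at \<open>N = 0\<close>; there the difference is zero
        and is treated directly.\<close>
      proof (cases "N = 0")
        case True
        then have "p x - ?q x * G x = 0" for x
          using c0[of _ x] by (intro poly_eqI) (auto simp del: coeff_diff)
        then show ?thesis
          by (simp add: regp_const)
      next
        case False
        have "degree (p x - ?q x * G x) \<le> N - 1" for x
          using c0[of _ x] False by (intro degree_le) (auto simp del: coeff_diff)
        then have "degree (p x - ?q x * G x) < N" for x
          using False by (meson diff_less less_one neq0_conv order_le_less_trans)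
        then show ?thesis
          by (intro Suc.IH regp_diff regp_mult q assms Suc.prems)
      qed
      have "(\<lambda>x. (p x - ?q x * G x) div G x + ?q x) \<in> regpoly I"
        by (rule regp_add[OF conjunct1[OF *] q])
      then show ?thesis
        using * nz by (simp add: div_mod_monic_step)
    qed
  qed auto
  moreover obtain N where "\<And>x. degree (p x) < N"
    using regp_degree[OF assms(1)] by (meson le_imp_less_Suc)
  ultimately show "(\<lambda>x. p x div G x) \<in> regpoly I" "(\<lambda>x. p x mod G x) \<in> regpoly I"
    using assms(1) by blast+
qed

lemma reg_insert_imp_regp:
  "f \<in> reg (insert v I) \<Longrightarrow> \<exists>H\<in>regpoly I. \<forall>x. f x = poly (H x) (x v)"
proof (induction rule: reg.induct)
  case (const c)
  show ?case
    by (intro bexI[of _ "\<lambda>x. [:c:]"] regp_const) simp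
next
  case (coord i)
  show ?case
  proof (cases "i = v")
    case True
    then show ?thesis
      by (intro bexI[of _ "\<lambda>x. [:0, 1:]"] regp_const) simp
  next
    case False
    then show ?thesis
      using coord by (intro bexI[of _ "\<lambda>x. [:x i:]"] regp_pCons regp_const) (auto intro: reg.intros)
  qed
next
  case (add f g)
  then obtain H K where "H \<in> regpoly I" "\<forall>x. f x = poly (H x) (x v)"
      "K \<in> regpoly I" "\<forall>x. g x = poly (K x) (x v)"
    by blast
  then show ?case
    by (intro bexI[of _ "\<lambda>x. H x + K x"] regp_add) auto
next
  case (mult f g)
  then obtain H K where "H \<in> regpoly I" "\<forall>x. f x = poly (H x) (x v)"
      "K \<in> regpoly I" "\<forall>x. g x = poly (K x) (x v)"
    by blast
  then show ?case
    by (intro bexI[of _ "\<lambda>x. H x * K x"] regp_mult) auto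
qed

lemma reg_fun_upd: "f \<in> reg I \<Longrightarrow> v \<notin> I \<Longrightarrow> f (x(v := t)) = f x"
  by (erule reg_cong) auto

lemma regp_fun_upd: "p \<in> regpoly I \<Longrightarrow> v \<notin> I \<Longrightarrow> p (x(v := t)) = p x"
  by (erule regp_cong) auto

lemma affine_space_upd: "x \<in> affine_space I \<Longrightarrow> x(v := t) \<in> affine_space (insert v I)"
  by (auto simp: affine_space_def)

lemma affine_space_upd_0: "x \<in> affine_space (insert v I) \<Longrightarrow> x(v := 0) \<in> affine_space I"
  by (auto simp: affine_space_def)

lemma dvd_power_size:
  fixes h :: "'a::comm_semiring_1"
  shows "(\<And>x. x \<in># M \<Longrightarrow> f x dvd h) \<Longrightarrow> (\<Prod>x\<in>#M. f x) dvd h ^ size M"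
  by (induction M) (auto intro: mult_dvd_mono)

text \<open>A univariate Nullstellensatz with explicit exponent: \<open>G\<close> is a product of
  \<open>degree G\<close> linear factors, each dividing \<open>h\<close>. The exponent depends only
  on the degree, so it is uniform in a family.\<close>

lemma roots_imp_dvd_power:
  fixes G h :: "'a::alg_closed_field poly"
  assumes "lead_coeff G = 1" "\<And>t. poly G t = 0 \<Longrightarrow> poly h t = 0"
  shows "G dvd h ^ degree G"
proof -
  have "G \<noteq> 0"
    using assms(1) by auto
  then obtain M where M: "size M = degree G" "G = (\<Prod>x\<in>#M. [:-x, 1:])"
    using alg_closed_imp_factorization[of G] assms(1) by auto
  have "[:-x, 1:] dvd h" if "x \<in># M" for x
  proof -
    have "[:-x, 1:] dvd G"
      using that by (subst M(2)) (auto intro: dvd_prod_mset simp: dvd_prod_mset)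
    then show ?thesis
      using assms(2) by (simp add: poly_eq_0_iff_dvd[symmetric])
  qed
  then show ?thesis
    using dvd_power_size[of M "\<lambda>x. [:-x, 1:]" h] M by simp
qed

section \<open>Towers of monic extensions\<close>

text \<open>\<open>x(v := 0)\<close> is the projection forgetting \<open>v\<close>, because points
  of the smaller affine space are zero outside \<open>I\<close>.\<close>

definition adjoin :: "'v \<Rightarrow> (('v \<Rightarrow> 'a) \<Rightarrow> 'a poly) \<Rightarrow> 'v set \<Rightarrow> ('v \<Rightarrow> 'a::comm_ring_1) set \<Rightarrow> ('v \<Rightarrow> 'a) set"
  where "adjoin v G I V = {x\<in>affine_space (insert v I). x(v := 0) \<in> V \<and> poly (G x) (x v) = 0}"

text \<open>The last premise of \<open>step\<close> says, through regular functions, that the points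
  of \<open>V\<close> over which \<open>G\<close> has \<open>e\<close> distinct roots are Zariski
  dense in \<open>V\<close>: this is generic separability.\<close>

inductive tower :: "'v set \<Rightarrow> 'v set \<Rightarrow> ('v \<Rightarrow> 'a::alg_closed_field) set \<Rightarrow> bool" for R where
  base: "tower R R (affine_space R)"
| step: "tower R I V \<Longrightarrow> v \<notin> I \<Longrightarrow> G \<in> regpoly I \<Longrightarrow> (\<And>x. lead_coeff (G x) = 1) \<Longrightarrow>
    (\<And>x. degree (G x) = e) \<Longrightarrow>
    (\<And>f. f \<in> reg I \<Longrightarrow> (\<And>x. x \<in> V \<Longrightarrow> card {t. poly (G x) t = 0} = e \<Longrightarrow> f x = 0) \<Longrightarrow>
       (\<forall>x\<in>V. f x = 0)) \<Longrightarrow>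
    tower R (insert v I) (adjoin v G I V)"

lemma tower_subset: "tower R I V \<Longrightarrow> R \<subseteq> I \<and> V \<subseteq> affine_space I"
  by (induction rule: tower.induct) (auto simp: adjoin_def)

lemma tower_finite: "tower R I V \<Longrightarrow> finite R \<Longrightarrow> finite I"
  by (induction rule: tower.induct) auto

text \<open>Write \<open>h\<close> as a polynomial \<open>H\<close> in the new coordinate. Some root
  of \<open>G x\<close> avoids the zeros of \<open>H x\<close> unless \<open>G x\<close> divides
  \<open>H x ^ e\<close>. So it suffices that one coefficient of the remainder
  \<open>H x ^ e mod G x\<close> is nonzero, and this coefficient is a regular function one level
  below.\<close>

lemma tower_open:
  assumes "tower R I V" "h \<in> reg I" "x0 \<in> V" "h x0 \<noteq> 0"
  shows "\<exists>g\<in>reg R. g x0 \<noteq> 0 \<and>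
    (\<forall>z\<in>affine_space R. g z \<noteq> 0 \<longrightarrow> (\<exists>x\<in>V. (\<forall>i\<in>R. x i = z i) \<and> h x \<noteq> 0))"
  using assms
proof (induction arbitrary: h x0 rule: tower.induct)
  case base
  then show ?case
    by (intro bexI[of _ h]) auto
next
  case (step I V v G e)
  have sub: "R \<subseteq> I" "V \<subseteq> affine_space I"
    using tower_subset[OF step.hyps(1)] by auto
  then have "v \<notin> R"
    using step.hyps(2) by blast
  obtain H where H: "H \<in> regpoly I" "\<And>x. h x = poly (H x) (x v)"
    using reg_insert_imp_regp[OF step.prems(1)] by blast
  define C where "C = (\<lambda>x. H x ^ e mod G x)"
  have C: "C \<in> regpoly I"
    unfolding C_def by (intro regp_div_mod[where e = e] regp_power H step.hyps)
  have x0: "x0(v := 0) \<in> V" "poly (G x0) (x0 v) = 0"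
    using step.prems(2) by (auto simp: adjoin_def)
  have "C x0 \<noteq> 0"
  proof
    assume "C x0 = 0"
    then have "G x0 dvd H x0 ^ e"
      by (simp add: C_def dvd_eq_mod_eq_0)
    then have "poly (H x0 ^ e) (x0 v) = 0"
      using x0(2) by (metis dvd_trans poly_eq_0_iff_dvd)
    then show False
      using step.prems(3) H(2) by simp
  qed
  then obtain n where n: "coeff (C x0) n \<noteq> 0"
    by (metis leading_coeff_0_iff)
  have "(\<lambda>x. coeff (C x) n) \<in> reg I" "coeff (C (x0(v := 0))) n \<noteq> 0"
    using n regp_coeff[OF C] regp_fun_upd[OF C step.hyps(2)] by auto
  from step.IH[OF this(1) x0(1) this(2)] obtain g where g: "g \<in> reg R" "g (x0(v := 0)) \<noteq> 0"
    "\<And>z. z \<in> affine_space R \<Longrightarrow> g z \<noteq> 0 \<Longrightarrow>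
      \<exists>x\<in>V. (\<forall>i\<in>R. x i = z i) \<and> coeff (C x) n \<noteq> 0"
    by blast
  have "g x0 \<noteq> 0"
    using g(2) reg_fun_upd[OF g(1) \<open>v \<notin> R\<close>] by simp
  moreover have "\<exists>x\<in>adjoin v G I V. (\<forall>i\<in>R. x i = z i) \<and> h x \<noteq> 0"
    if z: "z \<in> affine_space R" "g z \<noteq> 0" for z
  proof -
    obtain x where x: "x \<in> V" "\<forall>i\<in>R. x i = z i" "coeff (C x) n \<noteq> 0"
      using g(3)[OF z] by blast
    have "C x \<noteq> 0"
      using x(3) by auto
    then have "\<not> G x dvd H x ^ e"
      by (simp add: C_def dvd_eq_mod_eq_0)
    then have "\<exists>t. poly (G x) t = 0 \<and> poly (H x) t \<noteq> 0"
      using roots_imp_dvd_power[of "G x" "H x"] step.hyps by metis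
    then obtain t where t: "poly (G x) t = 0" "poly (H x) t \<noteq> 0"
      by blast
    have "x v = 0"
      using x(1) sub(2) step.hyps(2) by (auto simp: affine_space_def)
    then have "(x(v := t))(v := 0) = x"
      by auto
    then have "x(v := t) \<in> adjoin v G I V"
      using x t sub(2) affine_space_upd regp_fun_upd[OF step.hyps(3,2)] by (fastforce simp: adjoin_def)
    moreover have "h (x(v := t)) \<noteq> 0"
      using t(2) H(2) regp_fun_upd[OF H(1) step.hyps(2)] by simp
    moreover have "\<forall>i\<in>R. (x(v := t)) i = z i"
      using x(2) \<open>v \<notin> R\<close> by auto
    ultimately show ?thesis
      by blast
  qed
  ultimately show ?case
    using g(1) by blast
qed

text \<open>Each step multiplies the bound by the degree \<open>e\<close>, which does not vary with
  the point of the base.\<close>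

lemma tower_fibres:
  assumes "tower R I V"
  shows "\<exists>N. \<forall>z. finite {x\<in>V. \<forall>i\<in>R. x i = z i} \<and> card {x\<in>V. \<forall>i\<in>R. x i = z i} \<le> N"
  using assms
proof (induction rule: tower.induct)
  case base
  have "finite {x\<in>affine_space R. \<forall>i\<in>R. x i = z i} \<and>
      card {x\<in>affine_space R. \<forall>i\<in>R. x i = z i} \<le> 1" (is "finite ?S \<and> card ?S \<le> 1")
    for z :: "'a \<Rightarrow> 'b"
  proof -
    have sub: "?S \<subseteq> {\<lambda>i. if i \<in> R then z i else 0}"
      by (auto simp: affine_space_def)
    show ?thesis
      using finite_subset[OF sub] card_mono[OF _ sub] by simp
  qed
  then show ?case
    by blast
next
  case (step I V v G e)
  then obtain N where N: "\<And>z. finite {x\<in>V. \<forall>i\<in>R. x i = z i}" "\<And>z. card {x\<in>V. \<forall>i\<in>R. x i = z i} \<le> N"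
    by blast
  have "v \<notin> R"
    using tower_subset step.hyps by blast
  have G: "finite {t. poly (G y) t = 0}" "card {t. poly (G y) t = 0} \<le> e" for y
  proof -
    have "G y \<noteq> 0"
      using step.hyps(4)[of y] by auto
    then show "finite {t. poly (G y) t = 0}" "card {t. poly (G y) t = 0} \<le> e"
      using poly_roots_finite card_poly_roots_bound[of "G y"] step.hyps(5)[of y] by auto
  qed
  have "finite {x\<in>adjoin v G I V. \<forall>i\<in>R. x i = z i} \<and>
      card {x\<in>adjoin v G I V. \<forall>i\<in>R. x i = z i} \<le> N * e" for z
  proof -
    let ?A = "{x\<in>V. \<forall>i\<in>R. x i = z i}"
    let ?U = "\<Union>y\<in>?A. (\<lambda>t. y(v := t)) ` {t. poly (G y) t = 0}"
    have "{x\<in>adjoin v G I V. \<forall>i\<in>R. x i = z i} \<subseteq> ?U"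
    proof
      fix x assume x: "x \<in> {x\<in>adjoin v G I V. \<forall>i\<in>R. x i = z i}"
      then have "x(v := 0) \<in> ?A" "poly (G (x(v := 0))) (x v) = 0" "x = (x(v := 0))(v := x v)"
        using \<open>v \<notin> R\<close> regp_fun_upd[OF step.hyps(3,2)] by (auto simp: adjoin_def)
      then show "x \<in> ?U"
        by blast
    qed
    moreover have "finite ?U"
      using N(1) G(1) by blast
    moreover have "card ?U \<le> (\<Sum>y\<in>?A. card ((\<lambda>t. y(v := t)) ` {t. poly (G y) t = 0}))"
      by (rule card_UN_le) (rule N(1))
    moreover have "\<dots> \<le> (\<Sum>y\<in>?A. e)"
      using G card_image_le order_trans by (intro sum_mono) blast
    moreover have "\<dots> \<le> N * e"
      using N(2)[of z] by simp
    ultimately show ?thesis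
      by (meson card_mono finite_subset order_trans)
  qed
  then show ?case
    by blast
qed

section \<open>The ideal and the module of functions of a tower\<close>

lemma sum_poly_coeff_lessThan:
  fixes p :: "'a::comm_ring_1 poly"
  assumes "p = 0 \<or> degree p < e"
  shows "poly p t = (\<Sum>j<e. coeff p j * t ^ j)"
proof (cases "p = 0")
  case False
  then have "degree p \<le> e - 1" "{..e - 1} = {..<e}"
    using assms by auto
  then show ?thesis
    using poly_eq_sum_coeff[of p "e - 1" t] by metis
qed simp

lemma regpoly_division:
  fixes H :: "('v \<Rightarrow> 'a::field) \<Rightarrow> 'a poly"
  assumes "H \<in> regpoly I" "G \<in> regpoly I" "\<And>x. lead_coeff (G x) = 1" "\<And>x. degree (G x) = e"
  shows "\<exists>Q\<in>regpoly I. \<exists>C\<in>regpoly I. \<forall>x. (C x = 0 \<or> degree (C x) < e) \<and>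
    (\<forall>t. poly (H x) t = poly (Q x) t * poly (G x) t + (\<Sum>j<e. coeff (C x) j * t ^ j))"
proof -
  have *: "H x mod G x = 0 \<or> degree (H x mod G x) < e" for x
  proof -
    have "G x \<noteq> 0"
      using assms(3)[of x] by auto
    then show ?thesis
      using degree_mod_less[of "G x" "H x"] assms(4)[of x] by auto
  qed
  have "poly (H x) t = poly (H x div G x) t * poly (G x) t + (\<Sum>j<e. coeff (H x mod G x) j * t ^ j)"
    for x t
  proof -
    have "poly (H x) t = poly (H x div G x * G x + H x mod G x) t"
      by simp
    also have "\<dots> = poly (H x div G x) t * poly (G x) t + (\<Sum>j<e. coeff (H x mod G x) j * t ^ j)"
      unfolding poly_add poly_mult sum_poly_coeff_lessThan[OF *] ..
    finally show ?thesis .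
  qed
  with * show ?thesis
    using regp_div_mod[OF assms]
    by (intro bexI[of _ "\<lambda>x. H x div G x"] bexI[of _ "\<lambda>x. H x mod G x"]) auto
qed

text \<open>Ideal membership is tested by values on \<open>affine_space I\<close>, which determine a
  regular function by \<open>reg_cong\<close>.\<close>

definition ideal_generators ::
    "'v set \<Rightarrow> ('v \<Rightarrow> 'a::comm_ring_1) set \<Rightarrow> nat \<Rightarrow> (nat \<Rightarrow> ('v \<Rightarrow> 'a) \<Rightarrow> 'a) \<Rightarrow> bool" where
  "ideal_generators I V k E \<longleftrightarrow> (\<forall>i<k. E i \<in> reg I) \<and> (\<forall>x\<in>V. \<forall>i<k. E i x = 0) \<and>
    (\<forall>f\<in>reg I. (\<forall>x\<in>V. f x = 0) \<longrightarrow>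
      (\<exists>h. (\<forall>i<k. h i \<in> reg I) \<and> (\<forall>x\<in>affine_space I. f x = (\<Sum>i<k. h i x * E i x))))"

lemma ideal_generatorsD:
  assumes "ideal_generators I V k E"
  shows "\<And>i. i < k \<Longrightarrow> E i \<in> reg I" "\<And>x i. x \<in> V \<Longrightarrow> i < k \<Longrightarrow> E i x = 0"
    "\<And>f. f \<in> reg I \<Longrightarrow> (\<And>x. x \<in> V \<Longrightarrow> f x = 0) \<Longrightarrow>
      \<exists>h. (\<forall>i<k. h i \<in> reg I) \<and> (\<forall>x\<in>affine_space I. f x = (\<Sum>i<k. h i x * E i x))"
  using assms by (simp_all add: ideal_generators_def)

text \<open>The ideal of a tower has as many generators as there are steps. A remainder modulo the last
  monic polynomial that vanishes on the tower has vanishing coefficients because generically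
  that polynomial has as many roots as its degree.\<close>

lemma tower_ideal:
  assumes "tower R I V" "finite R"
  shows "\<exists>E k. k + card R = card I \<and> ideal_generators I V k E"
  using assms
proof (induction rule: tower.induct)
  case base
  show ?case
    by (intro exI[of _ "\<lambda>_ _. 0"] exI[of _ "0::nat"]) (auto simp: ideal_generators_def)
next
  case (step I V v G e)
  then obtain E k where k: "k + card R = card I" and gens: "ideal_generators I V k E"
    by blast
  note E = k ideal_generatorsD(1,3,2)[OF gens]
  let ?G = "\<lambda>x. poly (G x) (x v)"
  let ?J = "insert v I"
  have "finite I"
    using tower_finite step by blast
  have up: "f \<in> reg I \<Longrightarrow> f \<in> reg ?J" for f :: "('a \<Rightarrow> 'b) \<Rightarrow> 'b"
    by (rule reg_mono) auto
  have upp: "f \<in> regpoly I \<Longrightarrow> f \<in> regpoly ?J" for f :: "('a \<Rightarrow> 'b) \<Rightarrow> 'b poly"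
    by (rule regp_mono) auto
  have ideal: "\<exists>h. (\<forall>i<Suc k. h i \<in> reg ?J) \<and>
      (\<forall>x\<in>affine_space ?J. f x = (\<Sum>i<Suc k. h i x * (E(k := ?G)) i x))"
    if f: "f \<in> reg ?J" "\<And>x. x \<in> adjoin v G I V \<Longrightarrow> f x = 0" for f
  proof -
    obtain H where H: "H \<in> regpoly I" "\<And>x. f x = poly (H x) (x v)"
      using reg_insert_imp_regp[OF f(1)] by blast
    obtain Q C where Q: "Q \<in> regpoly I" and C: "C \<in> regpoly I" "\<And>x. C x = 0 \<or> degree (C x) < e"
      and QC: "\<And>x t. poly (H x) t = poly (Q x) t * poly (G x) t + (\<Sum>j<e. coeff (C x) j * t ^ j)"
      using regpoly_division[OF H(1) step.hyps(3-5)] by blast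
    have "\<forall>x\<in>V. coeff (C x) j = 0" for j
    proof (rule step.hyps(6))
      show "(\<lambda>x. coeff (C x) j) \<in> reg I"
        by (rule regp_coeff[OF C(1)])
      fix x assume x: "x \<in> V" and card: "card {t. poly (G x) t = 0} = e"
      have "poly (C x) t = 0" if t: "poly (G x) t = 0" for t
      proof -
        have xv: "x \<in> affine_space I" "x v = 0"
          using x step.hyps tower_subset[OF step.hyps(1)] by (auto simp: affine_space_def)
        then have "(x(v := t))(v := 0) = x"
          by auto
        then have "x(v := t) \<in> adjoin v G I V"
          using x xv t affine_space_upd[OF xv(1)] regp_fun_upd[OF step.hyps(3,2)] by (simp add: adjoin_def)
        then have "poly (H x) t = 0"
          using f(2) H(2) regp_fun_upd[OF H(1) step.hyps(2)] by (metis fun_upd_same)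
        then show ?thesis
          using QC[of x t] t by (simp add: sum_poly_coeff_lessThan[OF C(2)])
      qed
      then have sub: "{t. poly (G x) t = 0} \<subseteq> {t. poly (C x) t = 0}"
        by auto
      have "C x = 0"
      proof (rule ccontr)
        assume nz: "C x \<noteq> 0"
        then have "e \<le> card {t. poly (C x) t = 0}"
          using card_mono[OF _ sub] poly_roots_finite[OF nz] card by simp
        then show False
          using card_poly_roots_bound[OF nz] C(2)[of x] nz by simp
      qed
      then show "coeff (C x) j = 0"
        by simp
    qed
    then have "\<forall>j. \<exists>h. (\<forall>i<k. h i \<in> reg I) \<and>
        (\<forall>x\<in>affine_space I. coeff (C x) j = (\<Sum>i<k. h i x * E i x))"
      by (intro allI E(3)[OF regp_coeff[OF C(1)]]) simp
    from choice[OF this] obtain h where h: "\<And>j i. i < k \<Longrightarrow> h j i \<in> reg I"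
        "\<And>j x. x \<in> affine_space I \<Longrightarrow> coeff (C x) j = (\<Sum>i<k. h j i x * E i x)"
      by auto
    have hJ: "coeff (C x) j = (\<Sum>i<k. h j i x * E i x)" if "x \<in> affine_space ?J" for x j
    proof -
      have "coeff (C (x(v := 0))) j = (\<Sum>i<k. h j i (x(v := 0)) * E i (x(v := 0)))"
        by (rule h(2)) (rule affine_space_upd_0[OF that])
      also have "\<dots> = (\<Sum>i<k. h j i x * E i x)"
        using h(1) E(2) step.hyps(2) by (intro sum.cong) (auto simp: reg_fun_upd[where I = I])
      finally show ?thesis
        using regp_fun_upd[OF C(1) step.hyps(2)] by simp
    qed
    \<comment> \<open>The new generator receives the quotient \<open>Q\<close> as coefficient; each
      old one receives the polynomial in \<open>x v\<close> assembled from the representations of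
      the coefficients of the remainder.\<close>
    define h' where "h' = (\<lambda>i x. if i = k then poly (Q x) (x v) else \<Sum>j<e. h j i x * x v ^ j)"
    have "h' i \<in> reg ?J" if "i < Suc k" for i
    proof (cases "i = k")
      case True
      then show ?thesis
        using regp_poly[OF upp[OF Q] reg.coord[of v]] by (simp add: h'_def)
    next
      case False
      then show ?thesis
        using that up[OF h(1)] by (auto simp: h'_def intro!: reg_sum reg.mult reg_power reg.coord)
    qed
    moreover have "f x = (\<Sum>i<Suc k. h' i x * (E(k := ?G)) i x)" if "x \<in> affine_space ?J" for x
    proof -
      have "(\<Sum>j<e. coeff (C x) j * x v ^ j) = (\<Sum>j<e. \<Sum>i<k. h j i x * E i x * x v ^ j)"
        by (simp add: hJ[OF that] sum_distrib_right)
      also have "\<dots> = (\<Sum>i<k. \<Sum>j<e. h j i x * E i x * x v ^ j)"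
        by (rule sum.swap)
      also have "\<dots> = (\<Sum>i<k. h' i x * (E(k := ?G)) i x)"
        by (intro sum.cong) (auto simp: h'_def sum_distrib_left sum_distrib_right algebra_simps)
      finally show ?thesis
        using QC[of x "x v"] by (simp add: H(2) h'_def)
    qed
    ultimately show ?thesis
      by blast
  qed
  have "Suc k + card R = card ?J"
    using E(1) \<open>finite I\<close> step.hyps(2) by simp
  moreover have "(E(k := ?G)) i \<in> reg ?J" if "i < Suc k" for i
  proof (cases "i = k")
    case True
    then show ?thesis
      using regp_poly[OF upp[OF step.hyps(3)] reg.coord[of v]] by simp
  next
    case False
    then show ?thesis
      using that E(2) by (auto intro: up)
  qed
  moreover have "(E(k := ?G)) i x = 0" if "x \<in> adjoin v G I V" "i < Suc k" for x i
  proof (cases "i = k")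
    case True
    then show ?thesis
      using that by (simp add: adjoin_def)
  next
    case False
    then have "E i (x(v := 0)) = 0"
      using that E(4) by (auto simp: adjoin_def)
    moreover have "E i (x(v := 0)) = E i x"
      using False that(2) by (intro reg_fun_upd[OF E(2) step.hyps(2)]) simp
    ultimately show ?thesis
      using False by simp
  qed
  ultimately have "ideal_generators ?J (adjoin v G I V) (Suc k) (E(k := ?G))"
    using ideal unfolding ideal_generators_def by (intro conjI ballI allI impI) blast+
  with \<open>Suc k + card R = card ?J\<close> show ?case
    by blast
qed

text \<open>Reduction modulo the monic polynomials leaves only powers of \<open>x v\<close> below
  \<open>e\<close>, so finitely many products of such powers suffice. This lets the dimension count
  be done with monomials in the base coordinates.\<close>

lemma tower_finite_module:
  assumes "tower R I V"
  shows "\<exists>M. finite M \<and> M \<subseteq> reg I \<and> (\<forall>f\<in>reg I. \<exists>p. (\<forall>\<mu>\<in>M. p \<mu> \<in> reg R) \<and>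
    (\<forall>x\<in>V. f x = (\<Sum>\<mu>\<in>M. p \<mu> x * \<mu> x)))"
  using assms
proof (induction rule: tower.induct)
  case base
  have "\<exists>p. (\<forall>\<mu>\<in>{\<lambda>x. 1}. p \<mu> \<in> reg R) \<and> (\<forall>x\<in>affine_space R. f x = (\<Sum>\<mu>\<in>{\<lambda>x. 1}. p \<mu> x * \<mu> x))"
    if "f \<in> reg R" for f :: "('a \<Rightarrow> 'b) \<Rightarrow> 'b"
    using that by (intro exI[of _ "\<lambda>_. f"]) auto
  then show ?case
    by (intro exI[of _ "{\<lambda>x. 1}"]) (auto intro: reg.intros)
next
  case (step I V v G e)
  from step.IH obtain M where M: "finite M" "M \<subseteq> reg I" "\<forall>f\<in>reg I.
      \<exists>p. (\<forall>\<mu>\<in>M. p \<mu> \<in> reg R) \<and> (\<forall>x\<in>V. f x = (\<Sum>\<mu>\<in>M. p \<mu> x * \<mu> x))"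
    by (elim exE conjE)
  have "v \<notin> R"
    using tower_subset step.hyps by blast
  let ?\<phi> = "\<lambda>(\<mu>, j) x. \<mu> x * x v ^ j"
  let ?S = "M \<times> {..<e}"
  let ?M = "?\<phi> ` ?S"
  have "finite ?M"
    using M(1) by simp
  moreover have "?M \<subseteq> reg (insert v I)"
    using M(2) by (auto intro!: reg_intros intro: reg_mono)
  moreover have "\<exists>p. (\<forall>\<mu>\<in>?M. p \<mu> \<in> reg R) \<and> (\<forall>x\<in>adjoin v G I V. f x = (\<Sum>\<mu>\<in>?M. p \<mu> x * \<mu> x))"
    if f: "f \<in> reg (insert v I)" for f
  proof -
    obtain H where H: "H \<in> regpoly I" "\<And>x. f x = poly (H x) (x v)"
      using reg_insert_imp_regp[OF f] by blast
    obtain Q C where Q: "Q \<in> regpoly I" and C: "C \<in> regpoly I"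
      and QC: "\<And>x t. poly (H x) t = poly (Q x) t * poly (G x) t + (\<Sum>j<e. coeff (C x) j * t ^ j)"
      using regpoly_division[OF H(1) step.hyps(3-5)] by blast
    have "\<forall>j. \<exists>p. (\<forall>\<mu>\<in>M. p \<mu> \<in> reg R) \<and> (\<forall>x\<in>V. coeff (C x) j = (\<Sum>\<mu>\<in>M. p \<mu> x * \<mu> x))"
      by (intro allI bspec[OF M(3) regp_coeff[OF C]])
    from choice[OF this] obtain p where p: "\<And>j \<mu>. \<mu> \<in> M \<Longrightarrow> p j \<mu> \<in> reg R"
        "\<And>j x. x \<in> V \<Longrightarrow> coeff (C x) j = (\<Sum>\<mu>\<in>M. p j \<mu> x * \<mu> x)"
      by auto
    \<comment> \<open>Different pairs may give the same function, so coefficients are summed over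
      the fibres of \<open>?\<phi>\<close>.\<close>
    define p' where "p' = (\<lambda>\<nu> x. \<Sum>s\<in>{s\<in>?S. ?\<phi> s = \<nu>}. p (snd s) (fst s) x)"
    have "p' \<nu> \<in> reg R" for \<nu>
      unfolding p'_def by (rule reg_sum) (use p(1) in auto)
    moreover have "f x = (\<Sum>\<nu>\<in>?M. p' \<nu> x * \<nu> x)" if x: "x \<in> adjoin v G I V" for x
    proof -
      have x0: "x(v := 0) \<in> V" "poly (G x) (x v) = 0"
        using x by (auto simp: adjoin_def)
      have c: "coeff (C x) j = (\<Sum>\<mu>\<in>M. p j \<mu> x * \<mu> x)" for j
      proof -
        have "coeff (C (x(v := 0))) j = (\<Sum>\<mu>\<in>M. p j \<mu> (x(v := 0)) * \<mu> (x(v := 0)))"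
          by (rule p(2)[OF x0(1)])
        also have "\<dots> = (\<Sum>\<mu>\<in>M. p j \<mu> x * \<mu> x)"
          by (intro sum.cong refl arg_cong2[where f = "(*)"] reg_fun_upd[OF p(1) \<open>v \<notin> R\<close>]
              reg_fun_upd[OF subsetD[OF M(2)] step.hyps(2)])
        finally show ?thesis
          using regp_fun_upd[OF C step.hyps(2)] by simp
      qed
      have "f x = (\<Sum>j<e. coeff (C x) j * x v ^ j)"
        using QC[of x "x v"] x0 by (simp add: H(2))
      also have "\<dots> = (\<Sum>j<e. \<Sum>\<mu>\<in>M. p j \<mu> x * (\<mu> x * x v ^ j))"
        by (simp add: c sum_distrib_right mult.assoc)
      also have "\<dots> = (\<Sum>\<mu>\<in>M. \<Sum>j<e. p j \<mu> x * (\<mu> x * x v ^ j))"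
        by (rule sum.swap)
      also have "\<dots> = (\<Sum>s\<in>?S. p (snd s) (fst s) x * ?\<phi> s x)"
        by (simp add: sum.cartesian_product case_prod_unfold)
      also have "\<dots> = (\<Sum>\<nu>\<in>?M. \<Sum>s\<in>{s\<in>?S. ?\<phi> s = \<nu>}. p (snd s) (fst s) x * ?\<phi> s x)"
        by (rule sum.image_gen) (use M(1) in simp)
      also have "\<dots> = (\<Sum>\<nu>\<in>?M. p' \<nu> x * \<nu> x)"
        unfolding p'_def sum_distrib_right by (intro sum.cong refl) auto
      finally show ?thesis .
    qed
    ultimately show ?thesis
      by blast
  qed
  ultimately show ?case
    by (intro exI[of _ ?M] conjI ballI)
qed

section \<open>Irreducible sets\<close>

definition zclosure :: "'v set \<Rightarrow> ('v \<Rightarrow> 'a::comm_ring_1) set \<Rightarrow> ('v \<Rightarrow> 'a) set" where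
  "zclosure I U = {x\<in>affine_space I. \<forall>f\<in>reg I. (\<forall>u\<in>U. f u = 0) \<longrightarrow> f x = 0}"

text \<open>Primality of the vanishing ideal. It is formulated for arbitrary sets so that it applies
  to open pieces before their closure is taken.\<close>

definition prime_set :: "'v set \<Rightarrow> ('v \<Rightarrow> 'a::comm_ring_1) set \<Rightarrow> bool" where
  "prime_set I U \<longleftrightarrow> U \<noteq> {} \<and> (\<forall>f\<in>reg I. \<forall>g\<in>reg I. (\<forall>x\<in>U. f x * g x = 0) \<longrightarrow>
     (\<forall>x\<in>U. f x = 0) \<or> (\<forall>x\<in>U. g x = 0))"

lemma zariski_closed_iff:
  fixes V :: "('v \<Rightarrow> 'a::comm_ring_1) set"
  shows "zariski_closed I V \<longleftrightarrow> (\<exists>S\<subseteq>reg I. V = {x\<in>affine_space I. \<forall>f\<in>S. f x = 0})"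
proof
  assume "zariski_closed I V"
  then obtain S where S: "S \<subseteq> mp_vars_in I" "V = {x\<in>affine_space I. \<forall>f\<in>S. mp_eval id x f = 0}"
    unfolding zariski_closed_def by blast
  show "\<exists>S\<subseteq>reg I. V = {x\<in>affine_space I. \<forall>f\<in>S. f x = 0}"
  proof (intro exI conjI)
    show "(\<lambda>F x. mp_eval id x F) ` S \<subseteq> reg I"
      using S(1) mp_eval_in_reg by blast
    show "V = {x\<in>affine_space I. \<forall>f\<in>(\<lambda>F x. mp_eval id x F) ` S. f x = 0}"
      unfolding S(2) ball_simps by (rule refl)
  qed
next
  assume "\<exists>S\<subseteq>reg I. V = {x\<in>affine_space I. \<forall>f\<in>S. f x = 0}"
  then obtain S where S: "S \<subseteq> reg I" "V = {x\<in>affine_space I. \<forall>f\<in>S. f x = 0}"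
    by blast
  then obtain T where T: "T \<subseteq> mp_vars_in I" "S = (\<lambda>F x. mp_eval id x F) ` T"
    unfolding reg_eq_mp_eval subset_image_iff by blast
  have "V = {x\<in>affine_space I. \<forall>f\<in>T. mp_eval id x f = 0}"
    unfolding S(2) T(2) ball_simps by (rule refl)
  then show "zariski_closed I V"
    unfolding zariski_closed_def using T(1) by blast
qed

lemma subset_zclosure: "U \<subseteq> affine_space I \<Longrightarrow> U \<subseteq> zclosure I U"
  by (auto simp: zclosure_def)

lemma zclosure_mono: "U \<subseteq> U' \<Longrightarrow> zclosure I U \<subseteq> zclosure I U'"
  by (auto simp: zclosure_def)

lemma zariski_closed_iff_zclosure: "zariski_closed I V \<longleftrightarrow> zclosure I V = (V :: ('v \<Rightarrow> 'a::comm_ring_1) set)"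
proof
  assume "zariski_closed I V"
  then obtain S where S: "S \<subseteq> reg I" "V = {x\<in>affine_space I. \<forall>f\<in>S. f x = 0}"
    unfolding zariski_closed_iff by blast
  show "zclosure I V = V"
  proof
    have "V \<subseteq> affine_space I"
      unfolding S(2) by blast
    then show "V \<subseteq> zclosure I V"
      by (rule subset_zclosure)
    show "zclosure I V \<subseteq> V"
    proof
      fix x assume x: "x \<in> zclosure I V"
      have "f x = 0" if "f \<in> S" for f
      proof -
        have "\<forall>u\<in>V. f u = 0"
          unfolding S(2) using that by blast
        then show ?thesis
          using x that S(1) unfolding zclosure_def by blast
      qed
      then show "x \<in> V"
        using x unfolding S(2) zclosure_def by blast
    qed
  qed
next
  assume V: "zclosure I V = V"
  have "V = {x\<in>affine_space I. \<forall>f\<in>{f\<in>reg I. \<forall>u\<in>V. f u = 0}. f x = 0}"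
    by (subst V[symmetric], unfold zclosure_def, blast)
  then show "zariski_closed I V"
    unfolding zariski_closed_iff by (intro exI[of _ "{f\<in>reg I. \<forall>u\<in>V. f u = 0}"] conjI) blast
qed

lemma zclosure_minimal:
  "U \<subseteq> V \<Longrightarrow> zariski_closed I V \<Longrightarrow> zclosure I U \<subseteq> (V :: ('v \<Rightarrow> 'a::comm_ring_1) set)"
  using zclosure_mono[of U V I] unfolding zariski_closed_iff_zclosure by simp

lemma zariski_closed_zclosure: "zariski_closed I (zclosure I (U :: ('v \<Rightarrow> 'a::comm_ring_1) set))"
proof -
  have "zclosure I U = {x\<in>affine_space I. \<forall>f\<in>{f\<in>reg I. \<forall>u\<in>U. f u = 0}. f x = 0}"
    unfolding zclosure_def by blast
  then show ?thesis
    unfolding zariski_closed_iff by (intro exI[of _ "{f\<in>reg I. \<forall>u\<in>U. f u = 0}"] conjI) blast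
qed

lemma zariski_closed_subset: "zariski_closed I V \<Longrightarrow> V \<subseteq> affine_space I"
  unfolding zariski_closed_def by blast

lemma zariski_closed_restrict:
  fixes V :: "('v \<Rightarrow> 'a::comm_ring_1) set"
  assumes "zariski_closed I V" "S \<subseteq> reg I"
  shows "zariski_closed I {x\<in>V. \<forall>f\<in>S. f x = 0}"
proof -
  obtain T where T: "T \<subseteq> reg I" "V = {x\<in>affine_space I. \<forall>f\<in>T. f x = 0}"
    using assms(1) unfolding zariski_closed_iff by blast
  have "{x\<in>V. \<forall>f\<in>S. f x = 0} = {x\<in>affine_space I. \<forall>f\<in>S \<union> T. f x = 0}"
    unfolding T(2) by blast
  moreover have "S \<union> T \<subseteq> reg I"
    using assms(2) T(1) by blast
  ultimately show ?thesis
    unfolding zariski_closed_iff by blast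
qed

lemma irreducible_closed_iff:
  fixes V :: "('v \<Rightarrow> 'a::idom) set"
  shows "irreducible_closed I V \<longleftrightarrow> zariski_closed I V \<and> prime_set I V"
proof (intro iffI conjI)
  assume V: "irreducible_closed I V"
  then show closed: "zariski_closed I V"
    by (simp add: irreducible_closed_def)
  show "prime_set I V"
    unfolding prime_set_def
  proof (intro conjI ballI impI)
    show "V \<noteq> {}"
      using V by (simp add: irreducible_closed_def)
    fix f g assume fg: "f \<in> reg I" "g \<in> reg I" "\<forall>x\<in>V. f x * g x = 0"
    have "zariski_closed I {x\<in>V. f x = 0}" "zariski_closed I {x\<in>V. g x = 0}"
      using zariski_closed_restrict[OF closed, of "{f}"] zariski_closed_restrict[OF closed, of "{g}"] fg
      by auto
    moreover have "V = {x\<in>V. f x = 0} \<union> {x\<in>V. g x = 0}"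
      using fg(3) by auto
    ultimately have "V = {x\<in>V. f x = 0} \<or> V = {x\<in>V. g x = 0}"
      using V unfolding irreducible_closed_def by blast
    then show "(\<forall>x\<in>V. f x = 0) \<or> (\<forall>x\<in>V. g x = 0)"
      by blast
  qed
next
  assume V: "zariski_closed I V \<and> prime_set I V"
  show "irreducible_closed I V"
    unfolding irreducible_closed_def
  proof (intro conjI allI impI)
    fix A B assume AB: "zariski_closed I A" "zariski_closed I B" "V = A \<union> B"
    show "V = A \<or> V = B"
    proof (rule ccontr)
      assume "\<not> ?thesis"
      then obtain a b where "a \<in> V - A" "b \<in> V - B"
        using AB(3) by blast
      then have "a \<notin> zclosure I A" "b \<notin> zclosure I B" "a \<in> affine_space I" "b \<in> affine_space I"
        using AB zariski_closed_iff_zclosure zariski_closed_subset V by blast+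
      then obtain f g where fg: "f \<in> reg I" "\<forall>u\<in>A. f u = 0" "f a \<noteq> 0"
          "g \<in> reg I" "\<forall>u\<in>B. g u = 0" "g b \<noteq> 0"
        by (auto simp: zclosure_def)
      then have "\<forall>x\<in>V. f x * g x = 0"
        using AB(3) by auto
      then show False
        using V fg \<open>a \<in> V - A\<close> \<open>b \<in> V - B\<close> unfolding prime_set_def by blast
    qed
  qed (use V in \<open>auto simp: prime_set_def\<close>)
qed

lemma zclosure_vanish: "f \<in> reg I \<Longrightarrow> (\<And>u. u \<in> U \<Longrightarrow> f u = 0) \<Longrightarrow> x \<in> zclosure I U \<Longrightarrow> f x = 0"
  unfolding zclosure_def by blast

lemma irreducible_closed_zclosure:
  fixes U :: "('v \<Rightarrow> 'a::idom) set"
  assumes "U \<subseteq> affine_space I" "prime_set I U"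
  shows "irreducible_closed I (zclosure I U)"
  unfolding irreducible_closed_iff prime_set_def
proof (intro conjI ballI impI zariski_closed_zclosure)
  show "zclosure I U \<noteq> {}"
    using assms subset_zclosure[OF assms(1)] by (auto simp: prime_set_def)
  fix f g assume fg: "f \<in> reg I" "g \<in> reg I" "\<forall>x\<in>zclosure I U. f x * g x = 0"
  then have "\<forall>x\<in>U. f x * g x = 0"
    using subset_zclosure[OF assms(1)] by blast
  then have "(\<forall>x\<in>U. f x = 0) \<or> (\<forall>x\<in>U. g x = 0)"
    using assms(2) fg by (auto simp: prime_set_def)
  then show "(\<forall>x\<in>zclosure I U. f x = 0) \<or> (\<forall>x\<in>zclosure I U. g x = 0)"
    using zclosure_vanish[OF fg(1)] zclosure_vanish[OF fg(2)] by blast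
qed

lemma irreducible_closed_point:
  assumes "x \<in> affine_space I"
  shows "irreducible_closed I {x :: 'v \<Rightarrow> 'a::idom}"
proof -
  have "y = x" if "y \<in> zclosure I {x}" for y
  proof
    fix i
    show "y i = x i"
    proof (cases "i \<in> I")
      case True
      then have "(\<lambda>y. y i - x i) \<in> reg I"
        by (intro reg_intros)
      then show ?thesis
        using zclosure_vanish[OF _ _ that, of "\<lambda>y. y i - x i"] by simp
    next
      case False
      then show ?thesis
        using assms that by (auto simp: zclosure_def affine_space_def)
    qed
  qed
  then have "zclosure I {x} = {x}"
    using assms subset_zclosure[of "{x}" I] by auto
  then show ?thesis
    by (auto simp: irreducible_closed_iff zariski_closed_iff_zclosure prime_set_def)
qed

lemma prime_setD:
  assumes "prime_set I U" "f \<in> reg I" "g \<in> reg I" "\<And>x. x \<in> U \<Longrightarrow> f x * g x = 0"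
  shows "(\<forall>x\<in>U. f x = 0) \<or> (\<forall>x\<in>U. g x = 0)"
  using assms unfolding prime_set_def by blast

lemma prime_set_two:
  fixes g :: "('v \<Rightarrow> 'a::idom) \<Rightarrow> 'a"
  assumes "prime_set I W" "g \<in> reg I" "h \<in> reg I" "\<exists>w\<in>W. g w \<noteq> 0" "\<exists>w\<in>W. h w \<noteq> 0"
  shows "\<exists>z\<in>W. g z \<noteq> 0 \<and> h z \<noteq> 0"
proof (rule ccontr)
  assume "\<not> ?thesis"
  then have "g x * h x = 0" if "x \<in> W" for x
    using that by auto
  then show False
    using prime_setD[OF assms(1-3)] assms(4,5) by blast
qed

text \<open>The intersection property of nonempty open subsets of an irreducible set; it provides
  the simultaneous generic choices below.\<close>

lemma prime_set_prod:
  fixes g :: "'i \<Rightarrow> ('v \<Rightarrow> 'a::idom) \<Rightarrow> 'a"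
  assumes "prime_set I W" "finite H" "\<And>h. h \<in> H \<Longrightarrow> g h \<in> reg I" "\<And>h. h \<in> H \<Longrightarrow> \<exists>w\<in>W. g h w \<noteq> 0"
  shows "\<exists>z\<in>W. \<forall>h\<in>H. g h z \<noteq> 0"
proof -
  have "\<exists>z\<in>W. (\<Prod>h\<in>H. g h z) \<noteq> 0"
    using assms(2-4)
  proof (induction H rule: finite_induct)
    case empty
    then show ?case
      using assms(1) by (auto simp: prime_set_def)
  next
    case (insert h H)
    then have "\<exists>z\<in>W. (\<Prod>h\<in>H. g h z) \<noteq> 0" "\<exists>w\<in>W. g h w \<noteq> 0"
        "g h \<in> reg I" "(\<lambda>z. \<Prod>h\<in>H. g h z) \<in> reg I"
      by (auto intro!: reg_prod)
    then have "\<exists>z\<in>W. g h z \<noteq> 0 \<and> (\<Prod>h\<in>H. g h z) \<noteq> 0"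
      using prime_set_two[OF assms(1)] by blast
    then show ?case
      using insert.hyps by auto
  qed
  then show ?thesis
    using assms(2) by auto
qed

text \<open>If \<open>f * g\<close> vanishes on \<open>W\<close>, its pullback to a curve from
  \<open>p\<close> to \<open>q\<close> is a zero product of univariate polynomials, so one factor is
  zero; this is impossible when \<open>f p\<close> and \<open>g q\<close> are nonzero.\<close>

lemma prime_set_paths:
  fixes W :: "('v \<Rightarrow> 'a::alg_closed_field) set"
  assumes "W \<noteq> {}"
    and "\<And>p q. p \<in> W \<Longrightarrow> q \<in> W \<Longrightarrow> \<exists>\<gamma>. (\<forall>s. (\<lambda>i. poly (\<gamma> i) s) \<in> W) \<and>
      (\<lambda>i. poly (\<gamma> i) 0) = p \<and> (\<lambda>i. poly (\<gamma> i) 1) = q"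
  shows "prime_set I W"
  unfolding prime_set_def
proof (intro conjI ballI impI assms(1))
  fix f g assume fg: "f \<in> reg I" "g \<in> reg I" "\<forall>x\<in>W. f x * g x = 0"
  show "(\<forall>x\<in>W. f x = 0) \<or> (\<forall>x\<in>W. g x = 0)"
  proof (rule ccontr)
    assume "\<not> ?thesis"
    then obtain p q where pq: "p \<in> W" "q \<in> W" "f p \<noteq> 0" "g q \<noteq> 0"
      by blast
    obtain \<gamma> where \<gamma>: "\<And>s. (\<lambda>i. poly (\<gamma> i) s) \<in> W"
        "(\<lambda>i. poly (\<gamma> i) 0) = p" "(\<lambda>i. poly (\<gamma> i) 1) = q"
      using assms(2)[OF pq(1,2)] by blast
    obtain P Q where PQ: "\<And>s. f (\<lambda>i. poly (\<gamma> i) s) = poly P s" "\<And>s. g (\<lambda>i. poly (\<gamma> i) s) = poly Q s"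
      using reg_path[OF fg(1), of \<gamma>] reg_path[OF fg(2), of \<gamma>] by blast
    have "P * Q = 0"
      using fg(3) \<gamma>(1) PQ by (intro poly_eqI_finite[of "{}"]) (auto simp flip: PQ)
    then have "P = 0 \<or> Q = 0"
      by simp
    then show False
      using PQ(1)[of 0] PQ(2)[of 1] \<gamma> pq by auto
  qed
qed

lemma prime_set_lines:
  fixes W :: "('v \<Rightarrow> 'a::alg_closed_field) set"
  assumes "W \<noteq> {}" "\<And>p q s. p \<in> W \<Longrightarrow> q \<in> W \<Longrightarrow> (\<lambda>i. p i + s * (q i - p i)) \<in> W"
  shows "prime_set I W"
proof (rule prime_set_paths[OF assms(1)])
  fix p q assume "p \<in> W" "q \<in> W"
  then show "\<exists>\<gamma>. (\<forall>s. (\<lambda>i. poly (\<gamma> i) s) \<in> W) \<and>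
      (\<lambda>i. poly (\<gamma> i) 0) = p \<and> (\<lambda>i. poly (\<gamma> i) 1) = q"
    using assms(2) by (intro exI[of _ "\<lambda>i. [:p i, q i - p i:]"]) auto
qed

section \<open>Lifting irreducible sets\<close>

definition proj :: "'v set \<Rightarrow> ('v \<Rightarrow> 'a::zero) \<Rightarrow> 'v \<Rightarrow> 'a" where
  "proj R x = (\<lambda>i. if i \<in> R then x i else 0)"

lemma proj_in [simp]: "proj R x \<in> affine_space R"
  by (auto simp: proj_def affine_space_def)

lemma proj_eq_iff: "z \<in> affine_space R \<Longrightarrow> proj R x = z \<longleftrightarrow> (\<forall>i\<in>R. x i = z i)"
  by (auto simp: proj_def affine_space_def fun_eq_iff)

lemma reg_proj: "f \<in> reg R \<Longrightarrow> f (proj R x) = f x"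
  by (erule reg_cong) (simp add: proj_def)

lemma tower_open_over:
  assumes "tower R I V" "W \<subseteq> affine_space R" "h \<in> reg I" "x0 \<in> V" "proj R x0 \<in> W" "h x0 \<noteq> 0"
  shows "\<exists>g\<in>reg R. (\<exists>w\<in>W. g w \<noteq> 0) \<and> (\<forall>z\<in>W. g z \<noteq> 0 \<longrightarrow> (\<exists>x\<in>V. proj R x = z \<and> h x \<noteq> 0))"
proof -
  from tower_open[OF assms(1,3,4,6)] obtain g where g: "g \<in> reg R" "g x0 \<noteq> 0"
    "\<forall>z\<in>affine_space R. g z \<noteq> 0 \<longrightarrow> (\<exists>x\<in>V. (\<forall>i\<in>R. x i = z i) \<and> h x \<noteq> 0)"
    by (elim bexE conjE)
  show ?thesis
  proof (intro bexI[OF _ g(1)] conjI ballI impI)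
    show "\<exists>w\<in>W. g w \<noteq> 0"
      using g(2) assms(5) by (intro bexI[of _ "proj R x0"]) (simp_all add: reg_proj[OF g(1)])
    fix z assume z: "z \<in> W" "g z \<noteq> 0"
    then have "z \<in> affine_space R"
      using assms(2) by blast
    with g(3)[rule_format, OF this z(2)] show "\<exists>x\<in>V. proj R x = z \<and> h x \<noteq> 0"
      by (simp add: proj_eq_iff)
  qed
qed

text \<open>The projection is open with fibres of bounded size, so over an irreducible set a disjoint
  family of nonempty basic open sets is bounded in size. A maximal one consists of irreducible sets
  with dense union.\<close>

lemma tower_lift:
  fixes V :: "('v \<Rightarrow> 'a::alg_closed_field) set"
  assumes tow: "tower R I V" and W: "W \<subseteq> affine_space R" "prime_set R W"
    and Y: "prime_set I Y" "Y \<subseteq> V" "\<And>y. y \<in> Y \<Longrightarrow> proj R y \<in> W"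
  shows "\<exists>h\<in>reg I. prime_set I {x\<in>V. proj R x \<in> W \<and> h x \<noteq> 0} \<and>
    Y \<subseteq> zclosure I {x\<in>V. proj R x \<in> W \<and> h x \<noteq> 0}"
proof -
  let ?X = "{x\<in>V. proj R x \<in> W}"
  let ?U = "\<lambda>h. {x\<in>V. proj R x \<in> W \<and> h x \<noteq> 0}"
  \<comment> \<open>Disjointness of the open sets is stated as vanishing of products, which survives
    multiplication of a member by another function.\<close>
  define fam where "fam = (\<lambda>H. H \<subseteq> reg I \<and> finite H \<and> (\<forall>h\<in>H. \<exists>x\<in>?X. h x \<noteq> 0) \<and>
    (\<forall>h\<in>H. \<forall>h'\<in>H. h \<noteq> h' \<longrightarrow> (\<forall>x\<in>?X. h x * h' x = 0)))"
  have famD: "H \<subseteq> reg I" "finite H" "\<forall>h\<in>H. \<exists>x\<in>?X. h x \<noteq> 0"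
      "\<forall>h\<in>H. \<forall>h'\<in>H. h \<noteq> h' \<longrightarrow> (\<forall>x\<in>?X. h x * h' x = 0)" if "fam H" for H
    using that unfolding fam_def by - (elim conjE, assumption)+
  have famM: "h x * h' x = 0" if "fam H" "h \<in> H" "h' \<in> H" "h \<noteq> h'" "x \<in> ?X" for H h h' x
    by (rule famD(4)[OF that(1), rule_format, OF that(2-5)])
  from tower_fibres[OF tow]
  obtain N where "\<forall>z. finite {x\<in>V. \<forall>i\<in>R. x i = z i} \<and> card {x\<in>V. \<forall>i\<in>R. x i = z i} \<le> N"
    by (elim exE)
  then have N: "\<And>z. finite {x\<in>V. \<forall>i\<in>R. x i = z i}" "\<And>z. card {x\<in>V. \<forall>i\<in>R. x i = z i} \<le> N"
    by simp_all
  \<comment> \<open>The image of each open set contains a nonempty open part of \<open>W\<close>.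
    Irreducibility of \<open>W\<close> gives a common point \<open>z\<close>, and the fibre over
    \<open>z\<close> meets all the disjoint sets, so its size bounds their number.\<close>
  have bound: "card H \<le> N" if H: "fam H" for H
  proof -
    have "\<forall>h\<in>H. \<exists>g. g \<in> reg R \<and> (\<exists>w\<in>W. g w \<noteq> 0) \<and>
        (\<forall>z\<in>W. g z \<noteq> 0 \<longrightarrow> (\<exists>x\<in>V. proj R x = z \<and> h x \<noteq> 0))"
    proof
      fix h assume h: "h \<in> H"
      then obtain x0 where x0: "x0 \<in> V" "proj R x0 \<in> W" "h x0 \<noteq> 0"
        using famD(3)[OF H] by blast
      have "h \<in> reg I"
        using famD(1)[OF H] h by blast
      from tower_open_over[OF tow W(1) this x0] show "\<exists>g. g \<in> reg R \<and> (\<exists>w\<in>W. g w \<noteq> 0) \<and>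
          (\<forall>z\<in>W. g z \<noteq> 0 \<longrightarrow> (\<exists>x\<in>V. proj R x = z \<and> h x \<noteq> 0))"
        by (simp only: Bex_def)
    qed
    from bchoice[OF this] obtain g where g: "\<And>h. h \<in> H \<Longrightarrow> g h \<in> reg R"
      "\<And>h. h \<in> H \<Longrightarrow> \<exists>w\<in>W. g h w \<noteq> 0"
      "\<And>h z. h \<in> H \<Longrightarrow> z \<in> W \<Longrightarrow> g h z \<noteq> 0 \<Longrightarrow> \<exists>x\<in>V. proj R x = z \<and> h x \<noteq> 0"
      by auto
    have "finite H"
      using H by (simp add: fam_def)
    from prime_set_prod[where g = g and H = H, OF W(2) this g(1,2)] obtain z where z: "z \<in> W" "\<forall>h\<in>H. g h z \<noteq> 0"
      by blast
    then have "\<forall>h\<in>H. \<exists>x. x \<in> V \<and> proj R x = z \<and> h x \<noteq> 0"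
      using g(3) by blast
    from bchoice[OF this] obtain y where y: "\<And>h. h \<in> H \<Longrightarrow> y h \<in> V"
        "\<And>h. h \<in> H \<Longrightarrow> proj R (y h) = z" "\<And>h. h \<in> H \<Longrightarrow> h (y h) \<noteq> 0"
      by auto
    have "inj_on y H"
    proof (rule inj_onI, rule ccontr)
      fix h h' assume hh: "h \<in> H" "h' \<in> H" "y h = y h'" "h \<noteq> h'"
      then have "y h \<in> ?X"
        using y(1,2) z(1) by simp
      then have "h (y h) * h' (y h) = 0"
        using famD(4)[OF H] hh by blast
      then show False
        using y(3)[OF hh(1)] y(3)[OF hh(2)] hh(3) by auto
    qed
    moreover have "y ` H \<subseteq> {x\<in>V. \<forall>i\<in>R. x i = z i}"
    proof -
      have "z \<in> affine_space R"
        using z(1) W(1) by blast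
      then show ?thesis
        using y(1,2) by (auto simp: proj_eq_iff)
    qed
    ultimately show ?thesis
      by (intro order_trans[OF card_inj_on_le[OF _ _ N(1)] N(2)])
  qed
  have "fam {}"
    by (simp add: fam_def)
  have "\<forall>H. fam H \<longrightarrow> card H < Suc N"
    using bound by (simp add: less_Suc_eq_le)
  from ex_has_greatest_nat[OF \<open>fam {}\<close> this]
  obtain H where H: "fam H" and "\<forall>H'. fam H' \<longrightarrow> card H' \<le> card H"
    by (elim exE conjE)
  then have max: "card H' \<le> card H" if "fam H'" for H'
    using that by blast
  have Hreg: "h \<in> reg I" if "h \<in> H" for h
    using famD(1)[OF H] that by blast
  have "finite H"
    by (rule famD(2)[OF H])
  \<comment> \<open>If \<open>f * g\<close> vanished on the set of \<open>h\<close> but neither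
    factor did, \<open>f * h\<close> and \<open>g * h\<close> could replace \<open>h\<close> and
    enlarge the maximal family.\<close>
  have prime: "prime_set I (?U h)" if h: "h \<in> H" for h
    unfolding prime_set_def
  proof (intro conjI ballI impI)
    show "?U h \<noteq> {}"
      using bspec[OF famD(3)[OF H] h] by blast
    fix f g assume fg: "f \<in> reg I" "g \<in> reg I" "\<forall>x\<in>?U h. f x * g x = 0"
    show "(\<forall>x\<in>?U h. f x = 0) \<or> (\<forall>x\<in>?U h. g x = 0)"
    proof (rule ccontr)
      assume "\<not> ?thesis"
      then obtain a b where ab: "a \<in> ?U h" "b \<in> ?U h" "f a \<noteq> 0" "g b \<noteq> 0"
        by blast
      let ?fh = "\<lambda>x. f x * h x" and ?gh = "\<lambda>x. g x * h x"
      have reg: "?fh \<in> reg I" "?gh \<in> reg I"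
        using fg Hreg[OF h] by (auto intro: reg.mult)
      have nz: "\<exists>x\<in>?X. ?fh x \<noteq> 0" "\<exists>x\<in>?X. ?gh x \<noteq> 0"
        using ab by auto
      have fgh: "?fh x * ?gh x = 0" if "x \<in> ?X" for x
        using fg(3) that by (cases "h x = 0") auto
      have oth: "?fh x * h' x = 0" "?gh x * h' x = 0" if "x \<in> ?X" "h' \<in> H - {h}" for x h'
      proof -
        have "h x * h' x = 0"
          using that by (intro famM[OF H h]) auto
        then show "?fh x * h' x = 0" "?gh x * h' x = 0"
          by auto
      qed
      have ne: "?fh \<noteq> ?gh"
      proof
        assume eq: "?fh = ?gh"
        obtain x where x: "x \<in> ?X" "?fh x \<noteq> 0"
          using nz(1) by (elim bexE)
        with fgh[OF x(1)] fun_cong[OF eq, of x] show False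
          by simp
      qed
      have notin0: "k \<notin> H - {h}"
        if nzk: "\<exists>x\<in>?X. k x \<noteq> 0" and othk: "\<And>x h'. x \<in> ?X \<Longrightarrow> h' \<in> H - {h} \<Longrightarrow> k x * h' x = 0" for k
      proof
        assume k: "k \<in> H - {h}"
        obtain x where x: "x \<in> ?X" "k x \<noteq> 0"
          using nzk by (elim bexE)
        with othk[OF x(1) k] show False
          by simp
      qed
      have notin: "?fh \<notin> H - {h}" "?gh \<notin> H - {h}"
        by (rule notin0, rule nz(1), rule oth(1), assumption, assumption)
          (rule notin0, rule nz(2), rule oth(2), assumption, assumption)
      let ?H = "insert ?fh (insert ?gh (H - {h}))"
      have "fam ?H"
        unfolding fam_def
      proof (intro conjI ballI impI)
        show "?H \<subseteq> reg I" "finite ?H"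
          using reg Hreg \<open>finite H\<close> by auto
        show "\<exists>x\<in>?X. k x \<noteq> 0" if "k \<in> ?H" for k
          using that
        proof (elim insertE)
          assume "k \<in> H - {h}"
          then show "\<exists>x\<in>?X. k x \<noteq> 0"
            using bspec[OF famD(3)[OF H], of k] by blast
        qed (use nz in \<open>simp_all only:\<close>)
        fix k k' x assume "k \<in> ?H" "k' \<in> ?H" "k \<noteq> k'" "x \<in> ?X"
        moreover have "k x * k' x = 0" if "k \<in> H - {h}" "k' \<in> H - {h}" "k \<noteq> k'" "x \<in> ?X"
          using that by (intro famM[OF H]) auto
        ultimately show "k x * k' x = 0"
          using fgh[of x] oth[of x k] oth[of x k'] by (elim insertE) auto
      qed
      moreover have "card ?H = card H + 1"
        using ne notin \<open>finite H\<close> h by (simp add: card_Diff_singleton card_gt_0_iff)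
          (metis Suc_pred card_gt_0_iff empty_iff)
      ultimately show False
        using max by fastforce
    qed
  qed
  \<comment> \<open>Otherwise each set of the family has a function vanishing on it but not on
    \<open>Y\<close>. As \<open>Y\<close> is irreducible, the product is nonzero somewhere on
    \<open>Y\<close>, and it could be added to the family.\<close>
  have "\<exists>h\<in>H. Y \<subseteq> zclosure I (?U h)"
  proof (rule ccontr)
    assume "\<not> ?thesis"
    moreover have "Y \<subseteq> affine_space I"
      using Y(2) tower_subset[OF tow] by blast
    ultimately have "\<forall>h\<in>H. \<exists>f. f \<in> reg I \<and> (\<forall>x\<in>?U h. f x = 0) \<and> (\<exists>y\<in>Y. f y \<noteq> 0)"
      unfolding zclosure_def by blast
    from bchoice[OF this] obtain f where f: "\<And>h. h \<in> H \<Longrightarrow> f h \<in> reg I"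
        "\<And>h x. h \<in> H \<Longrightarrow> x \<in> ?U h \<Longrightarrow> f h x = 0" "\<And>h. h \<in> H \<Longrightarrow> \<exists>y\<in>Y. f h y \<noteq> 0"
      by auto
    obtain y where y: "y \<in> Y" "\<forall>h\<in>H. f h y \<noteq> 0"
      using prime_set_prod[where g = f and H = H, OF Y(1) \<open>finite H\<close> f(1,3)] by blast
    let ?F = "\<lambda>x. \<Prod>h\<in>H. f h x"
    have F: "?F \<in> reg I" "y \<in> ?X" "?F y \<noteq> 0"
      using f(1) y Y(2,3) \<open>finite H\<close> by (auto intro: reg_prod)
    have Fh: "?F x * h x = 0" if "h \<in> H" "x \<in> ?X" for h x
    proof (cases "h x = 0")
      case False
      then have "f h x = 0"
        using f(2) that by auto
      then show ?thesis
        using \<open>finite H\<close> that(1) by (metis mult_zero_left prod_zero)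
    qed simp
    have "?F \<notin> H"
    proof
      assume "?F \<in> H"
      then have "?F y * ?F y = 0"
        using Fh[OF _ F(2)] by blast
      then show False
        using F(3) by simp
    qed
    have "fam (insert ?F H)"
      unfolding fam_def
    proof (intro conjI ballI impI)
      show "insert ?F H \<subseteq> reg I" "finite (insert ?F H)"
        using F Hreg \<open>finite H\<close> by auto
      show "\<exists>x\<in>?X. k x \<noteq> 0" if "k \<in> insert ?F H" for k
        using that
      proof (elim insertE)
        assume "k \<in> H"
        then show "\<exists>x\<in>?X. k x \<noteq> 0"
          using bspec[OF famD(3)[OF H], of k] by blast
      next
        assume "k = ?F"
        with F(2,3) show "\<exists>x\<in>?X. k x \<noteq> 0"
          by blast
      qed
      fix k k' x assume "k \<in> insert ?F H" "k' \<in> insert ?F H" "k \<noteq> k'" "x \<in> ?X"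
      moreover have "k x * k' x = 0" if "k \<in> H" "k' \<in> H" "k \<noteq> k'" "x \<in> ?X"
        using that by (intro famM[OF H]) auto
      ultimately show "k x * k' x = 0"
        using Fh by (auto simp: mult.commute)
    qed
    moreover have "card (insert ?F H) = card H + 1"
      using \<open>?F \<notin> H\<close> \<open>finite H\<close> by simp
    ultimately show False
      using max by fastforce
  qed
  then show ?thesis
    using prime Hreg by blast
qed

section \<open>Dimension\<close>

interpretation fs: vector_space "\<lambda>(c::'a::field) (v::'v \<Rightarrow> 'a) i. c * v i"
  by (rule vector_space_pointwise)

text \<open>Independence after restriction to \<open>Z\<close>. The index set is kept apart from the
  functions so that lists of exponents can label products.\<close>

definition lin_indep :: "'e set \<Rightarrow> ('e \<Rightarrow> 'v \<Rightarrow> 'a::comm_ring_1) \<Rightarrow> 'v set \<Rightarrow> bool" where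
  "lin_indep E f Z \<longleftrightarrow> (\<forall>c. (\<forall>x\<in>Z. (\<Sum>e\<in>E. c e * f e x) = 0) \<longrightarrow> (\<forall>e\<in>E. c e = 0))"

lemma lin_indepD:
  assumes "lin_indep E f Z" "\<And>x. x \<in> Z \<Longrightarrow> (\<Sum>e\<in>E. c e * f e x) = 0" "e \<in> E"
  shows "c e = 0"
  using assms(1)[unfolded lin_indep_def, THEN spec, of c] assms(2,3) by blast

lemma sum_fun_apply: "(\<Sum>e\<in>E. f e) x = (\<Sum>e\<in>E. (f e x :: 'a::comm_monoid_add))"
  by (induction E rule: infinite_finite_induct) auto

text \<open>Extension by zero outside \<open>Z\<close> turns restrictions into vectors, to which the
  exchange bound for spans applies.\<close>

lemma lin_indep_card_le:
  fixes f :: "'e \<Rightarrow> 'v \<Rightarrow> 'a::field"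
  assumes "finite E" "lin_indep E f Z" "finite T"
    and "\<And>e. e \<in> E \<Longrightarrow> (\<lambda>x. if x \<in> Z then f e x else 0) \<in> fs.span T"
  shows "card E \<le> card T"
proof -
  define g where "g = (\<lambda>e x. if x \<in> Z then f e x else 0)"
  have eqs: "e = e'" if "e \<in> E" "e' \<in> E" "g e = g e'" for e e'
  proof (rule ccontr)
    assume "e \<noteq> e'"
    let ?c = "\<lambda>k. if k = e then 1 else if k = e' then - 1 else (0::'a)"
    have "(\<Sum>k\<in>E. ?c k * f k x) = 0" if "x \<in> Z" for x
    proof -
      have "(\<Sum>k\<in>E. ?c k * f k x) = (\<Sum>k\<in>{e, e'}. ?c k * f k x)"
        using \<open>e \<in> E\<close> \<open>e' \<in> E\<close> assms(1) by (intro sum.mono_neutral_right) auto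
      also have "\<dots> = f e x - f e' x"
        using \<open>e \<noteq> e'\<close> by simp
      also have "\<dots> = 0"
        using fun_cong[OF \<open>g e = g e'\<close>, of x] that by (simp add: g_def)
      finally show ?thesis .
    qed
    from lin_indepD[OF assms(2), of ?c e, OF this \<open>e \<in> E\<close>] show False
      by simp
  qed
  then have inj: "inj_on g E"
    by (intro inj_onI)
  have "fs.independent (g ` E)"
    unfolding fs.dependent_finite[OF finite_imageI[OF assms(1)]]
  proof clarify
    fix u e assume u: "(\<Sum>v\<in>g ` E. (\<lambda>i. u v * v i)) = 0" and e: "e \<in> E" "u (g e) \<noteq> 0"
    have "(\<Sum>k\<in>E. u (g k) * f k x) = 0" if "x \<in> Z" for x
    proof -
      have "(\<Sum>k\<in>E. u (g k) * f k x) = (\<Sum>k\<in>E. u (g k) * g k x)"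
        using that by (simp add: g_def)
      also have "\<dots> = (\<Sum>v\<in>g ` E. (\<lambda>i. u v * v i)) x"
        unfolding sum_fun_apply by (subst sum.reindex[OF inj]) simp
      also have "\<dots> = 0"
        by (simp add: u)
      finally show ?thesis .
    qed
    from lin_indepD[OF assms(2), of "\<lambda>k. u (g k)", OF this e(1)] e(2) show False
      by simp
  qed
  moreover have "g ` E \<subseteq> fs.span T"
    using assms(4) by (auto simp: g_def)
  ultimately have "card (g ` E) \<le> card T"
    using fs.independent_span_bound[OF assms(3)] by blast
  then show ?thesis
    by (simp add: card_image[OF inj])
qed

text \<open>On \<open>Z\<close> only the terms with \<open>j = 0\<close> survive, so their
  coefficients vanish. The rest is a multiple of \<open>g\<close>, which can be cancelled because
  \<open>Z'\<close> is irreducible and \<open>g\<close> is not zero on it. One step of a chain thus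
  multiplies the number of independent functions by \<open>t\<close>.\<close>

lemma lin_indep_powers:
  fixes f :: "'e \<Rightarrow> ('v \<Rightarrow> 'a::idom) \<Rightarrow> 'a"
  assumes "lin_indep E f Z" "Z \<subseteq> Z'" "prime_set I Z'" "g \<in> reg I"
    and "\<And>x. x \<in> Z \<Longrightarrow> g x = 0" "\<exists>x\<in>Z'. g x \<noteq> 0" "\<And>e. e \<in> E \<Longrightarrow> f e \<in> reg I"
    and "\<And>x. x \<in> Z' \<Longrightarrow> (\<Sum>j<t. \<Sum>e\<in>E. c e j * f e x * g x ^ j) = 0"
  shows "\<forall>j<t. \<forall>e\<in>E. c e j = 0"
  using assms(8)
proof (induction t arbitrary: c)
  case (Suc t)
  let ?S = "\<lambda>x. \<Sum>j<t. \<Sum>e\<in>E. c e (Suc j) * f e x * g x ^ j"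
  have split: "(\<Sum>j<Suc t. \<Sum>e\<in>E. c e j * f e x * g x ^ j) = (\<Sum>e\<in>E. c e 0 * f e x) + g x * ?S x" for x
    unfolding sum.lessThan_Suc_shift by (simp add: sum_distrib_left algebra_simps)
  have "\<forall>x\<in>Z. (\<Sum>e\<in>E. c e 0 * f e x) = 0"
  proof
    fix x assume "x \<in> Z"
    then have "x \<in> Z'" "g x = 0"
      using assms(2,5) by auto
    with Suc.prems[of x] show "(\<Sum>e\<in>E. c e 0 * f e x) = 0"
      unfolding split by simp
  qed
  then have c0: "\<forall>e\<in>E. c e 0 = 0"
    using lin_indepD[OF assms(1), of "\<lambda>e. c e 0"] by blast
  have "?S \<in> reg I"
    using assms(4,7) by (auto intro!: reg_sum reg.mult reg_power reg.const)
  moreover have "\<forall>x\<in>Z'. g x * ?S x = 0"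
    using Suc.prems split c0 by simp
  ultimately have "\<forall>x\<in>Z'. ?S x = 0"
    using prime_setD[OF assms(3,4), of ?S] assms(6) by blast
  then have "\<forall>j<t. \<forall>e\<in>E. c e (Suc j) = 0"
    using Suc.IH[of "\<lambda>e j. c e (Suc j)"] by blast
  then show ?case
    using c0 less_Suc_eq_0_disj by auto
qed simp

subsection \<open>Filtration by degree\<close>

text \<open>Bounding each exponent separately, not the total degree, makes the count a pure power
  \<open>(n + 1) ^ card R\<close>.\<close>

definition box_monomials :: "'v set \<Rightarrow> nat \<Rightarrow> (('v \<Rightarrow> 'a::comm_ring_1) \<Rightarrow> 'a) set" where
  "box_monomials R n = (\<lambda>a x. \<Prod>i\<in>R. x i ^ a i) ` (PiE R (\<lambda>_. {..n}))"

definition box_polys :: "'v set \<Rightarrow> nat \<Rightarrow> (('v \<Rightarrow> 'a::field) \<Rightarrow> 'a) set" where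
  "box_polys R n = fs.span (box_monomials R n)"

lemma box_monomialsI: "a \<in> PiE R (\<lambda>_. {..n}) \<Longrightarrow> (\<lambda>x. \<Prod>i\<in>R. x i ^ a i) \<in> box_monomials R n"
  unfolding box_monomials_def by (rule imageI)

lemma finite_box_monomials: "finite R \<Longrightarrow> finite (box_monomials R n)"
  unfolding box_monomials_def by (intro finite_imageI finite_PiE) auto

lemma card_box_monomials: "finite R \<Longrightarrow> card (box_monomials R n) \<le> (n + 1) ^ card R"
  unfolding box_monomials_def
  by (rule order_trans[OF card_image_le]) (auto intro!: finite_PiE simp: card_PiE)

lemma box_polys_mono: "n \<le> m \<Longrightarrow> box_polys R n \<subseteq> box_polys R m"
  unfolding box_polys_def box_monomials_def by (intro fs.span_mono image_mono PiE_mono) auto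

lemma box_polys_add: "f \<in> box_polys R n \<Longrightarrow> g \<in> box_polys R n \<Longrightarrow> (\<lambda>x. f x + g x) \<in> box_polys R n"
  unfolding box_polys_def using fs.span_add[of f _ g] by (simp add: plus_fun_def)

lemma box_polys_zero: "(\<lambda>x. 0) \<in> box_polys R n"
  unfolding box_polys_def using fs.span_zero by (simp add: zero_fun_def)

lemma box_polys_sum:
  "(\<And>i. i \<in> S \<Longrightarrow> f i \<in> box_polys R n) \<Longrightarrow> (\<lambda>x. \<Sum>i\<in>S. f i x) \<in> box_polys R n"
  by (induction S rule: infinite_finite_induct) (auto intro: box_polys_add box_polys_zero)

lemma span_mult_span:
  fixes f g :: "'v \<Rightarrow> 'a::field"
  assumes "f \<in> fs.span A" "g \<in> fs.span T" "\<And>a b. a \<in> A \<Longrightarrow> b \<in> T \<Longrightarrow> (\<lambda>x. a x * b x) \<in> fs.span C"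
  shows "(\<lambda>x. f x * g x) \<in> fs.span C"
  using assms(1)
proof (induction rule: fs.span_induct_alt)
  case base
  then show ?case
    using fs.span_zero by (simp add: zero_fun_def)
next
  case (step c a f)
  have "(\<lambda>x. a x * g x) \<in> fs.span C"
    using assms(2)
  proof (induction rule: fs.span_induct_alt)
    case base
    then show ?case
      using fs.span_zero by (simp add: zero_fun_def)
  next
    case (step d b g)
    have "(\<lambda>x. d * (a x * b x)) + (\<lambda>x. a x * g x) \<in> fs.span C"
      using assms(3) \<open>a \<in> A\<close> step by (intro fs.span_add fs.span_scale) auto
    then show ?case
      by (simp add: plus_fun_def algebra_simps)
  qed
  then have "(\<lambda>x. c * (a x * g x)) + (\<lambda>x. f x * g x) \<in> fs.span C"
    using step by (intro fs.span_add fs.span_scale) auto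
  then show ?case
    by (simp add: plus_fun_def algebra_simps)
qed

lemma box_polys_mult:
  assumes "f \<in> box_polys R n" "g \<in> box_polys R m"
  shows "(\<lambda>x. f x * g x) \<in> box_polys R (n + m)"
  using assms unfolding box_polys_def
proof (rule span_mult_span)
  fix p q :: "('a \<Rightarrow> 'b) \<Rightarrow> 'b"
  assume "p \<in> box_monomials R n" "q \<in> box_monomials R m"
  then obtain a b where ab: "a \<in> PiE R (\<lambda>_. {..n})" "b \<in> PiE R (\<lambda>_. {..m})"
      "p = (\<lambda>x. \<Prod>i\<in>R. x i ^ a i)" "q = (\<lambda>x. \<Prod>i\<in>R. x i ^ b i)"
    by (auto simp: box_monomials_def)
  let ?c = "\<lambda>i\<in>R. a i + b i"
  have "(\<lambda>x. p x * q x) = (\<lambda>x. \<Prod>i\<in>R. x i ^ ?c i)"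
    unfolding ab(3,4) prod.distrib[symmetric] by (intro ext prod.cong) (auto simp: power_add)
  moreover have "?c \<in> PiE R (\<lambda>_. {..n + m})"
    using ab(1,2) by (fastforce simp: PiE_def Pi_def intro: add_mono)
  ultimately show "(\<lambda>x. p x * q x) \<in> fs.span (box_monomials R (n + m))"
    by (simp only:) (intro fs.span_base box_monomialsI)
qed

lemma reg_box_polys:
  fixes f :: "('v \<Rightarrow> 'a::field) \<Rightarrow> 'a"
  assumes "finite R" "f \<in> reg R"
  shows "\<exists>n. f \<in> box_polys R n"
  using assms(2)
proof (induction rule: reg.induct)
  case (const c)
  have "(\<lambda>x::'v \<Rightarrow> 'a. 1) \<in> box_monomials R 0"
    unfolding box_monomials_def by (intro image_eqI[of _ _ "\<lambda>i\<in>R. 0"]) auto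
  then have "(\<lambda>x::'v \<Rightarrow> 'a. c * 1) \<in> fs.span (box_monomials R 0)"
    by (intro fs.span_scale fs.span_base)
  then show ?case
    by (auto simp: box_polys_def)
next
  case (coord i)
  define a where "a = (\<lambda>j\<in>R. if j = i then 1 else 0 :: nat)"
  have "(\<lambda>x::'v \<Rightarrow> 'a. x i) = (\<lambda>x. \<Prod>j\<in>R. x j ^ a j)"
  proof
    fix x :: "'v \<Rightarrow> 'a"
    have "(\<Prod>j\<in>R. x j ^ a j) = (\<Prod>j\<in>R. if j = i then x j else 1)"
      by (intro prod.cong) (auto simp: a_def)
    then show "x i = (\<Prod>j\<in>R. x j ^ a j)"
      using coord assms(1) by (simp add: prod.delta)
  qed
  moreover have "a \<in> PiE R (\<lambda>_. {..1})"
    by (auto simp: a_def)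
  ultimately have "(\<lambda>x::'v \<Rightarrow> 'a. x i) \<in> box_monomials R 1"
    by (simp only:) (rule box_monomialsI)
  then show ?case
    unfolding box_polys_def by (blast intro: fs.span_base)
next
  case (add f g)
  then obtain n m where "f \<in> box_polys R n" "g \<in> box_polys R m"
    by blast
  then have "f \<in> box_polys R (max n m)" "g \<in> box_polys R (max n m)"
    using box_polys_mono max.cobounded1 max.cobounded2 by blast+
  then show ?case
    by (blast intro: box_polys_add)
next
  case (mult f g)
  then show ?case
    by (blast intro: box_polys_mult)
qed

text \<open>The filtration induced by the module generators \<open>M\<close>; the growth of its
  dimension plays the role of a Hilbert function.\<close>

definition mod_filt :: "'v set \<Rightarrow> ('v \<Rightarrow> 'a) set \<Rightarrow> (('v \<Rightarrow> 'a) \<Rightarrow> 'a) set \<Rightarrow> nat \<Rightarrow> (('v \<Rightarrow> 'a::field) \<Rightarrow> 'a) set"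
  where "mod_filt R V M n = {f. \<exists>p. (\<forall>\<mu>\<in>M. p \<mu> \<in> box_polys R n) \<and> (\<forall>x\<in>V. f x = (\<Sum>\<mu>\<in>M. p \<mu> x * \<mu> x))}"

lemma mod_filt_mono: "n \<le> m \<Longrightarrow> mod_filt R V M n \<subseteq> mod_filt R V M m"
  unfolding mod_filt_def using subsetD[OF box_polys_mono[of n m R]] by blast

lemma mod_filt_total:
  fixes f :: "('v \<Rightarrow> 'a::field) \<Rightarrow> 'a"
  assumes "finite R" "finite M" "\<And>\<mu>. \<mu> \<in> M \<Longrightarrow> p \<mu> \<in> reg R"
    and "\<And>x. x \<in> V \<Longrightarrow> f x = (\<Sum>\<mu>\<in>M. p \<mu> x * \<mu> x)"
  shows "\<exists>n. f \<in> mod_filt R V M n"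
proof -
  have "\<forall>\<mu>\<in>M. \<exists>n. p \<mu> \<in> box_polys R n"
    using reg_box_polys assms(1,3) by blast
  from bchoice[OF this] obtain n where n: "\<forall>\<mu>\<in>M. p \<mu> \<in> box_polys R (n \<mu>)"
    by blast
  have "p \<mu> \<in> box_polys R (\<Sum>\<mu>\<in>M. n \<mu>)" if "\<mu> \<in> M" for \<mu>
    using n that box_polys_mono[of "n \<mu>" "\<Sum>\<mu>\<in>M. n \<mu>"] member_le_sum[of \<mu> M n] assms(2) by auto
  then show ?thesis
    unfolding mod_filt_def using assms(4) by blast
qed

text \<open>\<open>C\<close> bounds the degrees of the structure coefficients that express products
  of generators through generators, hence does not depend on \<open>n\<close> and
  \<open>m\<close>.\<close>

lemma mod_filt_mult:
  fixes M :: "(('v \<Rightarrow> 'a::field) \<Rightarrow> 'a) set"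
  assumes "finite R" "finite M"
    and "\<And>\<mu> \<nu>. \<mu> \<in> M \<Longrightarrow> \<nu> \<in> M \<Longrightarrow> \<exists>p. (\<forall>\<kappa>\<in>M. p \<kappa> \<in> reg R) \<and>
      (\<forall>x\<in>V. \<mu> x * \<nu> x = (\<Sum>\<kappa>\<in>M. p \<kappa> x * \<kappa> x))"
  shows "\<exists>C. \<forall>n m. \<forall>f\<in>mod_filt R V M n. \<forall>g\<in>mod_filt R V M m.
    (\<lambda>x. f x * g x) \<in> mod_filt R V M (n + m + C)"
proof -
  have "\<forall>s\<in>M \<times> M. \<exists>n. (\<lambda>x. fst s x * snd s x) \<in> mod_filt R V M n"
  proof
    fix s assume "s \<in> M \<times> M"
    then obtain p where "\<forall>\<kappa>\<in>M. p \<kappa> \<in> reg R" "\<forall>x\<in>V. fst s x * snd s x = (\<Sum>\<kappa>\<in>M. p \<kappa> x * \<kappa> x)"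
      using assms(3)[of "fst s" "snd s"] by auto
    then show "\<exists>n. (\<lambda>x. fst s x * snd s x) \<in> mod_filt R V M n"
      using mod_filt_total[OF assms(1,2), of p V "\<lambda>x. fst s x * snd s x"] by blast
  qed
  from bchoice[OF this] obtain c where
    c: "\<And>s. s \<in> M \<times> M \<Longrightarrow> (\<lambda>x. fst s x * snd s x) \<in> mod_filt R V M (c s)"
    by blast
  define C where "C = (\<Sum>s\<in>M \<times> M. c s)"
  have "(\<lambda>x. fst s x * snd s x) \<in> mod_filt R V M C" if "s \<in> M \<times> M" for s
    using c[OF that] mod_filt_mono[of "c s" C R V M] member_le_sum[of s "M \<times> M" c] that assms(2)
    by (auto simp: C_def)
  then have "\<forall>s\<in>M \<times> M. \<exists>q. (\<forall>\<kappa>\<in>M. q \<kappa> \<in> box_polys R C) \<and>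
      (\<forall>x\<in>V. fst s x * snd s x = (\<Sum>\<kappa>\<in>M. q \<kappa> x * \<kappa> x))"
    unfolding mod_filt_def by blast
  from bchoice[OF this] obtain q where q0: "\<forall>s\<in>M \<times> M. (\<forall>\<kappa>\<in>M. q s \<kappa> \<in> box_polys R C) \<and>
      (\<forall>x\<in>V. fst s x * snd s x = (\<Sum>\<kappa>\<in>M. q s \<kappa> x * \<kappa> x))"
    by (elim exE)
  have q: "\<And>s \<kappa>. s \<in> M \<times> M \<Longrightarrow> \<kappa> \<in> M \<Longrightarrow> q s \<kappa> \<in> box_polys R C"
      "\<And>s x. s \<in> M \<times> M \<Longrightarrow> x \<in> V \<Longrightarrow> fst s x * snd s x = (\<Sum>\<kappa>\<in>M. q s \<kappa> x * \<kappa> x)"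
    using bspec[OF q0] by blast+
  have "(\<lambda>x. f x * g x) \<in> mod_filt R V M (n + m + C)"
    if f: "f \<in> mod_filt R V M n" and g: "g \<in> mod_filt R V M m" for n m f g
  proof -
    obtain p where p: "\<And>\<mu>. \<mu> \<in> M \<Longrightarrow> p \<mu> \<in> box_polys R n" "\<And>x. x \<in> V \<Longrightarrow> f x = (\<Sum>\<mu>\<in>M. p \<mu> x * \<mu> x)"
      using f unfolding mod_filt_def by blast
    obtain r where r: "\<And>\<mu>. \<mu> \<in> M \<Longrightarrow> r \<mu> \<in> box_polys R m" "\<And>x. x \<in> V \<Longrightarrow> g x = (\<Sum>\<mu>\<in>M. r \<mu> x * \<mu> x)"
      using g unfolding mod_filt_def by blast
    define w where "w = (\<lambda>\<kappa> x. \<Sum>s\<in>M \<times> M. (p (fst s) x * r (snd s) x) * q s \<kappa> x)"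
    have "w \<kappa> \<in> box_polys R (n + m + C)" if "\<kappa> \<in> M" for \<kappa>
      unfolding w_def using p(1) r(1) q(1) that by (intro box_polys_sum box_polys_mult) auto
    moreover have "f x * g x = (\<Sum>\<kappa>\<in>M. w \<kappa> x * \<kappa> x)" if "x \<in> V" for x
    proof -
      have "f x * g x = (\<Sum>s\<in>M \<times> M. (p (fst s) x * fst s x) * (r (snd s) x * snd s x))"
        unfolding p(2)[OF that] r(2)[OF that] sum_product by (simp add: sum.cartesian_product case_prod_unfold)
      also have "\<dots> = (\<Sum>s\<in>M \<times> M. (p (fst s) x * r (snd s) x) * (fst s x * snd s x))"
        by (intro sum.cong) (auto simp: algebra_simps)
      also have "\<dots> = (\<Sum>s\<in>M \<times> M. \<Sum>\<kappa>\<in>M. (p (fst s) x * r (snd s) x) * q s \<kappa> x * \<kappa> x)"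
        using q(2)[OF _ that] by (intro sum.cong) (auto simp: sum_distrib_left mult.assoc)
      also have "\<dots> = (\<Sum>\<kappa>\<in>M. w \<kappa> x * \<kappa> x)"
        unfolding w_def sum_distrib_right by (rule sum.swap)
      finally show ?thesis .
    qed
    ultimately show ?thesis
      unfolding mod_filt_def by blast
  qed
  then show ?thesis
    by blast
qed

text \<open>On \<open>Z\<close> this step of the filtration is spanned by the products of box
  monomials with the generators in \<open>M\<close>.\<close>

lemma mod_filt_lin_indep:
  fixes f :: "'e \<Rightarrow> ('v \<Rightarrow> 'a::field) \<Rightarrow> 'a"
  assumes "finite R" "finite M" "finite E" "lin_indep E f Z" "Z \<subseteq> V"
    and "\<And>e. e \<in> E \<Longrightarrow> f e \<in> mod_filt R V M n"
  shows "card E \<le> card M * (n + 1) ^ card R"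
proof -
  let ?b = "\<lambda>s x. if x \<in> Z then fst s x * snd s x else 0"
  let ?T = "?b ` (box_monomials R n \<times> M)"
  have fin: "finite (box_monomials R n \<times> M :: ((('v \<Rightarrow> 'a) \<Rightarrow> 'a) \<times> (('v \<Rightarrow> 'a) \<Rightarrow> 'a)) set)"
    using assms(1,2) finite_box_monomials by blast
  have "(\<lambda>x. if x \<in> Z then f e x else 0) \<in> fs.span ?T" if e: "e \<in> E" for e
  proof -
    obtain p where p: "\<And>\<mu>. \<mu> \<in> M \<Longrightarrow> p \<mu> \<in> box_polys R n" "\<And>x. x \<in> V \<Longrightarrow> f e x = (\<Sum>\<mu>\<in>M. p \<mu> x * \<mu> x)"
      using assms(6)[OF e] unfolding mod_filt_def by blast
    have "(\<lambda>x. p \<mu> x * (if x \<in> Z then \<mu> x else 0)) \<in> fs.span ?T" if \<mu>: "\<mu> \<in> M" for \<mu>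
    proof (rule span_mult_span)
      show "p \<mu> \<in> fs.span (box_monomials R n)"
        using p(1)[OF \<mu>] by (simp add: box_polys_def)
      show "(\<lambda>x. if x \<in> Z then \<mu> x else 0) \<in> fs.span {\<lambda>x. if x \<in> Z then \<mu> x else 0}"
        by (intro fs.span_base) simp
      fix a b :: "('v \<Rightarrow> 'a) \<Rightarrow> 'a"
      assume "a \<in> box_monomials R n" "b \<in> {\<lambda>x. if x \<in> Z then \<mu> x else 0}"
      then have "(\<lambda>x. a x * b x) = ?b (a, \<mu>)" and mem: "(a, \<mu>) \<in> box_monomials R n \<times> M"
        using \<mu> by auto
      moreover have "?b (a, \<mu>) \<in> fs.span ?T"
        by (intro fs.span_base imageI mem)
      ultimately show "(\<lambda>x. a x * b x) \<in> fs.span ?T"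
        by (simp only:)
    qed
    then have "(\<Sum>\<mu>\<in>M. (\<lambda>x. p \<mu> x * (if x \<in> Z then \<mu> x else 0))) \<in> fs.span ?T"
      by (rule fs.span_sum)
    moreover have "(\<Sum>\<mu>\<in>M. (\<lambda>x. p \<mu> x * (if x \<in> Z then \<mu> x else 0))) = (\<lambda>x. if x \<in> Z then f e x else 0)"
      using p(2) assms(5) by (auto simp: fun_eq_iff sum_fun_apply subset_iff)
    ultimately show ?thesis
      by simp
  qed
  then have "card E \<le> card ?T"
    using lin_indep_card_le[OF assms(3,4) finite_imageI[OF fin]] by blast
  also have "\<dots> \<le> card (box_monomials R n \<times> M :: ((('v \<Rightarrow> 'a) \<Rightarrow> 'a) \<times> (('v \<Rightarrow> 'a) \<Rightarrow> 'a)) set)"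
    by (rule card_image_le[OF fin])
  also have "\<dots> = card M * card (box_monomials R n :: (('v \<Rightarrow> 'a) \<Rightarrow> 'a) set)"
    by (simp add: card_cartesian_product)
  also have "\<dots> \<le> card M * (n + 1) ^ card R"
    by (intro mult_left_mono card_box_monomials assms(1)) simp
  finally show ?thesis .
qed

section \<open>Length of chains of irreducible closed sets\<close>

lemma separating_function:
  fixes Z :: "('v \<Rightarrow> 'a::comm_ring_1) set"
  assumes "zariski_closed I Z" "y \<in> affine_space I" "y \<notin> Z"
  shows "\<exists>g\<in>reg I. (\<forall>z\<in>Z. g z = 0) \<and> g y \<noteq> 0"
proof -
  have "y \<notin> zclosure I Z"
    using assms(1,3) unfolding zariski_closed_iff_zclosure by simp
  then show ?thesis
    using assms(2) unfolding zclosure_def by blast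
qed

text \<open>Functions \<open>g\<^sub>i\<close> vanishing on \<open>Z\<^sub>i\<close> but not on \<open>Z\<^sub>i\<^sub>+\<^sub>1\<close> are algebraically
  independent on the last member of the chain; counting monomials bounds their number.\<close>

lemma chain_monomials:
  fixes Z :: "nat \<Rightarrow> ('v \<Rightarrow> 'a::alg_closed_field) set"
  assumes chain: "irreducible_chain I V k Z" and VI: "V \<subseteq> affine_space I"
    and tot: "\<And>f. f \<in> reg I \<Longrightarrow> \<exists>n. f \<in> mod_filt R V M n"
    and mult: "\<And>n m f g. f \<in> mod_filt R V M n \<Longrightarrow> g \<in> mod_filt R V M m \<Longrightarrow>
      (\<lambda>x. f x * g x) \<in> mod_filt R V M (n + m + C0)"
  shows "i \<le> k \<Longrightarrow> \<exists>C. \<forall>t. \<exists>(E :: nat list set) f. finite E \<and> card E = t ^ i \<and>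
    lin_indep E f (Z i) \<and> (\<forall>e\<in>E. f e \<in> reg I \<and> f e \<in> mod_filt R V M (C * (t + 1)))"
proof (induction i)
  case 0
  obtain n where n: "(\<lambda>x. 1) \<in> mod_filt R V M n"
    using tot[OF reg.const] by blast
  have "irreducible_closed I (Z 0)"
    using chain by (simp add: irreducible_chain_def)
  then have ne: "Z 0 \<noteq> {}"
    by (simp add: irreducible_closed_def)
  show ?case
  proof (intro exI allI conjI ballI)
    fix t :: nat
    show "finite {[] :: nat list}" "card {[] :: nat list} = t ^ 0" by auto
    show "lin_indep {[] :: nat list} (\<lambda>_ _. 1) (Z 0)"
      using ne by (auto simp: lin_indep_def)
    show "(\<lambda>x. 1) \<in> mod_filt R V M (n * (t + 1))"
      using n mod_filt_mono[of n "n * (t + 1)" R V M] by auto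
    show "(\<lambda>x. 1) \<in> reg I"
      by (rule reg.const)
  qed
next
  case (Suc i)
  then obtain C where C: "\<forall>t. \<exists>(E :: nat list set) f. finite E \<and> card E = t ^ i \<and>
    lin_indep E f (Z i) \<and> (\<forall>e\<in>E. f e \<in> reg I \<and> f e \<in> mod_filt R V M (C * (t + 1)))"
    by auto
  have Z: "irreducible_closed I (Z i)" "irreducible_closed I (Z (Suc i))" "Z i \<subset> Z (Suc i)" "Z (Suc i) \<subseteq> V"
    using chain Suc.prems by (auto simp: irreducible_chain_def)
  then obtain y where y: "y \<in> Z (Suc i)" "y \<notin> Z i"
    by blast
  have "y \<in> affine_space I" "zariski_closed I (Z i)"
    using y Z VI by (auto simp: irreducible_closed_iff)
  then obtain g where g: "g \<in> reg I" "\<forall>z\<in>Z i. g z = 0" "g y \<noteq> 0"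
    using separating_function y(2) by blast
  obtain n where n: "g \<in> mod_filt R V M n"
    using tot[OF g(1)] by blast
  obtain n1 where n1: "(\<lambda>x. 1) \<in> mod_filt R V M n1"
    using tot[OF reg.const] by blast
  have pow: "(\<lambda>x. g x ^ j) \<in> mod_filt R V M (j * (n + C0) + n1)" for j
  proof (induction j)
    case (Suc j)
    then show ?case
      using mult[OF n Suc] by (simp add: algebra_simps)
  qed (use n1 in simp)
  \<comment> \<open>Each factor \<open>g\<close> costs \<open>n + C0\<close>, the constant function
    \<open>n1\<close>, and the product with \<open>f e\<close> another \<open>C0\<close>; since
    \<open>j < t\<close>, everything fits into a multiple of \<open>t + 1\<close>.\<close>
  define C' where "C' = C + n + 2 * C0 + n1"
  have "\<exists>(E :: nat list set) f. finite E \<and> card E = t ^ Suc i \<and> lin_indep E f (Z (Suc i)) \<and>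
      (\<forall>e\<in>E. f e \<in> reg I \<and> f e \<in> mod_filt R V M (C' * (t + 1)))" for t
  proof -
    obtain E :: "nat list set" and f where E: "finite E" "card E = t ^ i" "lin_indep E f (Z i)"
        "\<forall>e\<in>E. f e \<in> reg I \<and> f e \<in> mod_filt R V M (C * (t + 1))"
      using C by blast
    let ?c = "\<lambda>(j, e). j # e :: nat list"
    let ?E = "?c ` ({..<t} \<times> E)"
    let ?f = "\<lambda>l x. f (tl l) x * g x ^ hd l"
    have inj: "inj_on ?c ({..<t} \<times> E)"
      by (auto simp: inj_on_def)
    have "lin_indep ?E ?f (Z (Suc i))"
      unfolding lin_indep_def
    proof (intro allI impI)
      fix c assume c: "\<forall>x\<in>Z (Suc i). (\<Sum>l\<in>?E. c l * ?f l x) = 0"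
      have "(\<Sum>j<t. \<Sum>e\<in>E. c (j # e) * f e x * g x ^ j) = 0" if "x \<in> Z (Suc i)" for x
      proof -
        have "(\<Sum>j<t. \<Sum>e\<in>E. c (j # e) * f e x * g x ^ j) =
            (\<Sum>s\<in>{..<t} \<times> E. c (?c s) * ?f (?c s) x)"
          by (simp add: sum.cartesian_product case_prod_unfold mult.assoc)
        also have "\<dots> = (\<Sum>l\<in>?E. c l * ?f l x)"
          by (subst sum.reindex[OF inj]) simp
        also have "\<dots> = 0"
          using c that by blast
        finally show ?thesis .
      qed
      then have "\<forall>j<t. \<forall>e\<in>E. c (j # e) = 0"
        using Z(2,3) g y(1) E(4)
        by (intro lin_indep_powers[OF E(3), where Z' = "Z (Suc i)" and g = g and I = I])
          (auto simp: irreducible_closed_iff)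
      then show "\<forall>l\<in>?E. c l = 0"
        by auto
    qed
    moreover have "card ?E = t ^ Suc i"
      by (simp add: card_image[OF inj] card_cartesian_product E(2))
    moreover have "?f l \<in> reg I \<and> ?f l \<in> mod_filt R V M (C' * (t + 1))" if "l \<in> ?E" for l
    proof -
      obtain j e where l: "l = j # e" "j < t" "e \<in> E"
        using \<open>l \<in> ?E\<close> by auto
      have "(\<lambda>x. f e x * g x ^ j) \<in> mod_filt R V M (C * (t + 1) + (j * (n + C0) + n1) + C0)"
        using E(4) l(3) pow by (intro mult) auto
      moreover have "j * (n + C0) \<le> (t + 1) * (n + C0)"
        using l(2) by (intro mult_right_mono) auto
      then have "C * (t + 1) + (j * (n + C0) + n1) + C0 \<le> C * (t + 1) + ((t + 1) * (n + C0) + n1 * (t + 1)) + C0 * (t + 1)"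
        by (intro add_mono) auto
      then have "C * (t + 1) + (j * (n + C0) + n1) + C0 \<le> C' * (t + 1)"
        by (simp add: C'_def algebra_simps)
      ultimately have "(\<lambda>x. f e x * g x ^ j) \<in> mod_filt R V M (C' * (t + 1))"
        using mod_filt_mono by blast
      then show ?thesis
        using l E(4) g(1) by (auto intro!: reg.mult reg_power)
    qed
    ultimately show ?thesis
      using E(1) by (intro exI[of _ ?E] exI[of _ ?f]) simp
  qed
  then show ?case
    by blast
qed

lemma tower_chain_le:
  fixes Z :: "nat \<Rightarrow> ('v \<Rightarrow> 'a::alg_closed_field) set"
  assumes tow: "tower R I V" and fin: "finite R" and chain: "irreducible_chain I V k Z"
  shows "k \<le> card R"
proof (rule ccontr)
  assume "\<not> k \<le> card R"
  from tower_finite_module[OF tow] obtain M where M: "finite M" "M \<subseteq> reg I"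
    "\<forall>f\<in>reg I. \<exists>p. (\<forall>\<mu>\<in>M. p \<mu> \<in> reg R) \<and> (\<forall>x\<in>V. f x = (\<Sum>\<mu>\<in>M. p \<mu> x * \<mu> x))"
    by (elim exE conjE)
  have tot: "\<exists>n. f \<in> mod_filt R V M n" if "f \<in> reg I" for f
  proof -
    obtain p where "\<forall>\<mu>\<in>M. p \<mu> \<in> reg R" "\<forall>x\<in>V. f x = (\<Sum>\<mu>\<in>M. p \<mu> x * \<mu> x)"
      using bspec[OF M(3) \<open>f \<in> reg I\<close>] by (elim exE conjE)
    then show ?thesis
      by (intro mod_filt_total[OF fin M(1), of p V f]) auto
  qed
  have "\<exists>C. \<forall>n m. \<forall>f\<in>mod_filt R V M n. \<forall>g\<in>mod_filt R V M m.
      (\<lambda>x. f x * g x) \<in> mod_filt R V M (n + m + C)"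
  proof (rule mod_filt_mult[OF fin M(1)])
    fix \<mu> \<nu> assume "\<mu> \<in> M" "\<nu> \<in> M"
    then have "(\<lambda>x. \<mu> x * \<nu> x) \<in> reg I"
      using M(2) by (blast intro: reg.mult)
    from bspec[OF M(3) this] show "\<exists>p. (\<forall>\<kappa>\<in>M. p \<kappa> \<in> reg R) \<and> (\<forall>x\<in>V. \<mu> x * \<nu> x = (\<Sum>\<kappa>\<in>M. p \<kappa> x * \<kappa> x))" .
  qed
  then obtain C0 where C0: "\<forall>n m. \<forall>f\<in>mod_filt R V M n. \<forall>g\<in>mod_filt R V M m.
      (\<lambda>x. f x * g x) \<in> mod_filt R V M (n + m + C0)"
    by (elim exE)
  have VI: "V \<subseteq> affine_space I"
    using tower_subset[OF tow] by blast
  obtain C where C: "\<forall>t. \<exists>(E :: nat list set) f. finite E \<and> card E = t ^ k \<and>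
      lin_indep E f (Z k) \<and> (\<forall>e\<in>E. f e \<in> reg I \<and> f e \<in> mod_filt R V M (C * (t + 1)))"
    using chain_monomials[OF chain VI tot, of C0 k] C0 by blast
  \<comment> \<open>For \<open>t \<ge> 1\<close> the degree satisfies
    \<open>C * (t + 1) + 1 \<le> (2 * C + 1) * t\<close>, so there is room for at most
    \<open>A * t ^ card R\<close> functions; \<open>t = A + 1\<close> makes this smaller than
    \<open>t ^ Suc (card R)\<close>.\<close>
  define A where "A = card M * (2 * C + 1) ^ card R"
  define t where "t = A + 1"
  obtain E :: "nat list set" and f where E: "finite E" "card E = t ^ k" "lin_indep E f (Z k)"
      "\<forall>e\<in>E. f e \<in> reg I \<and> f e \<in> mod_filt R V M (C * (t + 1))"
    using C by blast
  have "Z k \<subseteq> V"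
    using chain by (simp add: irreducible_chain_def)
  then have "card E \<le> card M * (C * (t + 1) + 1) ^ card R"
    using E(4) by (intro mod_filt_lin_indep[OF fin M(1) E(1,3)]) auto
  moreover have "C * (t + 1) + 1 \<le> (2 * C + 1) * t"
    by (simp add: t_def algebra_simps)
  then have "(C * (t + 1) + 1) ^ card R \<le> ((2 * C + 1) * t) ^ card R"
    by (rule power_mono) simp
  then have "card M * (C * (t + 1) + 1) ^ card R \<le> A * t ^ card R"
    unfolding A_def power_mult_distrib by (simp add: mult.assoc)
  moreover have "t ^ Suc (card R) \<le> t ^ k"
    using \<open>\<not> k \<le> card R\<close> by (intro power_increasing) (auto simp: t_def)
  ultimately have "t ^ Suc (card R) \<le> A * t ^ card R"
    using E(2) by linarith
  then show False
    by (simp add: t_def)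
qed

section \<open>Dimension of tangent spaces\<close>

lemma sum_units:
  fixes c :: "'v \<Rightarrow> 'a::comm_semiring_1"
  assumes "finite I"
  shows "(\<Sum>e\<in>I. c e * (if i = e then 1 else 0)) = (if i \<in> I then c i else 0)"
proof -
  have "(\<Sum>e\<in>I. c e * (if i = e then 1 else 0)) = (\<Sum>e\<in>I. if i = e then c e else 0)"
    by (intro sum.cong) auto
  then show ?thesis
    using assms by simp
qed

lemma lin_indep_units: "lin_indep I (\<lambda>i j. if j = i then 1 else (0::'a::field)) (UNIV :: 'v set)" if "finite I"
  unfolding lin_indep_def
proof (intro allI impI ballI)
  fix c :: "'v \<Rightarrow> 'a" and i
  assume c: "\<forall>x\<in>UNIV. (\<Sum>e\<in>I. c e * (if x = e then 1 else 0)) = 0" and i: "i \<in> I"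
  have "(\<Sum>e\<in>I. c e * (if i = e then 1 else 0)) = c i"
    using that i by (simp add: sum_units)
  with c show "c i = 0"
    by simp
qed

text \<open>Gaussian elimination: if the next functional is not zero on the family, one vector
  serves as pivot, is subtracted from the others and dropped. So each equation costs at most one
  vector.\<close>

lemma hyperplanes_lin_indep:
  fixes l :: "nat \<Rightarrow> ('v \<Rightarrow> 'a::field) \<Rightarrow> 'a"
  assumes "finite I" and lin: "\<And>j a b v w. l j (\<lambda>i. a * v i + b * w i) = a * l j v + b * l j w"
  shows "\<exists>E f. finite (E :: 'v set) \<and> card I \<le> card E + k \<and> lin_indep E f UNIV \<and>
    (\<forall>e\<in>E. f e \<in> affine_space I \<and> (\<forall>j<k. l j (f e) = 0))"
proof (induction k)
  case 0
  show ?case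
    using assms(1) lin_indep_units[OF assms(1)]
    by (intro exI[of _ I] exI[of _ "\<lambda>i j. if j = i then 1 else 0"]) (auto simp: affine_space_def)
next
  case (Suc k)
  then obtain E :: "'v set" and f where E: "finite E" "card I \<le> card E + k" "lin_indep E f UNIV"
      "\<forall>e\<in>E. f e \<in> affine_space I \<and> (\<forall>j<k. l j (f e) = 0)"
    by (elim exE conjE)
  show ?case
  proof (cases "\<forall>e\<in>E. l k (f e) = 0")
    case True
    then show ?thesis
      using E by (intro exI[of _ E] exI[of _ f]) (auto simp: less_Suc_eq)
  next
    case False
    then obtain e0 where e0: "e0 \<in> E" "l k (f e0) \<noteq> 0"
      by blast
    define d where "d = (\<lambda>e. l k (f e) / l k (f e0))"
    define f' where "f' = (\<lambda>e i. 1 * f e i + (- d e) * f e0 i)"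
    let ?E = "E - {e0}"
    have "card E = Suc (card ?E)"
      using card.remove[OF E(1) e0(1)] .
    then have "card I \<le> card ?E + Suc k"
      using E(2) by simp
    moreover have "lin_indep ?E f' UNIV"
      unfolding lin_indep_def
    proof (intro allI impI)
      fix c assume c: "\<forall>x\<in>UNIV. (\<Sum>e\<in>?E. c e * f' e x) = 0"
      define c' where "c' = (\<lambda>e. if e = e0 then - (\<Sum>e\<in>?E. c e * d e) else c e)"
      have "(\<Sum>e\<in>E. c' e * f e x) = 0" for x
      proof -
        have "(\<Sum>e\<in>E. c' e * f e x) = c' e0 * f e0 x + (\<Sum>e\<in>?E. c' e * f e x)"
          by (rule sum.remove[OF E(1) e0(1)])
        also have "(\<Sum>e\<in>?E. c' e * f e x) = (\<Sum>e\<in>?E. c e * f e x)"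
          by (intro sum.cong) (auto simp: c'_def)
        also have "c' e0 * f e0 x + \<dots> = (\<Sum>e\<in>?E. c e * f' e x)"
          by (simp add: c'_def f'_def algebra_simps sum_subtractf sum_distrib_left)
        finally show ?thesis
          using c by simp
      qed
      then have "c' e = 0" if "e \<in> E" for e
        using lin_indepD[OF E(3), of c' e] that by blast
      moreover have "c' e = c e" if "e \<in> ?E" for e
        using that by (simp add: c'_def)
      ultimately show "\<forall>e\<in>?E. c e = 0"
        by simp
    qed
    moreover have "f' e \<in> affine_space I \<and> (\<forall>j<Suc k. l j (f' e) = 0)" if e: "e \<in> ?E" for e
    proof (intro conjI allI impI)
      show "f' e \<in> affine_space I"
        using E(4) e e0(1) by (auto simp: affine_space_def f'_def)
      fix j assume "j < Suc k"
      have "l j (f' e) = 1 * l j (f e) + (- d e) * l j (f e0)"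
        unfolding f'_def by (rule lin)
      then show "l j (f' e) = 0"
        using \<open>j < Suc k\<close> E(4) e e0 by (cases "j = k") (auto simp: d_def)
    qed
    ultimately show ?thesis
      using E(1) by (intro exI[of _ ?E] exI[of _ f']) blast
  qed
qed

lemma span_units:
  assumes "finite R" "w \<in> affine_space R"
  shows "w \<in> fs.span ((\<lambda>i j. if j = i then 1 else (0::'a::field)) ` R)"
proof -
  have "(\<Sum>i\<in>R. (\<lambda>j. w i * (if j = i then 1 else 0))) \<in> fs.span ((\<lambda>i j. if j = i then 1 else (0::'a)) ` R)"
    by (intro fs.span_sum fs.span_scale fs.span_base imageI)
  also have "(\<Sum>i\<in>R. (\<lambda>j. w i * (if j = i then 1 else 0))) = w"
    using assms by (auto simp: fun_eq_iff sum_fun_apply affine_space_def sum_units)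
  finally show ?thesis .
qed

lemma independent_imp_lin_indep:
  assumes "finite T" "fs.independent T"
  shows "lin_indep T (\<lambda>t. t) (UNIV :: 'v set)"
  unfolding lin_indep_def
proof (intro allI impI ballI)
  fix c :: "('v \<Rightarrow> 'a) \<Rightarrow> 'a" and t
  assume c: "\<forall>x\<in>UNIV. (\<Sum>e\<in>T. c e * e x) = 0" and t: "t \<in> T"
  have "(\<Sum>v\<in>T. (\<lambda>i. c v * v i)) = 0"
    using c by (auto simp: fun_eq_iff sum_fun_apply)
  then show "c t = 0"
    using assms t unfolding fs.dependent_finite[OF assms(1)] by blast
qed

text \<open>Counting equations gives dimension at least \<open>card R\<close>; injectivity on
  \<open>S\<close> of the projection to the coordinates in \<open>R\<close> gives at most
  \<open>card R\<close>.\<close>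

lemma dim_hyperplanes:
  fixes l :: "nat \<Rightarrow> ('v \<Rightarrow> 'a::field) \<Rightarrow> 'a"
  assumes I: "finite I" and R: "R \<subseteq> I"
    and lin: "\<And>j a b v w. l j (\<lambda>i. a * v i + b * w i) = a * l j v + b * l j w"
    and S: "S = {w\<in>affine_space I. \<forall>j<k. l j w = 0}"
    and card: "card I = card R + k"
    and inj: "\<And>w. w \<in> S \<Longrightarrow> (\<And>i. i \<in> R \<Longrightarrow> w i = 0) \<Longrightarrow> w = (\<lambda>i. 0)"
  shows "fs.dim S = card R"
proof -
  have finR: "finite R"
    using I R finite_subset by blast
  have sub: "(\<lambda>i. a * v i + b * w i) \<in> S" if "v \<in> S" "w \<in> S" for a b v w
    using that lin by (auto simp: S affine_space_def)
  obtain T where T: "T \<subseteq> S" "fs.independent T" "S \<subseteq> fs.span T" "card T = fs.dim S"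
    using fs.basis_exists[of S] by blast
  have "T \<subseteq> fs.span ((\<lambda>i j. if j = i then 1 else 0) ` I)"
    using T(1) S span_units[OF I] by blast
  then have finT: "finite T"
    using fs.independent_span_bound[OF finite_imageI[OF I] T(2)] by blast
  have "lin_indep T (proj R) UNIV"
    unfolding lin_indep_def
  proof (intro allI impI)
    fix c assume c: "\<forall>x\<in>UNIV. (\<Sum>t\<in>T. c t * proj R t x) = 0"
    let ?w = "\<lambda>x. \<Sum>t\<in>T. c t * t x"
    have "(\<lambda>x. \<Sum>t\<in>T'. c t * t x) \<in> S" if "finite T'" "T' \<subseteq> T" for T'
      using that
    proof (induction T' rule: finite_induct)
      case empty
      have "l j (\<lambda>i. 0) = 0" for j
        using lin[of j 0 "\<lambda>i. 0" 0 "\<lambda>i. 0"] by simp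
      then show ?case
        by (simp add: S affine_space_def)
    next
      case (insert t T')
      then have "(\<lambda>x. c t * t x + 1 * (\<Sum>t\<in>T'. c t * t x)) \<in> S"
        using T(1) by (intro sub) auto
      then show ?case
        using insert by simp
    qed
    then have "?w \<in> S"
      using finT by blast
    moreover have "?w i = 0" if "i \<in> R" for i
      using c[rule_format, of i] that by (simp add: proj_def)
    ultimately have "?w = (\<lambda>i. 0)"
      by (rule inj)
    then have "\<forall>x\<in>UNIV. (\<Sum>t\<in>T. c t * t x) = 0"
      by (auto simp: fun_eq_iff)
    then show "\<forall>t\<in>T. c t = 0"
      using independent_imp_lin_indep[OF finT T(2)] unfolding lin_indep_def by blast
  qed
  then have "card T \<le> card ((\<lambda>i j. if j = i then 1 else (0::'a)) ` R)"
    using span_units[OF finR proj_in] by (intro lin_indep_card_le[OF finT _ finite_imageI[OF finR]]) auto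
  also have "\<dots> \<le> card R"
    by (rule card_image_le[OF finR])
  finally have upper: "card T \<le> card R" .
  from hyperplanes_lin_indep[of I l, OF I lin, of k]
  obtain E :: "'v set" and f where E: "finite E" "card I \<le> card E + k" "lin_indep E f UNIV"
      "\<forall>e\<in>E. f e \<in> affine_space I \<and> (\<forall>j<k. l j (f e) = 0)"
    by (elim exE conjE)
  have "card E \<le> card T"
  proof (rule lin_indep_card_le[OF E(1,3) finT])
    fix e assume "e \<in> E"
    then have "f e \<in> S"
      using E(4) by (simp add: S)
    then show "(\<lambda>x. if x \<in> UNIV then f e x else 0) \<in> fs.span T"
      using T(3) by auto
  qed
  then show ?thesis
    using upper E(2) card T(4) by linarith
qed

section \<open>Codimension and singular points of a tower\<close>


text \<open>\<open>g\<close> records that the lifted set still dominates \<open>W\<close>. This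
  later yields points of the lift with prescribed generic projection, which make inclusions
  strict.\<close>

lemma tower_lift_closed:
  fixes V :: "('v \<Rightarrow> 'a::alg_closed_field) set"
  assumes tow: "tower R I V" and V: "zariski_closed I V"
    and W: "W \<subseteq> affine_space R" "prime_set R W"
    and Y: "irreducible_closed I Y" "Y \<subseteq> V" "proj R ` Y \<subseteq> W"
  shows "\<exists>Z g. irreducible_closed I Z \<and> Y \<subseteq> Z \<and> Z \<subseteq> V \<and>
    (\<forall>f\<in>reg R. (\<forall>w\<in>W. f w = 0) \<longrightarrow> (\<forall>z\<in>Z. f z = 0)) \<and>
    g \<in> reg R \<and> (\<exists>w\<in>W. g w \<noteq> 0) \<and> (\<forall>w\<in>W. g w \<noteq> 0 \<longrightarrow> (\<exists>z\<in>Z. proj R z = w))"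
proof -
  have "prime_set I Y"
    using Y(1) by (simp add: irreducible_closed_iff)
  have "\<exists>h\<in>reg I. prime_set I {x\<in>V. proj R x \<in> W \<and> h x \<noteq> 0} \<and>
      Y \<subseteq> zclosure I {x\<in>V. proj R x \<in> W \<and> h x \<noteq> 0}"
    by (rule tower_lift[OF tow W \<open>prime_set I Y\<close> Y(2)]) (use Y(3) in blast)
  then obtain h where h: "h \<in> reg I"
    "prime_set I {x\<in>V. proj R x \<in> W \<and> h x \<noteq> 0}" "Y \<subseteq> zclosure I {x\<in>V. proj R x \<in> W \<and> h x \<noteq> 0}"
    by (elim bexE conjE)
  define U where "U = {x\<in>V. proj R x \<in> W \<and> h x \<noteq> 0}"
  have UV: "U \<subseteq> V" and VI: "V \<subseteq> affine_space I" and RI: "R \<subseteq> I"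
    using tower_subset[OF tow] by (auto simp: U_def)
  have U: "prime_set I U" "Y \<subseteq> zclosure I U"
    using h by (simp_all add: U_def)
  then obtain x0 where "x0 \<in> U"
    by (auto simp: prime_set_def)
  then have x0: "x0 \<in> V" "proj R x0 \<in> W" "h x0 \<noteq> 0"
    by (auto simp: U_def)
  from tower_open_over[OF tow W(1) h(1) x0] obtain g where g: "g \<in> reg R" "(\<exists>w\<in>W. g w \<noteq> 0) \<and>
    (\<forall>z\<in>W. g z \<noteq> 0 \<longrightarrow> (\<exists>x\<in>V. proj R x = z \<and> h x \<noteq> 0))"
    by (elim bexE)
  note g = g(1) conjunct1[OF g(2)] conjunct2[OF g(2)]
  show ?thesis
  proof (intro exI[of _ "zclosure I U"] exI[of _ g] conjI ballI impI)
    show "irreducible_closed I (zclosure I U)"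
      using UV VI U(1) by (intro irreducible_closed_zclosure) auto
    show "Y \<subseteq> zclosure I U" "g \<in> reg R" "\<exists>w\<in>W. g w \<noteq> 0"
      by (rule U(2) g)+
    show "zclosure I U \<subseteq> V"
      by (rule zclosure_minimal[OF UV V])
    show "f z = 0" if f: "f \<in> reg R" "\<forall>w\<in>W. f w = 0" "z \<in> zclosure I U" for f z
    proof (rule zclosure_vanish[OF _ _ f(3)])
      show "f \<in> reg I"
        by (rule reg_mono[OF f(1) RI])
      fix u assume "u \<in> U"
      then have "f (proj R u) = 0"
        by (intro f(2)[rule_format]) (simp add: U_def)
      then show "f u = 0"
        by (simp add: reg_proj[OF f(1)])
    qed
    show "\<exists>z\<in>zclosure I U. proj R z = w" if w: "w \<in> W" "g w \<noteq> 0" for w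
    proof -
      obtain x where x: "x \<in> V" "proj R x = w" "h x \<noteq> 0"
        using bspec[OF g(3) w(1)] w(2) by blast
      then have "x \<in> U"
        using w(1) by (simp add: U_def)
      then have "x \<in> zclosure I U"
        using subset_zclosure[of U I] UV VI by blast
      with x(2) show ?thesis
        by blast
    qed
  qed
qed

section \<open>Chains through a point and local dimension\<close>

lemma irreducible_chain_extend:
  assumes "irreducible_chain I V k Z" "irreducible_closed I D" "D \<subseteq> V" "Z k \<subset> D"
  shows "irreducible_chain I V (Suc k) (\<lambda>j. if j \<le> k then Z j else D)"
  unfolding irreducible_chain_def
proof (intro conjI allI impI)
  fix i
  show "irreducible_closed I (if i \<le> k then Z i else D)" "(if i \<le> k then Z i else D) \<subseteq> V"
    using assms by (simp_all add: irreducible_chain_def)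
  assume "i < Suc k"
  then consider "i < k" | "i = k"
    by linarith
  then show "(if i \<le> k then Z i else D) \<subset> (if Suc i \<le> k then Z (Suc i) else D)"
    using assms by cases (simp_all add: irreducible_chain_def)
qed

text \<open>Base coordinates are released one at a time. The top of the chain lies over the plane
  through the projection of \<open>x\<close> with directions \<open>Q\<close>; a lift over the plane
  with one more direction contains a point whose new coordinate differs from that of
  \<open>x\<close>, so it is strictly larger.\<close>

lemma tower_chain:
  fixes V :: "('v \<Rightarrow> 'a::alg_closed_field) set"
  assumes tow: "tower R I V" and V: "zariski_closed I V" and x: "x \<in> V" and "finite Q" "Q \<subseteq> R"
  shows "\<exists>Z. irreducible_chain I V (card Q) Z \<and> Z 0 = {x} \<and> (\<forall>y\<in>Z (card Q). \<forall>i\<in>R - Q. y i = x i)"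
  using assms(4,5)
proof (induction Q rule: finite_induct)
  case empty
  have "irreducible_closed I {x}"
    using x tower_subset[OF tow] by (intro irreducible_closed_point) blast
  then have "irreducible_chain I V 0 (\<lambda>_. {x})"
    using x by (simp add: irreducible_chain_def)
  then show ?case
    by (intro exI[of _ "\<lambda>_. {x}"]) simp
next
  case (insert i Q)
  then obtain Z where Z: "irreducible_chain I V (card Q) Z" "Z 0 = {x}"
      "\<forall>y\<in>Z (card Q). \<forall>i\<in>R - Q. y i = x i"
    by (meson insert_subset)
  define W where "W = {z\<in>affine_space R. \<forall>k\<in>R - insert i Q. z k = x k}"
  have iR: "i \<in> R" "i \<notin> Q"
    using insert by auto
  have xW: "proj R x \<in> W"
    by (auto simp: W_def) (simp add: proj_def)
  have "prime_set R W"
  proof (rule prime_set_lines)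
    show "W \<noteq> {}"
      using xW by blast
  qed (auto simp: W_def affine_space_def)
  have Y: "irreducible_closed I (Z (card Q))" "Z (card Q) \<subseteq> V"
    using Z(1) by (auto simp: irreducible_chain_def)
  have YW: "proj R ` Z (card Q) \<subseteq> W"
    using Z(3) by (auto simp: W_def) (simp add: proj_def)
  have WR: "W \<subseteq> affine_space R"
    by (auto simp: W_def)
  from tower_lift_closed[OF tow V WR \<open>prime_set R W\<close> Y YW]
  obtain D g where D: "irreducible_closed I D" "Z (card Q) \<subseteq> D" "D \<subseteq> V"
    "\<forall>f\<in>reg R. (\<forall>w\<in>W. f w = 0) \<longrightarrow> (\<forall>z\<in>D. f z = 0)"
    and g: "g \<in> reg R" "\<exists>w\<in>W. g w \<noteq> 0" "\<forall>w\<in>W. g w \<noteq> 0 \<longrightarrow> (\<exists>z\<in>D. proj R z = w)"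
    by (elim exE conjE)
  note D = D(1-3) D(4)[rule_format] and g = g(1,2) g(3)[rule_format]
  have reg: "(\<lambda>z. z k - x k) \<in> reg R" if "k \<in> R" for k
    using that by (intro reg_intros)
  have "(proj R x)(i := x i + 1) \<in> W"
    using xW iR by (auto simp: W_def affine_space_def)
  then have "\<exists>w\<in>W. w i - x i \<noteq> 0"
    by (intro bexI[of _ "(proj R x)(i := x i + 1)"]) auto
  from prime_set_two[OF \<open>prime_set R W\<close> g(1) reg[OF iR(1)] g(2) this] obtain w where w: "w \<in> W" "g w \<noteq> 0" "w i \<noteq> x i"
    by auto
  then obtain z where z: "z \<in> D" "proj R z = w"
    using g(3) by blast
  have "z i = w i"
    using z(2) iR(1) by (auto simp: proj_def)
  then have "z \<notin> Z (card Q)"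
    using Z(3) iR w(3) by auto
  then have "Z (card Q) \<subset> D"
    using D(2) z(1) by blast
  then have "irreducible_chain I V (Suc (card Q)) (\<lambda>j. if j \<le> card Q then Z j else D)"
    by (rule irreducible_chain_extend[OF Z(1) D(1,3)])
  moreover have "y k = x k" if "y \<in> D" "k \<in> R - insert i Q" for y k
  proof -
    have "k \<in> R"
      using that(2) by blast
    then have "y k - x k = 0"
      by (rule D(4)[where f = "\<lambda>z. z k - x k", OF reg _ that(1)]) (use that(2) in \<open>simp add: W_def\<close>)
    then show ?thesis
      by simp
  qed
  ultimately show ?case
    using insert.hyps Z(2) by (intro exI[of _ "\<lambda>j. if j \<le> card Q then Z j else D"]) simp
qed

text \<open>A chain of length \<open>card R\<close> from \<open>{x}\<close> must end in a maximal
  irreducible set, as an extension would violate \<open>tower_chain_le\<close>. Its end is therefore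
  a component through \<open>x\<close> of the largest possible dimension.\<close>

lemma tower_local_dim:
  fixes V :: "('v \<Rightarrow> 'a::alg_closed_field) set"
  assumes tow: "tower R I V" and V: "zariski_closed I V" and x: "x \<in> V" and fin: "finite R"
  shows "local_dim I V x = enat (card R)"
proof (rule antisym)
  have "variety_dim I C \<le> enat (card R)" if "C \<subseteq> V" for C
    unfolding variety_dim_def
  proof (rule Sup_least)
    fix e assume "e \<in> {enat k |k Z. irreducible_chain I C k Z}"
    then obtain k Z where e: "e = enat k" "irreducible_chain I C k Z"
      by blast
    then have "irreducible_chain I V k Z"
      using that by (auto simp: irreducible_chain_def)
    then show "e \<le> enat (card R)"
      using tower_chain_le[OF tow fin] e(1) by simp
  qed
  then show "local_dim I V x \<le> enat (card R)"
    unfolding local_dim_def by (intro Sup_least) (auto simp: irreducible_component_def)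
  obtain Z where Z: "irreducible_chain I V (card R) Z" "Z 0 = {x}"
    using tower_chain[OF tow V x fin] by blast
  let ?C = "Z (card R)"
  have C: "irreducible_closed I ?C" "?C \<subseteq> V"
    using Z(1) by (auto simp: irreducible_chain_def)
  have "D = ?C" if D: "irreducible_closed I D" "D \<subseteq> V" "?C \<subseteq> D" for D
  proof (rule ccontr)
    assume "D \<noteq> ?C"
    then have "?C \<subset> D"
      using D(3) by blast
    then show False
      using tower_chain_le[OF tow fin irreducible_chain_extend[OF Z(1) D(1,2)]] by simp
  qed
  then have comp: "irreducible_component I V ?C"
    using C by (simp add: irreducible_component_def)
  have mono: "Z i \<subseteq> Z j" if "i \<le> j" "j \<le> card R" for i j
    using that
  proof (induction j rule: dec_induct)
    case (step j)
    then have "Z j \<subset> Z (Suc j)"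
      using Z(1) by (auto simp: irreducible_chain_def)
    then show ?case
      using step by auto
  qed simp
  have "x \<in> ?C"
    using mono[of 0 "card R"] Z(2) by auto
  moreover have "irreducible_chain I ?C (card R) Z"
    using Z(1) mono by (auto simp: irreducible_chain_def)
  then have "enat (card R) \<le> variety_dim I ?C"
    unfolding variety_dim_def by (intro Sup_upper) blast
  ultimately show "enat (card R) \<le> local_dim I V x"
    unfolding local_dim_def using comp by (intro Sup_upper2[of "variety_dim I ?C"]) auto
qed

lemma two_le_codim:
  assumes "\<And>Y. irreducible_closed I Y \<Longrightarrow> Y \<subseteq> W \<Longrightarrow> \<exists>Z1 Z2. irreducible_closed I Z1 \<and>
    irreducible_closed I Z2 \<and> Y \<subset> Z1 \<and> Z1 \<subset> Z2 \<and> Z2 \<subseteq> V"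
  shows "2 \<le> codim I V W"
  unfolding codim_def
proof (rule Inf_greatest)
  fix e assume "e \<in> {Sup {enat k |k Z. irreducible_chain I V k Z \<and> Z 0 = Y} |Y. irreducible_closed I Y \<and> Y \<subseteq> W}"
  then obtain Y where Y: "e = Sup {enat k |k Z. irreducible_chain I V k Z \<and> Z 0 = Y}"
      "irreducible_closed I Y" "Y \<subseteq> W"
    by blast
  then obtain Z1 Z2 where Z: "irreducible_closed I Z1" "irreducible_closed I Z2" "Y \<subset> Z1" "Z1 \<subset> Z2" "Z2 \<subseteq> V"
    using assms[OF Y(2,3)] by (elim exE conjE)
  have "irreducible_chain I V 0 (\<lambda>_. Y)"
    using Y(2) Z by (auto simp: irreducible_chain_def)
  from irreducible_chain_extend[OF this Z(1)] Z(3-5)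
  have 1: "irreducible_chain I V (Suc 0) (\<lambda>j. if j \<le> 0 then Y else Z1)"
    by blast
  from irreducible_chain_extend[OF this Z(2)] Z(4,5)
  have "irreducible_chain I V (Suc (Suc 0)) (\<lambda>j. if j \<le> Suc 0 then if j \<le> 0 then Y else Z1 else Z2)"
    by simp
  moreover define Q where "Q = (\<lambda>j. if j \<le> Suc 0 then if j \<le> 0 then Y else Z1 else Z2)"
  ultimately have "irreducible_chain I V (Suc (Suc 0)) Q" "Q 0 = Y"
    by simp_all
  then have "enat (Suc (Suc 0)) \<in> {enat k |k Z. irreducible_chain I V k Z \<and> Z 0 = Y}"
    by blast
  then have "enat (Suc (Suc 0)) \<le> e"
    unfolding Y(1) by (rule Sup_upper)
  then show "2 \<le> e"
    by (simp add: numeral_eq_enat numeral_2_eq_2)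
qed

section \<open>Tangent spaces of a tower\<close>

lemma tangent_spaceD:
  fixes V :: "('v \<Rightarrow> 'a::alg_closed_field) set"
  assumes "finite I" "w \<in> tangent_space I V x" "f \<in> reg I" "\<And>y. y \<in> V \<Longrightarrow> f y = 0"
  shows "dir_deriv f x w = 0"
proof -
  obtain p where p: "p \<in> mp_vars_in I" "\<forall>x. f x = mp_eval id x p"
    using reg_imp_mp_eval[OF assms(3)] by blast
  then have f: "f = (\<lambda>x. mp_eval id x p)"
    by (intro ext) simp
  have "p \<in> vanishing_ideal I V"
    using p assms(4) by (simp add: vanishing_ideal_def)
  then have "(\<Sum>i\<in>I. mp_eval id x (mp_deriv i p) * w i) = 0"
    using assms(2) by (simp add: tangent_space_def)
  then show ?thesis
    unfolding f sum_mp_deriv[OF assms(1) p(1)] .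
qed

lemma tangent_space_eq:
  fixes V :: "('v \<Rightarrow> 'a::alg_closed_field) set"
  assumes "finite I" "ideal_generators I V k E" "x \<in> V" "V \<subseteq> affine_space I"
  shows "tangent_space I V x = {w\<in>affine_space I. \<forall>j<k. dir_deriv (E j) x w = 0}"
proof (intro subset_antisym subsetI)
  fix w assume w: "w \<in> tangent_space I V x"
  have "dir_deriv (E j) x w = 0" if "j < k" for j
    by (rule tangent_spaceD[OF assms(1) w ideal_generatorsD(1)[OF assms(2) that]])
      (rule ideal_generatorsD(2)[OF assms(2) _ that])
  then show "w \<in> {w\<in>affine_space I. \<forall>j<k. dir_deriv (E j) x w = 0}"
    using w by (simp add: tangent_space_def)
next
  fix w assume w: "w \<in> {w\<in>affine_space I. \<forall>j<k. dir_deriv (E j) x w = 0}"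
  have "(\<Sum>i\<in>I. mp_eval id x (mp_deriv i p) * w i) = 0" if p: "p \<in> vanishing_ideal I V" for p
  proof -
    let ?f = "\<lambda>x. mp_eval id x p"
    have pI: "p \<in> mp_vars_in I" and p0: "\<And>y. y \<in> V \<Longrightarrow> ?f y = 0"
      using p by (auto simp: vanishing_ideal_def)
    have "?f \<in> reg I"
      using pI by (rule mp_eval_in_reg)
    then have "\<exists>h. (\<forall>i<k. h i \<in> reg I) \<and> (\<forall>x\<in>affine_space I. ?f x = (\<Sum>i<k. h i x * E i x))"
      by (rule ideal_generatorsD(3)[OF assms(2)]) (rule p0)
    then obtain h where h: "\<forall>i<k. h i \<in> reg I" "\<forall>x\<in>affine_space I. ?f x = (\<Sum>i<k. h i x * E i x)"
      by (elim exE conjE)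
    \<comment> \<open>The line stays where \<open>?f\<close> agrees with the combination of
      generators, and \<open>dir_deriv\<close> sees only this line. In the product rule the
      derivatives of the \<open>h i\<close> drop out because the generators vanish at
      \<open>x\<close>.\<close>
    have "(\<lambda>i. x i + s * w i) \<in> affine_space I" for s
      using w assms(3,4) by (auto simp: affine_space_def)
    then have "dir_deriv ?f x w = dir_deriv (\<lambda>x. \<Sum>i<k. h i x * E i x) x w"
      unfolding dir_deriv_def using h(2) by simp
    also have "\<dots> = (\<Sum>i<k. dir_deriv (\<lambda>x. h i x * E i x) x w)"
      using h(1) ideal_generatorsD(1)[OF assms(2)] by (intro dir_deriv_sum[where I = I] reg.mult) auto
    also have "\<dots> = (\<Sum>i<k. h i x * dir_deriv (E i) x w + dir_deriv (h i) x w * E i x)"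
      using h(1) ideal_generatorsD(1)[OF assms(2)] by (intro sum.cong dir_deriv_mult[where I = I]) auto
    also have "\<dots> = 0"
      using w ideal_generatorsD(2)[OF assms(2,3)] by (intro sum.neutral) auto
    finally show ?thesis
      unfolding sum_mp_deriv[OF assms(1) pI] .
  qed
  then show "w \<in> tangent_space I V x"
    using w by (simp add: tangent_space_def)
qed

text \<open>The tangent space is cut out by \<open>card I - card R\<close> linear equations, so
  injectivity of its projection to the base forces its dimension to be the local dimension
  \<open>card R\<close>.\<close>

lemma tower_nonsingular:
  fixes V :: "('v \<Rightarrow> 'a::alg_closed_field) set"
  assumes tow: "tower R I V" and V: "zariski_closed I V" and x: "x \<in> V" and fin: "finite R"
    and inj: "\<And>w. w \<in> tangent_space I V x \<Longrightarrow> (\<And>i. i \<in> R \<Longrightarrow> w i = 0) \<Longrightarrow> w = (\<lambda>i. 0)"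
  shows "x \<notin> singular_locus I V"
proof -
  obtain E k where E: "k + card R = card I" "ideal_generators I V k E"
    using tower_ideal[OF tow fin] by blast
  have I: "finite I" "R \<subseteq> I" "V \<subseteq> affine_space I"
    using tower_finite[OF tow fin] tower_subset[OF tow] by auto
  define l where "l = (\<lambda>j w. if j < k then dir_deriv (E j) x w else 0)"
  have T: "tangent_space I V x = {w\<in>affine_space I. \<forall>j<k. l j w = 0}"
    unfolding tangent_space_eq[OF I(1) E(2) x I(3)] l_def by auto
  have "fs.dim (tangent_space I V x) = card R"
  proof (rule dim_hyperplanes[OF I(1,2) _ T _ inj])
    show "l j (\<lambda>i. a * v i + b * w i) = a * l j v + b * l j w" for j a b v w
      using dir_deriv_linear[OF ideal_generatorsD(1)[OF E(2)]] by (simp add: l_def)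
  qed (use E(1) in auto)
  then show ?thesis
    unfolding singular_locus_def using tower_local_dim[OF tow V x fin] by simp
qed

section \<open>Polynomials sharing their nonconstant coefficients\<close>

lemma coeff_1_pcompose_linear:
  fixes p :: "'a::idom poly"
  shows "coeff (pcompose p [:a, b:]) 1 = b * poly (pderiv p) a"
proof -
  have "coeff (pcompose p [:a, b:]) 1 = poly (pderiv (pcompose p [:a, b:])) 0"
    by (simp add: poly_0_coeff_0 coeff_pderiv)
  then show ?thesis
    by (simp add: pderiv_pcompose poly_pcompose pderiv_pCons)
qed

lemma dir_deriv_poly_const:
  fixes p :: "'a::alg_closed_field poly"
  assumes "\<And>s. f (\<lambda>i. x i + s * w i) = poly p (x v + s * w v)"
  shows "dir_deriv f x w = w v * poly (pderiv p) (x v)"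
proof -
  have "dir_deriv f x w = coeff (pcompose p [:x v, w v:]) 1"
    by (rule dir_deriv_eqI) (simp add: assms poly_pcompose algebra_simps)
  then show ?thesis
    by (simp only: coeff_1_pcompose_linear)
qed

text \<open>An element repeated in the root multiset of \<open>q\<close> would be a double root of
  \<open>p\<close>.\<close>

lemma separable_card_roots:
  fixes p q :: "'a::alg_closed_field poly"
  assumes "p \<noteq> 0" "q dvd p" "\<And>t. poly p t = 0 \<Longrightarrow> poly (pderiv p) t \<noteq> 0"
  shows "card {t. poly q t = 0} = degree q"
proof -
  have "q \<noteq> 0"
    using assms(1,2) by auto
  obtain M where M: "size M = degree q" "q = smult (lead_coeff q) (\<Prod>x\<in>#M. [:-x, 1:])"
    using alg_closed_imp_factorization[OF \<open>q \<noteq> 0\<close>] by blast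
  have qM: "poly q t = lead_coeff q * (\<Prod>x\<in>#M. t - x)" for t
    by (subst M(2)) (simp add: poly_prod_mset image_mset.compositionality o_def)
  have roots: "{t. poly q t = 0} = set_mset M"
    using \<open>q \<noteq> 0\<close> by (auto simp: qM prod_mset_zero_iff)
  have "count M x \<le> 1" for x
  proof (rule ccontr)
    assume "\<not> count M x \<le> 1"
    then have "{#x, x#} \<subseteq># M"
      by (auto simp: subseteq_mset_def)
    then obtain M' where M': "M = {#x, x#} + M'"
      by (metis subset_mset.add_diff_inverse)
    have "(\<Prod>x\<in>#M. [:-x, 1:]) = [:-x, 1:] * [:-x, 1:] * (\<Prod>x\<in>#M'. [:-x, 1:])"
      unfolding M' by (simp add: mult.assoc del: mult_pCons_left mult_pCons_right)
    then have "[:-x, 1:] * [:-x, 1:] dvd (\<Prod>x\<in>#M. [:-x, 1:])"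
      by (simp only: dvd_triv_left)
    then have "[:-x, 1:] * [:-x, 1:] dvd q"
      by (subst M(2)) (rule dvd_smult)
    then have "[:-x, 1:] * [:-x, 1:] dvd p"
      using assms(2) by (rule dvd_trans)
    then obtain r where "p = [:-x, 1:] * [:-x, 1:] * r"
      by (elim dvdE)
    then have "poly p x = 0" "poly (pderiv p) x = 0"
      by (simp_all only: pderiv_mult poly_mult poly_add) simp_all
    then show False
      using assms(3) by blast
  qed
  then have "count M x = 1" if "x \<in># M" for x
    using that by (simp add: le_antisym)
  then have "size M = card (set_mset M)"
    by (simp add: size_multiset_overloaded_eq)
  then show ?thesis
    using roots M(1) by simp
qed

lemma finite_exceptions:
  fixes z w :: "'v \<Rightarrow> 'a::alg_closed_field"
  assumes "g \<in> reg R" "g z \<noteq> 0" "finite S"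
  shows "\<exists>s. s \<notin> S \<and> g (\<lambda>i. z i + s * w i) \<noteq> 0"
proof -
  obtain P where P: "\<And>s. poly P s = g (\<lambda>i. z i + s * w i)"
    using reg_line[OF assms(1)] by blast
  have "P \<noteq> 0"
    using P[of 0] assms(2) by auto
  then have "finite ({s. poly P s = 0} \<union> S)"
    using assms(3) by (simp add: poly_roots_finite)
  then obtain s where "s \<notin> {s. poly P s = 0} \<union> S"
    using infinite_UNIV_alg_closed ex_new_if_finite by blast
  then show ?thesis
    using P by auto
qed

text \<open>The two polynomials at a point \<open>x\<close> are \<open>T0 + (\<Sum>i=1..N. monom (x (bc i)) i) + [:x c:]\<close> for
  \<open>c = c1, c2\<close>; the coordinates in \<open>A1\<close> and \<open>A2\<close> are roots of the first and the second one.\<close>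

locale polynomial_pair =
  fixes d N :: nat and T0 :: "'a::alg_closed_field poly" and bc :: "nat \<Rightarrow> 'v"
    and c1 c2 :: 'v and A1 A2 :: "'v set"
  assumes degT0: "degree T0 = d" and monic: "lead_coeff T0 = 1"
    and N: "3 \<le> N" "N < d"
    and inj_bc: "inj_on bc {1..N}"
    and finA: "finite A1" "finite A2" and cardA: "card A1 \<le> d" "card A2 \<le> d"
    and disj: "c1 \<noteq> c2" "c1 \<notin> bc ` {1..N}" "c2 \<notin> bc ` {1..N}"
      "A1 \<inter> A2 = {}" "c1 \<notin> A1 \<union> A2" "c2 \<notin> A1 \<union> A2" "bc ` {1..N} \<inter> (A1 \<union> A2) = {}"
begin

text \<open>Transfers what is proved for a multiple root in \<open>A1\<close> to one in
  \<open>A2\<close>.\<close>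

lemma polynomial_pair_swap: "polynomial_pair d N T0 bc c2 c1 A2 A1"
  by unfold_locales (use degT0 monic N inj_bc finA cardA disj disj(1)[symmetric]
    in \<open>simp_all only: Int_commute Un_commute not_False_eq_True\<close>)

definition F0 :: "('v \<Rightarrow> 'a) \<Rightarrow> 'a poly" where
  "F0 x = T0 + (\<Sum>i=1..N. monom (x (bc i)) i)"

definition FF :: "'v \<Rightarrow> ('v \<Rightarrow> 'a) \<Rightarrow> 'a poly" where
  "FF c x = F0 x + [:x c:]"

definition roots :: "'v set \<Rightarrow> ('v \<Rightarrow> 'a) \<Rightarrow> 'a poly" where
  "roots S x = (\<Prod>v\<in>S. [:-x v, 1:])"

definition idx :: "'v set \<Rightarrow> 'v set" where
  "idx S = bc ` {1..N} \<union> {c1, c2} \<union> S"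

text \<open>The intermediate stages of the tower, at which only the roots named in \<open>S\<close>
  have been adjoined.\<close>

definition VV :: "'v set \<Rightarrow> ('v \<Rightarrow> 'a) set" where
  "VV S = {x\<in>affine_space (idx S). roots (S \<inter> A1) x dvd FF c1 x \<and> roots (S \<inter> A2) x dvd FF c2 x}"

lemma degree_low: "degree (\<Sum>i=1..N. monom (x (bc i)) i :: 'a poly) \<le> N"
  by (rule degree_sum_le) (auto intro: order_trans[OF degree_monom_le])

lemma degree_F0: "degree (F0 x) = d" and lead_coeff_F0: "lead_coeff (F0 x) = 1"
proof -
  have "degree (\<Sum>i=1..N. monom (x (bc i)) i :: 'a poly) < degree T0"
    using degree_low[of x] N degT0 by linarith
  then show "degree (F0 x) = d" "lead_coeff (F0 x) = 1"
    using degT0 monic by (simp_all add: F0_def degree_add_eq_left coeff_eq_0)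
qed

lemma degree_FF: "degree (FF c x) = d" and lead_coeff_FF: "lead_coeff (FF c x) = 1"
proof -
  have "degree [:x c:] < degree (F0 x)"
    using degree_F0[of x] N by simp
  then show "degree (FF c x) = d" "lead_coeff (FF c x) = 1"
    using degree_F0[of x] lead_coeff_F0[of x] by (simp_all add: FF_def degree_add_eq_left coeff_eq_0)
qed

lemma FF_nonzero: "FF c x \<noteq> 0"
  using lead_coeff_FF[of c x] by auto

lemma pderiv_FF: "pderiv (FF c x) = pderiv (F0 x)"
  by (simp add: FF_def pderiv_add pderiv_pCons)

lemma regpoly_F0: "bc ` {1..N} \<subseteq> I \<Longrightarrow> F0 \<in> regpoly I"
proof -
  assume "bc ` {1..N} \<subseteq> I"
  then have "(\<lambda>x. T0 + (\<Sum>i=1..N. monom (x (bc i)) i)) \<in> regpoly I"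
    by (intro regp_add regp_const regp_sum regp_monom reg.coord) auto
  then show ?thesis
    by (simp add: F0_def[abs_def])
qed

lemma regpoly_FF: "bc ` {1..N} \<subseteq> I \<Longrightarrow> c \<in> I \<Longrightarrow> FF c \<in> regpoly I"
proof -
  assume "bc ` {1..N} \<subseteq> I" "c \<in> I"
  then have "(\<lambda>x. F0 x + [:x c:]) \<in> regpoly I"
    by (intro regp_add regpoly_F0 regp_pCons regp_const reg.coord) auto
  then show ?thesis
    by (simp add: FF_def[abs_def])
qed

lemma regpoly_roots: "S \<subseteq> I \<Longrightarrow> roots S \<in> regpoly I"
proof -
  assume "S \<subseteq> I"
  then have "(\<lambda>x. \<Prod>v\<in>S. [:-x v, 1:]) \<in> regpoly I"
    by (intro regp_prod regp_pCons regp_const reg_uminus reg.coord) auto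
  then show ?thesis
    by (simp add: roots_def[abs_def])
qed

lemma degree_roots: "degree (roots S x) = card S" if "finite S"
  unfolding roots_def using that by (subst degree_prod_eq_sum_degree) auto

lemma lead_coeff_roots: "lead_coeff (roots S x) = 1"
  unfolding roots_def by (simp add: lead_coeff_prod)

lemma F0_cong: "(\<And>i. i \<in> {1..N} \<Longrightarrow> x (bc i) = y (bc i)) \<Longrightarrow> F0 x = F0 y"
  by (simp add: F0_def)

text \<open>Divisibility by a monic polynomial is the vanishing of the coefficients of the
  remainder, which are regular.\<close>

lemma VV_closed: "S \<subseteq> A1 \<union> A2 \<Longrightarrow> zariski_closed (idx S) (VV S)"
proof -
  let ?r = "\<lambda>c A j x. coeff (FF c x mod roots (S \<inter> A) x) j"
  have reg: "?r c A j \<in> reg (idx S)" if "c \<in> {c1, c2}" "A \<in> {A1, A2}" for c A j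
    using that finA lead_coeff_roots
    by (intro regp_coeff regp_div_mod(2)[where e = "card (S \<inter> A)"] regpoly_FF regpoly_roots degree_roots)
      (auto simp: idx_def)
  let ?S = "range (?r c1 A1) \<union> range (?r c2 A2)"
  have "VV S = {x\<in>affine_space (idx S). \<forall>f\<in>?S. f x = 0}"
    unfolding VV_def dvd_eq_mod_eq_0 poly_eq_iff by auto
  moreover have "?S \<subseteq> reg (idx S)"
    using reg by blast
  ultimately show ?thesis
    unfolding zariski_closed_iff by (intro exI[of _ ?S] conjI)
qed

subsection \<open>Generic members\<close>

definition base :: "'v \<Rightarrow> 'v set" where
  "base a = bc ` {1..N} \<union> {c2, a}"

text \<open>The constant term is chosen to make \<open>z a\<close> a root. On the variety this is
  the first polynomial, expressed in base coordinates and without \<open>c1\<close>.\<close>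

definition Fa :: "'v \<Rightarrow> ('v \<Rightarrow> 'a) \<Rightarrow> 'a poly" where
  "Fa a z = F0 z - [:poly (F0 z) (z a):]"

lemma Fa_eq: "FF c x = Fa a x" if "poly (FF c x) (x a) = 0"
proof -
  have "x c = - poly (F0 x) (x a)"
    using that by (simp add: FF_def add_eq_0_iff)
  then show ?thesis
    by (simp add: FF_def Fa_def)
qed

lemma degree_Fa: "degree (Fa a z) = d"
proof -
  have "degree [:- poly (F0 z) (z a):] < degree (F0 z)"
    using degree_F0[of z] N by simp
  then show ?thesis
    using degree_F0[of z] degree_add_eq_left[of "[:- poly (F0 z) (z a):]" "F0 z"]
    by (simp add: Fa_def diff_conv_add_uminus del: add_uminus_conv_diff)
qed

lemma pderiv_Fa: "pderiv (Fa a z) = pderiv (F0 z)"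
  by (simp add: Fa_def pderiv_diff pderiv_pCons)

text \<open>Moving along \<open>direction q\<close> adds a multiple of \<open>q\<close> to
  \<open>F0\<close> except for the constant term, which \<open>F0\<close> has no coordinate for. In
  \<open>Fa\<close> this defect cancels if \<open>q\<close> vanishes at \<open>z a\<close>
  (\<open>Fa_shift\<close>).\<close>

definition direction :: "'a poly \<Rightarrow> 'v \<Rightarrow> 'a" where
  "direction q v = (if v \<in> bc ` {1..N} then coeff q (the_inv_into {1..N} bc v) else 0)"

lemma direction_bc: "i \<in> {1..N} \<Longrightarrow> direction q (bc i) = coeff q i"
  using inj_bc by (simp add: direction_def the_inv_into_f_f)

lemma direction_other: "v \<notin> bc ` {1..N} \<Longrightarrow> direction q v = 0"
  by (simp add: direction_def)

lemma F0_shift: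
  assumes "degree q \<le> N"
  shows "F0 (\<lambda>i. z i + s * direction q i) = F0 z + smult s q - [:s * coeff q 0:]"
proof -
  have "(\<Sum>i=1..N. monom (z (bc i) + s * direction q (bc i)) i) =
      (\<Sum>i=1..N. monom (z (bc i)) i) + (\<Sum>i=1..N. monom (s * coeff q i) i)"
    by (simp add: direction_bc add_monom[symmetric] sum.distrib)
  also have "(\<Sum>i=1..N. monom (s * coeff q i) i) = smult s q - [:s * coeff q 0:]"
  proof (rule poly_eqI)
    fix n
    have "coeff (\<Sum>i=1..N. monom (s * coeff q i) i) n = (\<Sum>i=1..N. if i = n then s * coeff q i else 0)"
      by (simp add: coeff_sum)
    also have "\<dots> = (if n \<in> {1..N} then s * coeff q n else 0)"
      by simp
    also have "\<dots> = coeff (smult s q - [:s * coeff q 0:]) n"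
      using assms coeff_eq_0[of q n] by (cases n) auto
    finally show "coeff (\<Sum>i=1..N. monom (s * coeff q i) i) n = coeff (smult s q - [:s * coeff q 0:]) n" .
  qed
  finally show ?thesis
    by (simp add: F0_def)
qed

lemma Fa_shift:
  assumes "degree q \<le> N" "poly q (z a) = 0" "a \<notin> bc ` {1..N}"
  shows "Fa a (\<lambda>i. z i + s * direction q i) = Fa a z + smult s q"
  using assms F0_shift[OF assms(1), of z s] by (simp add: Fa_def direction_other)

text \<open>Three perturbations keep the power of the linear factor and \<open>g \<noteq> 0\<close>:
  one makes the derivative of the cofactor nonzero, one makes its roots simple and different from
  \<open>z a\<close>, and one moves \<open>c2\<close> until the second polynomial has simple roots.
  The case \<open>\<epsilon> = 1\<close> serves separability, \<open>\<epsilon> = 2\<close> the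
  critical hypersurface.\<close>

lemma generic_member:
  assumes a: "a \<in> A1" and \<epsilon>: "\<epsilon> \<in> {1, 2}" and zi: "zi \<in> affine_space (base a)"
    and dvd: "[:- zi a, 1:] ^ \<epsilon> dvd Fa a zi" and g: "g \<in> reg (base a)" "g zi \<noteq> 0"
  shows "\<exists>z\<in>affine_space (base a). g z \<noteq> 0 \<and> (\<exists>H. Fa a z = [:- z a, 1:] ^ \<epsilon> * H \<and>
    poly H (z a) \<noteq> 0 \<and> (\<forall>y. poly H y = 0 \<longrightarrow> poly (pderiv H) y \<noteq> 0)) \<and>
    (\<forall>y. poly (FF c2 z) y = 0 \<longrightarrow> poly (pderiv (F0 z)) y \<noteq> 0)"
proof -
  have a': "a \<notin> bc ` {1..N}" "a \<noteq> c2"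
    using a disj by auto
  define x where "x = zi a"
  let ?l = "[:- x, 1:]"
  obtain H0 where H0: "Fa a zi = ?l ^ \<epsilon> * H0"
    using dvd unfolding x_def by (elim dvdE)
  have q: "degree (?l ^ k) \<le> N" "poly (?l ^ k) x = 0" if "k \<in> {1, 2, 3}" for k
    using that N degree_linear_power[of "- x" k] by (auto simp: poly_power)
  \<comment> \<open>Adding \<open>s\<close> times the linear factor to \<open>H0\<close> adds
    \<open>s\<close> to its derivative; the excluded value is the one that would annihilate the
    constant coefficient.\<close>
  have "finite {- coeff (pderiv H0) 0}"
    by simp
  from finite_exceptions[where g = g and z = zi and w = "direction (?l ^ Suc \<epsilon>)", OF g this]
  obtain s where s: "s \<notin> {- coeff (pderiv H0) 0}" "g (\<lambda>i. zi i + s * direction (?l ^ Suc \<epsilon>) i) \<noteq> 0"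
    by (elim exE conjE)
  define z1 where "z1 = (\<lambda>i. zi i + s * direction (?l ^ Suc \<epsilon>) i)"
  define H1 where "H1 = H0 + smult s ?l"
  have z1: "Fa a z1 = ?l ^ \<epsilon> * H1" "z1 a = x"
  proof -
    have "Suc \<epsilon> \<in> {1, 2, 3}"
      using \<epsilon> by auto
    from q[OF this] have q1: "degree (?l ^ Suc \<epsilon>) \<le> N" and q2: "poly (?l ^ Suc \<epsilon>) (zi a) = 0"
      by (simp_all only: x_def)
    have "Fa a z1 = Fa a zi + smult s (?l ^ Suc \<epsilon>)"
      unfolding z1_def by (rule Fa_shift[where z = zi and a = a, OF q1 q2 a'(1)])
    then show "Fa a z1 = ?l ^ \<epsilon> * H1"
      by (simp only: H0 H1_def power_Suc2 distrib_left mult_smult_right)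
    show "z1 a = x"
      using a' by (simp add: z1_def x_def direction_other)
  qed
  have "pderiv H1 = pderiv H0 + [:s:]"
    by (simp add: H1_def pderiv_add pderiv_smult pderiv_pCons)
  then have "coeff (pderiv H1) 0 \<noteq> 0"
    using s(1) by (simp add: add_eq_0_iff)
  then have H1: "pderiv H1 \<noteq> 0"
    by auto
  \<comment> \<open>Adding \<open>t\<close> to \<open>H1\<close> leaves the derivative alone, so
    only those \<open>t\<close> are excluded that create a zero at \<open>x\<close> or at one of the
    finitely many zeros of \<open>pderiv H1\<close>.\<close>
  let ?E = "insert (- poly H1 x) ((\<lambda>y. - poly H1 y) ` {y. poly (pderiv H1) y = 0})"
  have "finite ?E"
    using H1 by (simp add: poly_roots_finite)
  have "g z1 \<noteq> 0"
    unfolding z1_def by (rule s(2))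
  from finite_exceptions[where g = g and z = z1 and w = "direction (?l ^ \<epsilon>)", OF g(1) this \<open>finite ?E\<close>]
  obtain t where t: "t \<notin> ?E" "g (\<lambda>i. z1 i + t * direction (?l ^ \<epsilon>) i) \<noteq> 0"
    by (elim exE conjE)
  define z2 where "z2 = (\<lambda>i. z1 i + t * direction (?l ^ \<epsilon>) i)"
  define H where "H = H1 + [:t:]"
  have z2: "Fa a z2 = ?l ^ \<epsilon> * H" "z2 a = x"
  proof -
    have "\<epsilon> \<in> {1, 2, 3}"
      using \<epsilon> by auto
    from q[OF this] have q1: "degree (?l ^ \<epsilon>) \<le> N" and q2: "poly (?l ^ \<epsilon>) (z1 a) = 0"
      by (simp_all only: z1(2))
    have "Fa a z2 = Fa a z1 + smult t (?l ^ \<epsilon>)"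
      unfolding z2_def by (rule Fa_shift[where z = z1 and a = a, OF q1 q2 a'(1)])
    then show "Fa a z2 = ?l ^ \<epsilon> * H"
      by (simp only: z1 H_def distrib_left) simp
    show "z2 a = x"
      using a' z1 by (simp add: z2_def direction_other)
  qed
  have Hx: "poly H x \<noteq> 0"
    using t(1) by (auto simp: H_def add_eq_0_iff)
  have Hsep: "poly (pderiv H) y \<noteq> 0" if "poly H y = 0" for y
  proof
    assume "poly (pderiv H) y = 0"
    then have "poly (pderiv H1) y = 0"
      by (simp add: H_def pderiv_add pderiv_pCons)
    moreover have "t = - poly H1 y"
      using that by (simp add: H_def add_eq_0_iff)
    ultimately show False
      using t(1) by blast
  qed
  have "H \<noteq> 0"
    using Hx by auto
  \<comment> \<open>The cofactor has positive degree, hence a root \<open>y\<close>. This root is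
    simple and differs from \<open>x\<close>, so the derivative of the whole product is nonzero at
    \<open>y\<close>, and the common derivative is not the zero polynomial.\<close>
  have "d = degree (?l ^ \<epsilon> * H)"
    using degree_Fa[of a z2] z2(1) by simp
  also have "\<dots> = \<epsilon> + degree H"
    using \<open>H \<noteq> 0\<close> by (subst degree_mult_eq) (auto simp: degree_linear_power)
  finally have "degree H > 0"
    using N \<epsilon> by auto
  then obtain y where y: "poly H y = 0"
    using alg_closed_imp_poly_has_root by blast
  have "pderiv (F0 z2) \<noteq> 0"
  proof
    assume "pderiv (F0 z2) = 0"
    then have "poly (pderiv (?l ^ \<epsilon> * H)) y = 0"
      using pderiv_Fa[of a z2] z2(1) by simp
    then have "(y - x) ^ \<epsilon> * poly (pderiv H) y = 0"
      using y by (simp add: pderiv_mult poly_power)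
    then show False
      using Hsep[OF y] Hx y by auto
  qed
  \<comment> \<open>The shifts of \<open>c2\<close> that would turn a zero of the common derivative
    into a root of the second polynomial.\<close>
  let ?E' = "(\<lambda>y. - (poly (F0 z2) y + z2 c2)) ` {y. poly (pderiv (F0 z2)) y = 0}"
  have "finite ?E'"
    using \<open>pderiv (F0 z2) \<noteq> 0\<close> by (simp add: poly_roots_finite)
  have "g z2 \<noteq> 0"
    unfolding z2_def by (rule t(2))
  from finite_exceptions[where g = g and z = z2 and w = "\<lambda>i. if i = c2 then 1 else 0", OF g(1) this \<open>finite ?E'\<close>]
  obtain u where u: "u \<notin> ?E'" "g (\<lambda>i. z2 i + u * (if i = c2 then 1 else 0)) \<noteq> 0"
    by (elim exE conjE)
  define z where "z = (\<lambda>i. z2 i + u * (if i = c2 then 1 else 0))"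
  have F0z: "F0 z = F0 z2"
    using disj by (intro F0_cong) (auto simp: z_def)
  have za: "z a = x"
    using a' z2 by (simp add: z_def)
  have "z \<in> affine_space (base a)"
    using zi by (auto simp: affine_space_def z_def z2_def z1_def base_def direction_other)
  moreover have "g z \<noteq> 0"
    using u(2) by (simp add: z_def)
  moreover have "Fa a z = [:- z a, 1:] ^ \<epsilon> * H"
    using z2 za by (simp add: Fa_def F0z)
  moreover have "poly (pderiv (F0 z)) y \<noteq> 0" if "poly (FF c2 z) y = 0" for y
  proof
    assume "poly (pderiv (F0 z)) y = 0"
    moreover have "z c2 = z2 c2 + u"
      by (simp add: z_def)
    then have "(poly (F0 z2) y + z2 c2) + u = 0"
      using that by (simp add: FF_def F0z add.assoc)
    then have "u = - (poly (F0 z2) y + z2 c2)"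
      by (metis minus_unique)
    ultimately show False
      using u(1) unfolding F0z by blast
  qed
  moreover have "\<forall>y. poly H y = 0 \<longrightarrow> poly (pderiv H) y \<noteq> 0" "poly H (z a) \<noteq> 0"
    using Hsep Hx za by simp_all
  ultimately show ?thesis
    by (intro bexI[of _ z] conjI exI[of _ H] allI impI) simp_all
qed

end

context polynomial_pair
begin

subsection \<open>The tower structure\<close>

lemma FF_fun_upd: "v \<notin> bc ` {1..N} \<Longrightarrow> v \<noteq> c \<Longrightarrow> FF c (x(v := t)) = FF c x"
  unfolding FF_def F0_def by (auto intro!: arg_cong2[where f = "(+)"] sum.cong)

lemma roots_fun_upd: "v \<notin> S \<Longrightarrow> roots S (x(v := t)) = roots S x"
  unfolding roots_def by (intro prod.cong) auto

lemma roots_insert: "finite S \<Longrightarrow> v \<notin> S \<Longrightarrow> roots (insert v S) x = roots S x * [:- x v, 1:]"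
  by (simp add: roots_def)

lemma mult_dvd_iff_root:
  fixes p q :: "'b::field poly"
  assumes "p dvd q" "p \<noteq> 0"
  shows "p * [:- t, 1:] dvd q \<longleftrightarrow> poly (q div p) t = 0"
proof -
  have "q = p * (q div p)"
    using assms(1) by simp
  then have "p * [:- t, 1:] dvd q \<longleftrightarrow> [:- t, 1:] dvd q div p"
    using assms(2) by (metis dvd_mult_cancel_left)
  then show ?thesis
    by (simp add: poly_eq_0_iff_dvd)
qed

lemma monic_quotient:
  fixes p g :: "'b::field poly"
  assumes "lead_coeff p = 1" "lead_coeff g = 1" "degree g \<le> degree p"
  shows "lead_coeff (p div g) = 1" "degree (p div g) = degree p - degree g"
proof -
  have nz: "g \<noteq> 0" "p \<noteq> 0"
    using assms(1,2) by auto
  then have "p div g \<noteq> 0"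
    using assms(3) by (simp add: div_poly_eq_0_iff)
  have eq: "p div g * g = p + - (p mod g)"
    using div_mult_mod_eq[of p g] by (simp add: algebra_simps)
  have small: "p mod g = 0 \<or> degree (p mod g) < degree p"
    using degree_mod_less[OF nz(1), of p] assms(3) by auto
  have "degree (p + - (p mod g)) = degree p"
  proof (rule disjE[OF small])
    assume "degree (p mod g) < degree p"
    then show ?thesis
      by (intro degree_add_eq_left) simp
  qed simp
  then have deg: "degree (p div g * g) = degree p"
    by (simp only: eq)
  then show "degree (p div g) = degree p - degree g"
    using nz \<open>p div g \<noteq> 0\<close> by (simp add: degree_mult_eq)
  have "coeff (p mod g) (degree p) = 0"
    using small by (auto intro: coeff_eq_0)
  then have "coeff (p div g * g) (degree p) = 1"
    unfolding eq using assms(1) by simp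
  then have "lead_coeff (p div g * g) = 1"
    by (simp only: deg)
  then show "lead_coeff (p div g) = 1"
    unfolding lead_coeff_mult assms(2) by simp
qed

text \<open>After splitting off the roots in \<open>S \<inter> A\<close>, the next root of the same
  polynomial satisfies this monic quotient, whose degree is constant as a tower step
  requires.\<close>

lemma quotient_family:
  assumes "S \<subseteq> A1 \<union> A2" "c \<in> {c1, c2}" "A \<in> {A1, A2}"
  shows "(\<lambda>x. FF c x div roots (S \<inter> A) x) \<in> regpoly (idx S)"
    "lead_coeff (FF c x div roots (S \<inter> A) x) = 1"
    "degree (FF c x div roots (S \<inter> A) x) = d - card (S \<inter> A)"
proof -
  have fin: "finite (S \<inter> A)" and card: "card (S \<inter> A) \<le> d"
    using assms(3) finA cardA card_mono[of A "S \<inter> A"] by auto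
  show "(\<lambda>x. FF c x div roots (S \<inter> A) x) \<in> regpoly (idx S)"
    by (rule regp_div_mod(1)[OF _ _ lead_coeff_roots degree_roots[OF fin]])
      (use assms(2) in \<open>auto simp: idx_def intro!: regpoly_FF regpoly_roots\<close>)
  have "degree (roots (S \<inter> A) x) \<le> degree (FF c x)"
    using card by (simp add: degree_roots[OF fin] degree_FF)
  from monic_quotient[OF lead_coeff_FF lead_coeff_roots this]
  show "lead_coeff (FF c x div roots (S \<inter> A) x) = 1"
    "degree (FF c x div roots (S \<inter> A) x) = d - card (S \<inter> A)"
    by (simp_all add: degree_roots[OF fin] degree_FF)
qed

lemma VV_insert:
  assumes S: "S \<subseteq> A1 \<union> A2" and v: "v \<notin> S" and c: "(c = c1 \<and> A = A1) \<or> (c = c2 \<and> A = A2)" and vA: "v \<in> A"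
  shows "VV (insert v S) = adjoin v (\<lambda>x. FF c x div roots (S \<inter> A) x) (idx S) (VV S)"
proof -
  have idx: "idx (insert v S) = insert v (idx S)"
    by (auto simp: idx_def)
  have vn: "v \<notin> bc ` {1..N}" "v \<noteq> c1" "v \<noteq> c2"
    using c vA disj by auto
  have upd: "FF c1 (x(v := 0)) = FF c1 x" "FF c2 (x(v := 0)) = FF c2 x"
      "roots (S \<inter> A1) (x(v := 0)) = roots (S \<inter> A1) x" "roots (S \<inter> A2) (x(v := 0)) = roots (S \<inter> A2) x" for x
    using vn v by (simp_all add: FF_fun_upd roots_fun_upd)
  have fin: "finite (S \<inter> A1)" "finite (S \<inter> A2)"
    using finA by auto
  have nz: "roots (S \<inter> A) x \<noteq> 0" for x
    using lead_coeff_roots[of "S \<inter> A" x] by auto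
  have "x \<in> VV (insert v S) \<longleftrightarrow> x \<in> adjoin v (\<lambda>x. FF c x div roots (S \<inter> A) x) (idx S) (VV S)" for x
  proof (cases "x \<in> affine_space (insert v (idx S))")
    case True
    then have aff: "x(v := 0) \<in> affine_space (idx S)"
      by (rule affine_space_upd_0)
    have *: "roots (S \<inter> A) x * [:- x v, 1:] dvd FF c x \<longleftrightarrow>
        roots (S \<inter> A) x dvd FF c x \<and> poly (FF c x div roots (S \<inter> A) x) (x v) = 0"
      using mult_dvd_iff_root[OF _ nz] by (metis dvd_mult_left)
    from c show ?thesis
    proof
      assume c: "c = c1 \<and> A = A1"
      then have "insert v S \<inter> A1 = insert v (S \<inter> A1)" "insert v S \<inter> A2 = S \<inter> A2"
        using vA disj by auto
      moreover have "roots (insert v (S \<inter> A1)) x = roots (S \<inter> A1) x * [:- x v, 1:]"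
        using v fin by (intro roots_insert) auto
      ultimately show ?thesis
        using * True aff c unfolding VV_def adjoin_def idx by (simp only: mem_Collect_eq upd) blast
    next
      assume c: "c = c2 \<and> A = A2"
      then have "insert v S \<inter> A2 = insert v (S \<inter> A2)" "insert v S \<inter> A1 = S \<inter> A1"
        using vA disj by auto
      moreover have "roots (insert v (S \<inter> A2)) x = roots (S \<inter> A2) x * [:- x v, 1:]"
        using v fin by (intro roots_insert) auto
      ultimately show ?thesis
        using * True aff c unfolding VV_def adjoin_def idx by (simp only: mem_Collect_eq upd) blast
    qed
  next
    case False
    then show ?thesis
      by (simp add: VV_def adjoin_def idx)
  qed
  then show ?thesis
    by blast
qed

lemma root_of_dvd: "finite S \<Longrightarrow> v \<in> S \<Longrightarrow> roots S x dvd p \<Longrightarrow> poly p (x v) = 0"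
proof -
  assume "finite S" "v \<in> S" "roots S x dvd p"
  then have "[:- x v, 1:] dvd p"
    unfolding roots_def by (meson dvd_prodI dvd_trans)
  then show ?thesis
    by (simp add: poly_eq_0_iff_dvd)
qed

lemma VV_root1: "x \<in> VV S \<Longrightarrow> v \<in> S \<Longrightarrow> v \<in> A1 \<Longrightarrow> poly (FF c1 x) (x v) = 0"
  using finA by (intro root_of_dvd[of "S \<inter> A1"]) (auto simp: VV_def)

lemma VV_root2: "x \<in> VV S \<Longrightarrow> v \<in> S \<Longrightarrow> v \<in> A2 \<Longrightarrow> poly (FF c2 x) (x v) = 0"
  using finA by (intro root_of_dvd[of "S \<inter> A2"]) (auto simp: VV_def)

lemma base_props:
  assumes "a \<in> A1"
  shows "finite (base a)" "card (base a) = N + 2" "c1 \<notin> base a"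
proof -
  have "a \<noteq> c2" "a \<notin> bc ` {1..N}"
    using assms disj by auto
  then show "finite (base a)" "card (base a) = N + 2" "c1 \<notin> base a"
    using assms disj card_image[OF inj_bc] by (auto simp: base_def)
qed

lemma F0_proj: "F0 (proj (base a) x) = F0 x"
  by (rule F0_cong) (simp add: proj_def base_def)

lemma Fa_proj: "Fa a (proj (base a) x) = Fa a x"
  by (simp add: Fa_def F0_proj) (simp add: proj_def base_def)

lemma FF_c2_proj: "FF c2 (proj (base a) x) = FF c2 x"
  by (simp add: FF_def F0_proj) (simp add: proj_def base_def)

lemma reg_family_poly_self: "p \<in> regpoly I \<Longrightarrow> v \<in> I \<Longrightarrow> (\<lambda>x. poly (p x) (x v)) \<in> reg I"
  by (rule regp_poly[OF _ reg.coord])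

text \<open>If \<open>f\<close> is nonzero at a point, \<open>tower_open\<close> gives an open
  condition on the base under which \<open>f\<close> is nonzero somewhere in the fibre.
  \<open>generic_member\<close> with exponent 1 meets this condition at a base point for which both
  polynomials have simple roots.\<close>

lemma generic_separable:
  assumes a: "a \<in> A1" and tow: "tower (base a) I V" and V: "V \<subseteq> VV S" "a \<in> S"
    and f: "f \<in> reg I"
    and f0: "\<And>x. x \<in> V \<Longrightarrow> (\<And>y. poly (FF c1 x) y = 0 \<Longrightarrow> poly (pderiv (FF c1 x)) y \<noteq> 0) \<Longrightarrow>
      (\<And>y. poly (FF c2 x) y = 0 \<Longrightarrow> poly (pderiv (FF c2 x)) y \<noteq> 0) \<Longrightarrow> f x = 0"
  shows "\<forall>x\<in>V. f x = 0"
proof (rule ccontr)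
  assume "\<not> ?thesis"
  then obtain x0 where x0: "x0 \<in> V" "f x0 \<noteq> 0"
    by blast
  have "\<exists>g\<in>reg (base a). g x0 \<noteq> 0 \<and> (\<forall>z\<in>affine_space (base a). g z \<noteq> 0 \<longrightarrow>
      (\<exists>x\<in>V. (\<forall>i\<in>base a. x i = z i) \<and> f x \<noteq> 0))"
    by (rule tower_open[where h = f, OF tow f x0])
  then obtain g where g: "g \<in> reg (base a)" "g x0 \<noteq> 0 \<and> (\<forall>z\<in>affine_space (base a). g z \<noteq> 0 \<longrightarrow>
      (\<exists>x\<in>V. (\<forall>i\<in>base a. x i = z i) \<and> f x \<noteq> 0))"
    by (elim bexE)
  let ?z0 = "proj (base a) x0"
  have gz: "g ?z0 \<noteq> 0"
    using g(2) reg_proj[OF g(1)] by simp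
  have "poly (Fa a ?z0) (?z0 a) = 0"
    by (simp add: Fa_def)
  then have dvd: "[:- ?z0 a, 1:] ^ 1 dvd Fa a ?z0"
    by (simp add: poly_eq_0_iff_dvd)
  have one: "1 \<in> {1, 2 :: nat}"
    by simp
  from generic_member[where g = g and a = a and zi = "?z0" and \<epsilon> = 1, OF a one proj_in dvd g(1) gz]
  obtain z H where z: "z \<in> affine_space (base a)" "g z \<noteq> 0" "Fa a z = [:- z a, 1:] ^ 1 * H"
    "poly H (z a) \<noteq> 0" "\<forall>y. poly H y = 0 \<longrightarrow> poly (pderiv H) y \<noteq> 0"
    "\<forall>y. poly (FF c2 z) y = 0 \<longrightarrow> poly (pderiv (F0 z)) y \<noteq> 0"
    by (elim bexE exE conjE)
  note z = z(1-4) z(5,6)[rule_format]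
  obtain x where x: "x \<in> V" "\<forall>i\<in>base a. x i = z i" "f x \<noteq> 0"
    using g(2) z(1,2) by blast
  have pz: "proj (base a) x = z"
    using x(2) proj_eq_iff[OF z(1)] by blast
  have "poly (FF c1 x) (x a) = 0"
    using VV_root1 V x(1) a by blast
  then have F1: "FF c1 x = Fa a z"
    using Fa_eq[of c1 x a] Fa_proj[of a x] pz by simp
  have "f x = 0"
  proof (rule f0[OF x(1)])
    fix y assume "poly (FF c1 x) y = 0"
    then have y: "(y - z a) * poly H y = 0"
      unfolding F1 z(3) by auto
    have "poly (pderiv (FF c1 x)) y = (y - z a) * poly (pderiv H) y + poly H y"
      unfolding F1 z(3) power_one_right pderiv_mult by (simp add: pderiv_pCons algebra_simps)
    then show "poly (pderiv (FF c1 x)) y \<noteq> 0"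
      using y z(4) z(5)[of y] by auto
  next
    fix y assume "poly (FF c2 x) y = 0"
    then show "poly (pderiv (FF c2 x)) y \<noteq> 0"
      using z(6)[of y] FF_c2_proj[of a x] F0_proj[of a x] pz pderiv_FF by simp
  qed
  then show False
    using x(3) by blast
qed

text \<open>The first step eliminates \<open>c1\<close>: the root \<open>x a\<close> determines it
  by an equation of degree 1, for which the density premise is immediate.\<close>

lemma VV_tower_start:
  assumes a: "a \<in> A1"
  shows "tower (base a) (idx {a}) (VV {a})"
proof -
  let ?G = "\<lambda>x. [:poly (F0 x) (x a), 1:]"
  have idx: "idx {a} = insert c1 (base a)"
    by (auto simp: idx_def base_def)
  have F0reg: "F0 \<in> regpoly (base a)"
    by (rule regpoly_F0) (auto simp: base_def)
  have "tower (base a) (insert c1 (base a)) (adjoin c1 ?G (base a) (affine_space (base a)))"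
  proof (rule tower.step[OF tower.base, where e = 1])
    show "c1 \<notin> base a"
      using base_props[OF a] by blast
    have "(\<lambda>x. poly (F0 x) (x a)) \<in> reg (base a)"
      by (rule reg_family_poly_self[OF F0reg]) (simp add: base_def)
    then show "?G \<in> regpoly (base a)"
      by (intro regp_pCons regp_const)
    fix f :: "('v \<Rightarrow> 'a) \<Rightarrow> 'a" assume f: "f \<in> reg (base a)"
      and f0: "\<And>x. x \<in> affine_space (base a) \<Longrightarrow> card {t. poly (?G x) t = 0} = 1 \<Longrightarrow> f x = 0"
    have "{t. poly (?G x) t = 0} = {- poly (F0 x) (x a)}" for x
      by (auto simp: add_eq_0_iff)
    then show "\<forall>x\<in>affine_space (base a). f x = 0"
      using f0 by simp
  qed simp_all
  moreover have "adjoin c1 ?G (base a) (affine_space (base a)) = VV {a}"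
  proof -
    have "{a} \<inter> A1 = {a}" "{a} \<inter> A2 = {}"
      using a disj by auto
    then have "x \<in> VV {a} \<longleftrightarrow> x \<in> affine_space (insert c1 (base a)) \<and> poly (F0 x) (x a) + x c1 = 0" for x
      unfolding VV_def idx by (simp add: roots_def poly_eq_0_iff_dvd[symmetric] FF_def)
    moreover have "x \<in> adjoin c1 ?G (base a) (affine_space (base a)) \<longleftrightarrow>
        x \<in> affine_space (insert c1 (base a)) \<and> poly (F0 x) (x a) + x c1 = 0" for x
      using affine_space_upd_0[of x c1 "base a"] by (auto simp: adjoin_def)
    ultimately show ?thesis
      by blast
  qed
  ultimately show ?thesis
    unfolding idx by simp
qed

text \<open>The density premise of each step comes from \<open>generic_separable\<close>, because
  the quotient to be adjoined divides one of the two polynomials and inherits the simplicity of its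
  roots.\<close>

lemma VV_tower:
  assumes a: "a \<in> A1" and "finite S" "S \<subseteq> A1 \<union> A2 - {a}"
  shows "tower (base a) (idx (insert a S)) (VV (insert a S))"
  using assms(2,3)
proof (induction S rule: finite_induct)
  case empty
  then show ?case
    using VV_tower_start[OF a] by simp
next
  case (insert v S)
  let ?S = "insert a S"
  have S: "?S \<subseteq> A1 \<union> A2" "v \<notin> ?S" "v \<in> A1 \<union> A2"
    using insert a by auto
  have tow: "tower (base a) (idx ?S) (VV ?S)"
    using insert by auto
  from S(3) obtain c A where cA: "(c = c1 \<and> A = A1) \<or> (c = c2 \<and> A = A2)" "v \<in> A"
    by blast
  then have cA': "c \<in> {c1, c2}" "A \<in> {A1, A2}"
    by auto
  let ?G = "\<lambda>x. FF c x div roots (?S \<inter> A) x"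
  have "v \<notin> idx ?S"
    using S disj by (auto simp: idx_def)
  have "\<forall>x\<in>VV ?S. f x = 0" if f: "f \<in> reg (idx ?S)"
    and f0: "\<And>x. x \<in> VV ?S \<Longrightarrow> card {t. poly (?G x) t = 0} = d - card (?S \<inter> A) \<Longrightarrow> f x = 0" for f
  proof (rule generic_separable[where f = f, OF a tow subset_refl insertI1 f])
    fix x assume x: "x \<in> VV ?S" "\<And>y. poly (FF c1 x) y = 0 \<Longrightarrow> poly (pderiv (FF c1 x)) y \<noteq> 0"
      "\<And>y. poly (FF c2 x) y = 0 \<Longrightarrow> poly (pderiv (FF c2 x)) y \<noteq> 0"
    have "roots (?S \<inter> A) x dvd FF c x"
      using x(1) cA unfolding VV_def by blast
    then have dvd: "?G x dvd FF c x"
      by (metis dvd_div_mult_self dvd_triv_left)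
    have "card {t. poly (?G x) t = 0} = degree (?G x)"
      by (rule separable_card_roots[OF FF_nonzero dvd]) (use x(2,3) cA' in auto)
    then show "f x = 0"
      using f0[OF x(1)] quotient_family(3)[OF S(1) cA'] by simp
  qed
  then have sep: "\<forall>x\<in>VV ?S. f x = 0" if "f \<in> reg (idx ?S)"
    "\<And>x. x \<in> VV ?S \<Longrightarrow> card {t. poly (?G x) t = 0} = d - card (?S \<inter> A) \<Longrightarrow> f x = 0" for f
    using that by blast
  have "tower (base a) (insert v (idx ?S)) (adjoin v ?G (idx ?S) (VV ?S))"
    by (rule tower.step[OF tow \<open>v \<notin> idx ?S\<close> quotient_family[OF S(1) cA']], rule sep)
  moreover have "adjoin v ?G (idx ?S) (VV ?S) = VV (insert v ?S)"
    using VV_insert[OF S(1,2) cA] by simp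
  moreover have "insert v (idx ?S) = idx (insert v ?S)"
    by (auto simp: idx_def)
  moreover have "insert v ?S = insert a (insert v S)"
    by auto
  ultimately show ?case
    by simp
qed

definition Gamma :: "('v \<Rightarrow> 'a) set" where
  "Gamma = VV (A1 \<union> A2)"

lemma Gamma_tower: "a \<in> A1 \<Longrightarrow> tower (base a) (idx (A1 \<union> A2)) Gamma"
  using VV_tower[of a "A1 \<union> A2 - {a}"] finA by (simp add: Gamma_def insert_absorb)

lemma Gamma_closed: "zariski_closed (idx (A1 \<union> A2)) Gamma"
  unfolding Gamma_def by (rule VV_closed) simp

end

lemma pderiv_sum_poly: "pderiv (\<Sum>i\<in>S. p i) = (\<Sum>i\<in>S. pderiv (p i :: 'a::idom poly))"
  by (induction S rule: infinite_finite_induct) (simp_all add: pderiv_add)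

lemma double_root_dvd:
  fixes p :: "'a::field poly"
  assumes "poly p c = 0" "poly (pderiv p) c = 0"
  shows "[:- c, 1:] ^ 2 dvd p"
proof -
  obtain q where q: "p = [:- c, 1:] * q"
    using assms(1) unfolding poly_eq_0_iff_dvd by (elim dvdE)
  have "poly q c = 0"
    using assms(2) unfolding q pderiv_mult by (simp add: pderiv_pCons)
  then have "[:- c, 1:] dvd q"
    by (simp only: poly_eq_0_iff_dvd)
  then show ?thesis
    unfolding q power2_eq_square by (rule mult_dvd_mono[OF dvd_refl])
qed

context polynomial_pair
begin

subsection \<open>Singular points\<close>

lemma idx_finite: "finite (idx (A1 \<union> A2))"
  using finA by (simp add: idx_def)

lemma direction_zero_F0:
  assumes "\<And>i. i \<in> bc ` {1..N} \<Longrightarrow> w i = 0"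
  shows "F0 (\<lambda>i. x i + s * w i) = F0 x"
  by (rule F0_cong) (use assms in auto)

lemma regpoly_Gamma:
  assumes "c \<in> {c1, c2}"
  shows "FF c \<in> regpoly (idx (A1 \<union> A2))"
  using assms by (intro regpoly_FF) (auto simp: idx_def)

text \<open>For a tangent vector \<open>w\<close> vanishing on the base, the equation of the root
  \<open>x a\<close> gives \<open>w c1 = 0\<close>, so neither polynomial varies along
  \<open>w\<close>. The equation of another root \<open>x v\<close> then says that
  \<open>w v\<close> times the derivative is zero, which settles simple roots; a double root shared
  with \<open>x a\<close> needs the quotient by the factor of \<open>x a\<close>.\<close>

lemma Gamma_nonsingular:
  assumes a: "a \<in> A1" and x: "x \<in> Gamma"
    and 1: "\<And>v. v \<in> A1 \<Longrightarrow> v \<noteq> a \<Longrightarrow> poly (pderiv (F0 x)) (x v) \<noteq> 0 \<or>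
      x v = x a \<and> (\<exists>H. FF c1 x = [:- x a, 1:] ^ 2 * H \<and> poly H (x a) \<noteq> 0)"
    and 2: "\<And>v. v \<in> A2 \<Longrightarrow> poly (pderiv (F0 x)) (x v) \<noteq> 0"
  shows "x \<notin> singular_locus (idx (A1 \<union> A2)) Gamma"
proof (rule tower_nonsingular[OF Gamma_tower[OF a] Gamma_closed x base_props(1)[OF a]])
  let ?I = "idx (A1 \<union> A2)"
  fix w assume w: "w \<in> tangent_space ?I Gamma x" and w0: "\<And>i. i \<in> base a \<Longrightarrow> w i = 0"
  have wbc: "w i = 0" if "i \<in> bc ` {1..N}" for i
    using w0 that by (simp add: base_def)
  have wa: "w a = 0" "w c2 = 0"
    using w0 by (simp_all add: base_def)
  have aI: "a \<in> ?I" and vI: "\<And>v. v \<in> A1 \<union> A2 \<Longrightarrow> v \<in> ?I"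
    using a by (auto simp: idx_def)
  note D = tangent_spaceD[OF idx_finite w]
  have F0w: "F0 (\<lambda>i. x i + s * w i) = F0 x" for s
    by (rule direction_zero_F0) (rule wbc)
  have wc1: "w c1 = 0"
  proof -
    let ?f = "\<lambda>x. poly (FF c1 x) (x a)"
    have "dir_deriv ?f x w = 0"
      using a by (intro D reg_family_poly_self regpoly_Gamma aI) (auto simp: Gamma_def intro: VV_root1)
    moreover have "dir_deriv ?f x w = coeff [:?f x, w c1:] 1"
      by (rule dir_deriv_eqI) (simp add: FF_def F0w wa)
    ultimately show ?thesis
      by simp
  qed
  have F1w: "FF c1 (\<lambda>i. x i + s * w i) = FF c1 x" and F2w: "FF c2 (\<lambda>i. x i + s * w i) = FF c2 x" for s
    by (simp_all add: FF_def F0w wa wc1)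
  have w2: "w v = 0" if v: "v \<in> A2" for v
  proof -
    let ?f = "\<lambda>x. poly (FF c2 x) (x v)"
    have "dir_deriv ?f x w = 0"
      using v by (intro D reg_family_poly_self regpoly_Gamma vI) (auto simp: Gamma_def intro: VV_root2)
    moreover have "dir_deriv ?f x w = w v * poly (pderiv (FF c2 x)) (x v)"
      by (rule dir_deriv_poly_const) (simp add: F2w)
    ultimately show ?thesis
      using 2[OF v] by (simp add: pderiv_FF)
  qed
  have w1: "w v = 0" if v: "v \<in> A1" "v \<noteq> a" for v
    using 1[OF v]
  proof
    assume nz: "poly (pderiv (F0 x)) (x v) \<noteq> 0"
    let ?f = "\<lambda>x. poly (FF c1 x) (x v)"
    have "dir_deriv ?f x w = 0"
      using v by (intro D reg_family_poly_self regpoly_Gamma vI) (auto simp: Gamma_def intro: VV_root1)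
    moreover have "dir_deriv ?f x w = w v * poly (pderiv (FF c1 x)) (x v)"
      by (rule dir_deriv_poly_const) (simp add: F1w)
    ultimately show ?thesis
      using nz by (simp add: pderiv_FF)
  next
    assume "x v = x a \<and> (\<exists>H. FF c1 x = [:- x a, 1:] ^ 2 * H \<and> poly H (x a) \<noteq> 0)"
    then obtain H where H: "x v = x a" "FF c1 x = [:- x a, 1:] ^ 2 * H" "poly H (x a) \<noteq> 0"
      by blast
    \<comment> \<open>As \<open>v \<noteq> a\<close>, both linear factors divide the polynomial on
      all of \<open>Gamma\<close>, so \<open>x v\<close> is a root of this quotient. At
      \<open>x\<close> the derivative of the quotient at that root is the value of \<open>H\<close>
      at \<open>x a\<close>, which is nonzero.\<close>
    let ?q = "\<lambda>x. FF c1 x div [:- x a, 1:]"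
    let ?f = "\<lambda>x. poly (?q x) (x v)"
    have q: "?q \<in> regpoly ?I"
    proof (rule regp_div_mod(1)[where e = 1])
      show "FF c1 \<in> regpoly ?I"
        by (rule regpoly_Gamma) simp
      show "(\<lambda>x. [:- x a, 1:]) \<in> regpoly ?I"
        by (intro regp_pCons regp_const reg_uminus reg.coord aI)
    qed simp_all
    have "?f y = 0" if y: "y \<in> Gamma" for y
    proof -
      have "roots A1 y dvd FF c1 y"
        using y disj by (simp add: Gamma_def VV_def Int_Un_distrib2 Int_commute)
      moreover have "roots {a, v} y dvd roots A1 y"
        unfolding roots_def using a v finA by (intro prod_dvd_prod_subset) auto
      ultimately have "[:- y a, 1:] * [:- y v, 1:] dvd FF c1 y"
        using v(2) unfolding roots_def by (auto intro: dvd_trans)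
      moreover from this have "[:- y a, 1:] dvd FF c1 y"
        by (rule dvd_mult_left)
      ultimately show ?thesis
        using mult_dvd_iff_root[of "[:- y a, 1:]" "FF c1 y" "y v"] by simp
    qed
    then have "dir_deriv ?f x w = 0"
      using v by (intro D reg_family_poly_self[OF q] vI) auto
    moreover have "dir_deriv ?f x w = w v * poly (pderiv (?q x)) (x v)"
      by (rule dir_deriv_poly_const) (simp add: F1w wa)
    moreover have "?q x = [:- x a, 1:] * H"
      unfolding H(2) power2_eq_square mult.assoc by (rule nonzero_mult_div_cancel_left) simp
    moreover have "poly (pderiv ([:- x a, 1:] * H)) (x v) = poly H (x a)"
      unfolding H(1) pderiv_mult by (simp add: pderiv_pCons)
    ultimately show ?thesis
      using H(3) by simp
  qed
  show "w = (\<lambda>i. 0)"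
  proof
    fix i
    have "i \<notin> ?I \<Longrightarrow> w i = 0"
      using w by (simp add: tangent_space_def affine_space_def)
    then show "w i = 0"
      using wbc wa wc1 w1 w2 by (cases "i \<in> ?I"; cases "i = a") (auto simp: idx_def)
  qed
qed

text \<open>The equation of this hypersurface can be solved for the coordinate \<open>bc 1\<close>, so it is
  irreducible.\<close>

definition crit :: "'v \<Rightarrow> ('v \<Rightarrow> 'a) set" where
  "crit a = {z\<in>affine_space (base a). poly (pderiv (F0 z)) (z a) = 0}"

text \<open>What remains of the derivative at \<open>z a\<close> after removing its term
  \<open>z (bc 1)\<close>.\<close>

definition crit_eq :: "'v \<Rightarrow> ('v \<Rightarrow> 'a) \<Rightarrow> 'a" where
  "crit_eq a z = poly (pderiv T0) (z a) + (\<Sum>i=2..N. of_nat i * z (bc i) * z a ^ (i - 1))"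

lemma poly_pderiv_F0: "poly (pderiv (F0 z)) (z a) = crit_eq a z + z (bc 1)"
proof -
  have split: "{1..N} = insert 1 {2..N}"
    using N by auto
  have "pderiv (F0 z) = pderiv T0 + (\<Sum>i=1..N. pderiv (monom (z (bc i)) i))"
    by (simp add: F0_def pderiv_add pderiv_sum_poly)
  then have "poly (pderiv (F0 z)) (z a) =
      poly (pderiv T0) (z a) + (\<Sum>i=1..N. of_nat i * z (bc i) * z a ^ (i - 1))"
    by (simp add: poly_sum pderiv_monom poly_monom)
  also have "(\<Sum>i=1..N. of_nat i * z (bc i) * z a ^ (i - 1)) =
      z (bc 1) + (\<Sum>i=2..N. of_nat i * z (bc i) * z a ^ (i - 1))"
    unfolding split by (subst sum.insert) auto
  finally show ?thesis
    by (simp add: crit_eq_def)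
qed

lemma crit_eq_reg: "crit_eq a \<in> reg (base a - {bc 1})" if "a \<in> A1"
proof -
  have "bc 1 \<in> bc ` {1..N}"
    using N by (intro imageI) simp
  then have "a \<noteq> bc 1"
    using that disj(7) by blast
  then have a: "a \<in> base a - {bc 1}"
    by (simp add: base_def)
  have "bc i \<noteq> bc 1" if "i \<in> {2..N}" for i
    using that N inj_onD[OF inj_bc, of i 1] by auto
  then have b: "bc i \<in> base a - {bc 1}" if "i \<in> {2..N}" for i
    using that by (auto simp: base_def)
  have "(\<lambda>z. poly (pderiv T0) (z a) + (\<Sum>i=2..N. of_nat i * z (bc i) * z a ^ (i - 1))) \<in> reg (base a - {bc 1})"
    by (intro reg.add reg_sum reg.mult reg_power reg.const reg.coord a b reg_family_poly_self[OF regp_const])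
  then show ?thesis
    by (simp add: crit_eq_def[abs_def])
qed

lemma crit_iff: "z \<in> crit a \<longleftrightarrow> z \<in> affine_space (base a) \<and> z (bc 1) = - crit_eq a z"
  by (simp add: crit_def poly_pderiv_F0 add_eq_0_iff)

lemma bc1_base: "bc 1 \<in> base a"
  using N by (simp add: base_def)

lemma crit_eq_upd: "a \<in> A1 \<Longrightarrow> crit_eq a (z(bc 1 := t)) = crit_eq a z"
  by (rule reg_fun_upd[OF crit_eq_reg]) auto

text \<open>\<open>crit a\<close> is the graph of \<open>- crit_eq a\<close> over the remaining base
  coordinates: two points are joined by a line in these, with the coordinate \<open>bc 1\<close>
  following polynomially.\<close>

lemma prime_set_crit:
  assumes a: "a \<in> A1"
  shows "prime_set (base a) (crit a)"
proof (rule prime_set_paths)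
  have "(\<lambda>i. 0)(bc 1 := - crit_eq a (\<lambda>i. 0)) \<in> crit a"
    using bc1_base[of a] crit_eq_upd[OF a] by (simp add: crit_iff affine_space_def)
  then show "crit a \<noteq> {}"
    by blast
  fix p q assume pq: "p \<in> crit a" "q \<in> crit a"
  let ?L = "\<lambda>s i. p i + s * (q i - p i)"
  have "\<exists>P. \<forall>s. poly P s = crit_eq a (\<lambda>i. p i + s * (q i - p i))"
    by (rule reg_line[OF crit_eq_reg[OF a]])
  then obtain P where P: "\<And>s. poly P s = crit_eq a (?L s)"
    by blast
  define \<gamma> where "\<gamma> = (\<lambda>i. [:p i, q i - p i:])(bc 1 := - P)"
  have \<gamma>: "(\<lambda>i. poly (\<gamma> i) s) = (?L s)(bc 1 := - crit_eq a (?L s))" for s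
    by (auto simp: \<gamma>_def P)
  have "(?L s)(bc 1 := - crit_eq a (?L s)) \<in> crit a" for s
    using pq bc1_base[of a] by (simp only: crit_iff crit_eq_upd[OF a]) (auto simp: affine_space_def)
  moreover have "(?L 0)(bc 1 := - crit_eq a (?L 0)) = p" "(?L 1)(bc 1 := - crit_eq a (?L 1)) = q"
    using pq by (auto simp: crit_iff)
  ultimately show "\<exists>\<gamma>. (\<forall>s. (\<lambda>i. poly (\<gamma> i) s) \<in> crit a) \<and>
      (\<lambda>i. poly (\<gamma> i) 0) = p \<and> (\<lambda>i. poly (\<gamma> i) 1) = q"
    by (intro exI[of _ \<gamma>]) (simp only: \<gamma> simp_thms)
qed

lemma critical_reg: "a \<in> A1 \<Longrightarrow> (\<lambda>z. crit_eq a z + z (bc 1)) \<in> reg (base a)"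
  by (intro reg.add reg_mono[OF crit_eq_reg] reg.coord bc1_base) auto

text \<open>The inclusions are strict because lifts dominate what they lie over: above a generic
  critical point \<open>Z1\<close> has a nonsingular point, which is not in \<open>Y\<close>, and
  \<open>Z2\<close> has a point where the derivative at the coordinate \<open>a\<close> is
  nonzero.\<close>

lemma singular_chain:
  assumes a: "a \<in> A1" and Y: "irreducible_closed (idx (A1 \<union> A2)) Y"
    "Y \<subseteq> singular_locus (idx (A1 \<union> A2)) Gamma" "\<And>y. y \<in> Y \<Longrightarrow> poly (pderiv (F0 y)) (y a) = 0"
  shows "\<exists>Z1 Z2. irreducible_closed (idx (A1 \<union> A2)) Z1 \<and> irreducible_closed (idx (A1 \<union> A2)) Z2 \<and>
    Y \<subset> Z1 \<and> Z1 \<subset> Z2 \<and> Z2 \<subseteq> Gamma"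
proof -
  let ?I = "idx (A1 \<union> A2)"
  let ?D = "\<lambda>z. crit_eq a z + z (bc 1)"
  note tow = Gamma_tower[OF a]
  have YG: "Y \<subseteq> Gamma"
    using Y(2) by (auto simp: singular_locus_def)
  have Dproj: "?D (proj (base a) y) = ?D y" for y
    by (rule reg_proj[OF critical_reg[OF a]])
  have WR: "crit a \<subseteq> affine_space (base a)"
    by (auto simp: crit_def)
  have YW: "proj (base a) ` Y \<subseteq> crit a"
    using Y(3) Dproj by (auto simp: crit_def poly_pderiv_F0)
  from tower_lift_closed[OF tow Gamma_closed WR prime_set_crit[OF a] Y(1) YG YW]
  obtain Z1 g where Z1: "irreducible_closed ?I Z1" "Y \<subseteq> Z1" "Z1 \<subseteq> Gamma"
    "\<forall>f\<in>reg (base a). (\<forall>w\<in>crit a. f w = 0) \<longrightarrow> (\<forall>z\<in>Z1. f z = 0)"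
    and g: "g \<in> reg (base a)" "\<exists>w\<in>crit a. g w \<noteq> 0"
    "\<forall>w\<in>crit a. g w \<noteq> 0 \<longrightarrow> (\<exists>z\<in>Z1. proj (base a) z = w)"
    by (elim exE conjE)
  note Z1 = Z1(1-3) Z1(4)[rule_format] and g = g(1,2) g(3)[rule_format]
  have D0: "?D z = 0" if "z \<in> Z1" for z
    by (rule Z1(4)[where f = ?D, OF critical_reg[OF a] _ that]) (simp add: crit_iff)
  obtain zi where zi: "zi \<in> crit a" "g zi \<noteq> 0"
    using g(2) by blast
  have zaff: "zi \<in> affine_space (base a)"
    using zi(1) by (simp add: crit_def)
  have "poly (pderiv (Fa a zi)) (zi a) = 0" "poly (Fa a zi) (zi a) = 0"
    using zi(1) by (simp_all add: crit_def pderiv_Fa) (simp add: Fa_def)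
  then have dvd: "[:- zi a, 1:] ^ 2 dvd Fa a zi"
    by (rule double_root_dvd[rotated])
  have two: "2 \<in> {1, 2 :: nat}"
    by simp
  from generic_member[where g = g and a = a and zi = zi and \<epsilon> = 2, OF a two zaff dvd g(1) zi(2)]
  obtain z H where z: "z \<in> affine_space (base a)" "g z \<noteq> 0" "Fa a z = [:- z a, 1:] ^ 2 * H"
    "poly H (z a) \<noteq> 0" "\<forall>y. poly H y = 0 \<longrightarrow> poly (pderiv H) y \<noteq> 0"
    "\<forall>y. poly (FF c2 z) y = 0 \<longrightarrow> poly (pderiv (F0 z)) y \<noteq> 0"
    by (elim bexE exE conjE)
  \<comment> \<open>At \<open>y = z a\<close> this shows that \<open>z\<close> is critical; at a
    root of \<open>H\<close> it reduces to the square of \<open>y - z a\<close> times the derivative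
    of \<open>H\<close>, so such roots stay simple.\<close>
  have dF: "poly (pderiv (F0 z)) y = (y - z a) * (2 * poly H y + (y - z a) * poly (pderiv H) y)" for y
    unfolding pderiv_Fa[of a z, symmetric] z(3) power2_eq_square pderiv_mult
    by (simp add: pderiv_pCons algebra_simps)
  have "z \<in> crit a"
    using z(1) dF[of "z a"] by (simp add: crit_def)
  then obtain x where x: "x \<in> Z1" "proj (base a) x = z"
    using g(3) z(2) by blast
  have xG: "x \<in> Gamma"
    using x(1) Z1(3) by blast
  have xa: "x a = z a"
    using x(2) by (auto simp: proj_def base_def)
  have F0x: "F0 x = F0 z"
    using F0_proj[of a x] x(2) by simp
  have "poly (FF c1 x) (x a) = 0"
    using xG a by (intro VV_root1[of x "A1 \<union> A2"]) (auto simp: Gamma_def)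
  then have F1: "FF c1 x = [:- z a, 1:] ^ 2 * H"
    using Fa_eq[of c1 x a] Fa_proj[of a x] x(2) z(3) by simp
  have F2: "FF c2 x = FF c2 z"
    using FF_c2_proj[of a x] x(2) by simp
  have "x \<notin> singular_locus ?I Gamma"
  proof (rule Gamma_nonsingular[OF a xG])
    fix v assume v: "v \<in> A1" "v \<noteq> a"
    have "poly (FF c1 x) (x v) = 0"
      using xG v by (intro VV_root1[of x "A1 \<union> A2"]) (auto simp: Gamma_def)
    then have r: "x v = z a \<or> poly H (x v) = 0"
      unfolding F1 by (auto simp: poly_power)
    show "poly (pderiv (F0 x)) (x v) \<noteq> 0 \<or>
        x v = x a \<and> (\<exists>H. FF c1 x = [:- x a, 1:] ^ 2 * H \<and> poly H (x a) \<noteq> 0)"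
    proof (cases "x v = z a")
      case True
      then show ?thesis
        using F1 z(4) xa by auto
    next
      case False
      then have "poly H (x v) = 0" "poly (pderiv H) (x v) \<noteq> 0"
        using r z(5) by auto
      then show ?thesis
        using False unfolding F0x dF by simp
    qed
  next
    fix v assume v: "v \<in> A2"
    have "poly (FF c2 x) (x v) = 0"
      using xG v by (intro VV_root2[of x "A1 \<union> A2"]) (auto simp: Gamma_def)
    then show "poly (pderiv (F0 x)) (x v) \<noteq> 0"
      using z(6) unfolding F2 F0x by blast
  qed
  then have "x \<notin> Y"
    using Y(2) by blast
  then have YZ: "Y \<subset> Z1"
    using Z1(2) x(1) by blast
  have "prime_set (base a) (affine_space (base a) :: ('v \<Rightarrow> 'a) set)"
  proof (rule prime_set_lines)
    show "affine_space (base a) \<noteq> ({} :: ('v \<Rightarrow> 'a) set)"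
      using proj_in by blast
  qed (simp add: affine_space_def)
  have "proj (base a) ` Z1 \<subseteq> affine_space (base a)"
    by auto
  from tower_lift_closed[OF tow Gamma_closed subset_refl \<open>prime_set (base a) (affine_space (base a))\<close> Z1(1,3) this]
  obtain Z2 g' where Z2: "irreducible_closed ?I Z2" "Z1 \<subseteq> Z2" "Z2 \<subseteq> Gamma"
    and g': "g' \<in> reg (base a)" "\<exists>w\<in>affine_space (base a). g' w \<noteq> 0"
    "\<forall>w\<in>affine_space (base a). g' w \<noteq> 0 \<longrightarrow> (\<exists>z\<in>Z2. proj (base a) z = w)"
    by (elim exE conjE)
  have "\<exists>w\<in>affine_space (base a). ?D w \<noteq> 0"
  proof -
    let ?w = "(\<lambda>i. 0)(bc 1 := 1 - crit_eq a (\<lambda>i. 0))"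
    have "?D ?w = 1"
      unfolding crit_eq_upd[OF a] by simp
    moreover have "?w \<in> affine_space (base a)"
      using bc1_base[of a] by (auto simp: affine_space_def)
    ultimately show ?thesis
      by (intro bexI[of _ ?w]) simp_all
  qed
  then have "\<exists>w\<in>affine_space (base a). g' w \<noteq> 0 \<and> ?D w \<noteq> 0"
    by (rule prime_set_two[where g = g' and h = ?D, OF \<open>prime_set (base a) (affine_space (base a))\<close> g'(1)
        critical_reg[OF a] g'(2)])
  then obtain w where w: "w \<in> affine_space (base a)" "g' w \<noteq> 0" "?D w \<noteq> 0"
    by (elim bexE conjE)
  then obtain y where y: "y \<in> Z2" "proj (base a) y = w"
    using g'(3) by blast
  then have "y \<notin> Z1"
    using D0[of y] Dproj[of y] w(3) by auto
  then have "Z1 \<subset> Z2"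
    using Z2(2) y(1) by blast
  then show ?thesis
    using YZ Z1(1) Z2(1,3) by blast
qed

text \<open>Pointwise some root is multiple, but which one could vary. If no single \<open>v\<close>
  served all of \<open>Y\<close>, irreducibility would give a point of \<open>Y\<close> with all
  derivatives nonzero, which is nonsingular.\<close>

lemma singular_critical:
  assumes "A1 \<noteq> {}" and Y: "irreducible_closed (idx (A1 \<union> A2)) Y"
    "Y \<subseteq> singular_locus (idx (A1 \<union> A2)) Gamma"
  shows "\<exists>v\<in>A1 \<union> A2. \<forall>y\<in>Y. poly (pderiv (F0 y)) (y v) = 0"
proof (rule ccontr)
  let ?I = "idx (A1 \<union> A2)"
  let ?f = "\<lambda>v y. poly (pderiv (F0 y)) (y v)"
  assume "\<not> ?thesis"
  then have ne: "\<And>v. v \<in> A1 \<union> A2 \<Longrightarrow> \<exists>y\<in>Y. ?f v y \<noteq> 0"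
    by blast
  have "F0 \<in> regpoly ?I"
    by (rule regpoly_F0) (auto simp: idx_def)
  then have reg: "\<And>v. v \<in> A1 \<union> A2 \<Longrightarrow> ?f v \<in> reg ?I"
    by (intro reg_family_poly_self regp_pderiv) (auto simp: idx_def)
  have "prime_set ?I Y"
    using Y(1) by (simp add: irreducible_closed_iff)
  have "\<exists>y\<in>Y. \<forall>v\<in>A1 \<union> A2. ?f v y \<noteq> 0"
    by (rule prime_set_prod[OF \<open>prime_set ?I Y\<close>]) (use finA ne reg in auto)
  then obtain y where y: "y \<in> Y" "\<forall>v\<in>A1 \<union> A2. ?f v y \<noteq> 0"
    by blast
  obtain a where a: "a \<in> A1"
    using assms(1) by blast
  have "y \<in> Gamma"
    using y(1) Y(2) by (auto simp: singular_locus_def)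
  have "y \<notin> singular_locus ?I Gamma"
    by (rule Gamma_nonsingular[OF a \<open>y \<in> Gamma\<close>]) (use y(2) in auto)
  then show False
    using y(1) Y(2) by blast
qed

end

lemma (in polynomial_pair) codim_singular_locus:
  assumes "A1 \<noteq> {}"
  shows "2 \<le> codim (idx (A1 \<union> A2)) Gamma (singular_locus (idx (A1 \<union> A2)) Gamma)"
proof (rule two_le_codim)
  interpret sw: polynomial_pair d N T0 bc c2 c1 A2 A1
    by (rule polynomial_pair_swap)
  have idxsw: "sw.idx (A2 \<union> A1) = idx (A1 \<union> A2)"
    by (auto simp: sw.idx_def idx_def)
  have Gsw: "sw.Gamma = Gamma"
    unfolding sw.Gamma_def Gamma_def sw.VV_def VV_def idxsw
    unfolding Un_commute[of A2 A1] by (intro Collect_cong) blast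
  fix Y assume Y: "irreducible_closed (idx (A1 \<union> A2)) Y" "Y \<subseteq> singular_locus (idx (A1 \<union> A2)) Gamma"
  obtain v where v: "v \<in> A1 \<union> A2" "\<And>y. y \<in> Y \<Longrightarrow> poly (pderiv (F0 y)) (y v) = 0"
    using singular_critical[OF assms Y] by blast
  show "\<exists>Z1 Z2. irreducible_closed (idx (A1 \<union> A2)) Z1 \<and> irreducible_closed (idx (A1 \<union> A2)) Z2 \<and>
      Y \<subset> Z1 \<and> Z1 \<subset> Z2 \<and> Z2 \<subseteq> Gamma"
  proof (cases "v \<in> A1")
    case True
    then show ?thesis
      by (rule singular_chain[OF _ Y v(2)])
  next
    case False
    then have "v \<in> A2"
      using v(1) by blast
    from sw.singular_chain[OF this, unfolded idxsw Gsw, OF Y v(2)]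
    show ?thesis .
  qed
qed

section \<open>Divided differences and divisibility\<close>

lemma mp_eval_id_const: "mp_eval id y (mp_const c) = (c :: 'a::comm_semiring_1)"
  unfolding mp_const_def by (subst mp_eval_id_single[where J = "{}"]) auto

lemma mp_eval_id_var: "mp_eval id y (mp_var i) = (y i :: 'a::comm_semiring_1)"
  unfolding mp_var_def by (subst mp_eval_id_single[where J = "{i}"]) auto

lemma mp_eval_id_one: "mp_eval id y 1 = (1 :: 'a::comm_semiring_1)"
  using mp_eval_id_const[of y 1] by (simp add: mp_const_def single_one)

lemma mp_eval_id_power: "mp_eval id y (f ^ k) = mp_eval id y f ^ k" for f :: "('v, 'a::comm_semiring_1) mpoly"
  by (induction k) (simp_all only: power_0 power_Suc mp_eval_id_one mp_eval_id_mult)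

lemma mp_eval_id_prod:
  fixes f :: "'i \<Rightarrow> ('v, 'a::comm_semiring_1) mpoly"
  shows "mp_eval id y (\<Prod>i\<in>S. f i) = (\<Prod>i\<in>S. mp_eval id y (f i))"
  by (induction S rule: infinite_finite_induct) 
    (simp_all only: prod.infinite prod.empty prod.insert mp_eval_id_one mp_eval_id_mult simp_thms)

lemma mp_eval_id_diff:
  fixes f :: "('v, 'a::comm_ring_1) mpoly"
  shows "mp_eval id y (f - g) = mp_eval id y f - mp_eval id y g"
proof -
  have "mp_eval id y f = mp_eval id y (f - g) + mp_eval id y g"
    by (subst mp_eval_id_add[symmetric]) simp
  then show ?thesis
    by (simp only: add_diff_cancel_right')
qed

lemma mp_eval_id_subst:
  fixes f :: "('v, 'a::comm_semiring_1) mpoly"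
  shows "mp_eval id y (mp_eval mp_const \<sigma> f) = mp_eval id (\<lambda>i. mp_eval id y (\<sigma> i)) f"
  unfolding mp_eval_def[of mp_const] mp_eval_id_sum mp_eval_id_mult mp_eval_id_const mp_eval_id_prod mp_eval_id_power
  by (simp only: mp_eval_def[of id "\<lambda>i. mp_eval id y (\<sigma> i)"] id_apply)

text \<open>Iterated synthetic division by the linear factors of \<open>y 1\<close>,
  \<open>y 2\<close> and so on; the discarded remainders are the Newton coefficients, that is, the
  divided differences.\<close>

primrec newton_quotient :: "'a::comm_ring_1 poly \<Rightarrow> (nat \<Rightarrow> 'a) \<Rightarrow> nat \<Rightarrow> 'a poly" where
  "newton_quotient g y 0 = g"
| "newton_quotient g y (Suc i) = synthetic_div (newton_quotient g y i) (y (Suc i))"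

lemma newton_quotient_cong:
  "(\<And>j. j \<in> {1..i} \<Longrightarrow> y j = z j) \<Longrightarrow> newton_quotient g y i = newton_quotient g z i"
  by (induction i) auto

lemma poly_synthetic_div: "poly p t = (t - c) * poly (synthetic_div p c) t + poly p c" for p :: "'a::comm_ring_1 poly"
proof -
  have "poly p t = poly ([:- c, 1:] * synthetic_div p c + [:poly p c:]) t"
    by (simp only: synthetic_div_correct')
  then show ?thesis
    by (simp add: algebra_simps)
qed

text \<open>The recursion determines the value where the last two arguments differ; both sides are
  polynomial in the last argument.\<close>

lemma mp_eval_divdiff:
  fixes g :: "'a::alg_closed_field poly"
  shows "mp_eval id y (divdiff g i) = poly (newton_quotient g y i) (y (i + 1))"
proof (induction i arbitrary: y)
  case 0
  then show ?case
    by (simp only: divdiff.simps mp_eval_id_sum mp_eval_id_mult mp_eval_id_const mp_eval_id_power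
        mp_eval_id_var newton_quotient.simps poly_altdef add_0)
next
  case (Suc i)
  let ?q = "newton_quotient g y i" and ?c = "y (i + 1)"
  let ?e = "\<lambda>t. mp_eval id (y(i + 2 := t)) (divdiff g (Suc i))"
  have "(\<lambda>x. mp_eval id x (divdiff g (Suc i))) \<in> reg UNIV"
    by (rule mp_eval_in_reg) (simp add: mp_vars_in_def)
  from reg_path[OF this, of "\<lambda>j. if j = i + 2 then [:0, 1:] else [:y j:]"]
  obtain P where "\<forall>t. mp_eval id (\<lambda>j. poly (if j = i + 2 then [:0, 1:] else [:y j:]) t) (divdiff g (Suc i)) = poly P t"
    by (elim exE)
  moreover have "(\<lambda>j. poly (if j = i + 2 then [:0, 1:] else [:y j:]) t) = y(i + 2 := t)" for t
    by auto
  ultimately have P: "?e t = poly P t" for t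
    by simp
  have "P = synthetic_div ?q ?c"
  proof (rule poly_eqI_finite[of "{?c}"])
    fix t assume "t \<notin> {?c}"
    let ?y = "y(i + 2 := t)"
    have qc: "newton_quotient g ?y i = ?q" "newton_quotient g (?y(i + 1 := t)) i = ?q"
      by (rule newton_quotient_cong; auto)+
    have y1: "?y (i + 1) = ?c" "?y (i + 2) = t" "(?y(i + 1 := t)) (i + 1) = t"
      by auto
    have subst: "(\<lambda>j. mp_eval id ?y ((mp_var(i + 1 := mp_var (i + 2))) j)) = ?y(i + 1 := t)"
      by (auto simp only: fun_eq_iff fun_upd_apply mp_eval_id_var split: if_splits)
    have "?e t * (?c - t) = mp_eval id ?y (divdiff g (Suc i) * (mp_var (i + 1) - mp_var (i + 2)))"
      by (simp only: mp_eval_id_mult mp_eval_id_diff mp_eval_id_var y1)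
    also have "\<dots> = mp_eval id ?y (divdiff g i) - mp_eval id (?y(i + 1 := t)) (divdiff g i)"
      by (simp only: divdiff_Suc mp_eval_id_diff mp_eval_id_subst subst)
    also have "\<dots> = poly ?q ?c - poly ?q t"
      unfolding Suc.IH qc y1 ..
    also have "\<dots> = poly (synthetic_div ?q ?c) t * (?c - t)"
      using poly_synthetic_div[of ?q t ?c] by (simp add: algebra_simps)
    finally show "poly P t = poly (synthetic_div ?q ?c) t"
      using \<open>t \<notin> {?c}\<close> P by simp
  qed simp
  moreover have "mp_eval id y (divdiff g (Suc i)) = poly P (y (i + 2))"
    using P[of "y (i + 2)"] by (simp only: fun_upd_triv)
  moreover have "Suc i + 1 = i + 2" "Suc i = i + 1"
    by simp_all
  ultimately show ?case
    unfolding newton_quotient.simps by (simp only: )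
qed

text \<open>The two claims need a joint induction: exactness of the division by the first
  \<open>m\<close> factors turns divisibility by one more factor into a root of
  \<open>newton_quotient g y m\<close>.\<close>

lemma newton_quotient_dvd:
  fixes g :: "'a::field poly"
  shows "((\<forall>i\<in>{1..m}. poly (newton_quotient g y (i - 1)) (y i) = 0) \<longleftrightarrow> (\<Prod>i=1..m. [:- y i, 1:]) dvd g) \<and>
    ((\<Prod>i=1..m. [:- y i, 1:]) dvd g \<longrightarrow> g = (\<Prod>i=1..m. [:- y i, 1:]) * newton_quotient g y m)"
proof (induction m)
  case (Suc m)
  let ?P = "\<Prod>i=1..m. [:- y i, 1:]" and ?q = "newton_quotient g y m" and ?l = "[:- y (Suc m), 1:]"
  have split: "(\<Prod>i=1..Suc m. [:- y i, 1:]) = ?P * ?l"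
    by (simp add: prod.nat_ivl_Suc' mult.commute)
  have nz: "?P \<noteq> 0"
    by simp
  have all: "(\<forall>i\<in>{1..Suc m}. poly (newton_quotient g y (i - 1)) (y i) = 0) \<longleftrightarrow>
      (\<forall>i\<in>{1..m}. poly (newton_quotient g y (i - 1)) (y i) = 0) \<and> poly ?q (y (Suc m)) = 0"
    by (auto simp: atLeastAtMostSuc_conv)
  have step: "?P * ?l dvd g \<longleftrightarrow> ?P dvd g \<and> poly ?q (y (Suc m)) = 0"
  proof (cases "?P dvd g")
    case True
    then have "g = ?P * ?q"
      using Suc.IH by blast
    then have "?P * ?l dvd g \<longleftrightarrow> ?l dvd ?q"
      using dvd_mult_cancel_left[of ?P ?l ?q] nz by simp
    then show ?thesis
      using True by (simp add: poly_eq_0_iff_dvd)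
  next
    case False
    then show ?thesis
      using dvd_mult_left by blast
  qed
  have "g = ?P * ?l * newton_quotient g y (Suc m)" if "?P * ?l dvd g"
  proof -
    have "g = ?P * ?q" "poly ?q (y (Suc m)) = 0"
      using that step Suc.IH by blast+
    moreover have "?q = ?l * newton_quotient g y (Suc m)"
      using synthetic_div_correct'[of "y (Suc m)" ?q] \<open>poly ?q (y (Suc m)) = 0\<close> by simp
    ultimately show ?thesis
      by (simp only: mult.assoc)
  qed
  then show ?case
    unfolding split all using Suc.IH step by blast
qed simp

lemma divdiff_vanish_iff:
  fixes g :: "'a::alg_closed_field poly"
  shows "(\<forall>i\<in>{1..m}. mp_eval id y (divdiff g (i - 1)) = 0) \<longleftrightarrow> (\<Prod>i=1..m. [:- y i, 1:]) dvd g"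
proof -
  have "(\<forall>i\<in>{1..m}. mp_eval id y (divdiff g (i - 1)) = 0) \<longleftrightarrow>
      (\<forall>i\<in>{1..m}. poly (newton_quotient g y (i - 1)) (y i) = 0)"
    unfolding mp_eval_divdiff by (intro ball_cong refl) simp
  then show ?thesis
    using newton_quotient_dvd by blast
qed

theorem theorem8p9:
  fixes a :: "nat \<Rightarrow> 'k::{field,finite}" and p q d s m n :: nat
  assumes "q = card (UNIV :: 'k set)" and "p = CHAR('k)" and "p > 2"
    and "d < q" and "s \<ge> 1"
    and "1 \<le> m" and "m \<le> d" and "1 \<le> n" and "n \<le> d"
    and "d - s + 1 \<le> m + n" and "m + n \<le> 2 * d"
    and "(d - s \<ge> 4 \<and> p > 3) \<or> (d - s \<ge> 6 \<and> p = 3)"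
  shows "codim (coords d s m n) (Gamma_star d s a m n)
    (singular_locus (coords d s m n) (Gamma_star d s a m n)) \<ge> 2"
proof -
  have ds: "d - s \<ge> 4" "d > 0"
    using assms(12) by auto
  define L where "L = (\<Sum>i=d-s..d-1. monom (to_ac (a i)) i)"
  define T0 where "T0 = monom 1 d + L"
  let ?A1 = "Alpha ` {1..m}" and ?A2 = "Beta ` {1..n}"
  have "degree L \<le> d - 1"
    unfolding L_def by (rule degree_sum_le) (auto intro: order_trans[OF degree_monom_le])
  then have L: "degree L < d"
    using ds by linarith
  then have T0: "degree T0 = d" "lead_coeff T0 = 1"
    by (simp_all add: T0_def degree_add_eq_left degree_monom_eq coeff_eq_0)
  interpret pp: polynomial_pair d "d - s - 1" T0 B B01 B02 ?A1 ?A2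
  proof unfold_locales
    show "card ?A1 \<le> d" "card ?A2 \<le> d"
      using card_image_le[of "{1..m}" Alpha] card_image_le[of "{1..n}" Beta] assms(7,9) by simp_all
    show "3 \<le> d - s - 1" "d - s - 1 < d"
      using ds by simp_all
  qed (use T0 in \<open>auto simp: inj_on_def\<close>)
  have idx: "coords d s m n = pp.idx (?A1 \<union> ?A2)"
    unfolding coords_def pp.idx_def by blast
  have F: "F_poly d s a (\<lambda>k. x (B k)) (x c) = pp.FF c x" for x c
    unfolding F_poly_def pp.FF_def pp.F0_def unfolding T0_def L_def ..
  have r1: "pp.roots ?A1 x = (\<Prod>i=1..m. [:- x (Alpha i), 1:])" for x
    unfolding pp.roots_def by (subst prod.reindex) (auto simp: inj_on_def)
  have r2: "pp.roots ?A2 x = (\<Prod>i=1..n. [:- x (Beta i), 1:])" for x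
    unfolding pp.roots_def by (subst prod.reindex) (auto simp: inj_on_def)
  have int: "(?A1 \<union> ?A2) \<inter> ?A1 = ?A1" "(?A1 \<union> ?A2) \<inter> ?A2 = ?A2"
    by auto
  have Gam: "Gamma_star d s a m n = pp.Gamma"
    unfolding Gamma_star_def pp.Gamma_def pp.VV_def idx int F r1 r2 divdiff_vanish_iff ..
  have "?A1 \<noteq> {}"
    using assms(6) by simp
  from pp.codim_singular_locus[OF this] show ?thesis
    unfolding idx Gam .
qed

end
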